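(* Let $T_2=\left(-\frac9{15},-\frac5{15}\right)\cup\left(-\frac1{15},\frac3{15}\right)$. Then $\mathcal{B}(23,6;T_2)=\mathcal{B}(23,7;T_2)=47104$. Consequently, the code $C_{1/4}$ is a tight $T_2$-avoiding spherical $7$-design.
   Context: A spherical code is a finite set $C\subset\mathbb{S}^{n-1}$; $I(C)=\{x\cdot y: x,y\in C,\ x\ne y\}$. For $T\subset[-1,1)$, $C$ is $T$-avoiding if $I(C)\cap T=\varnothing$. A spherical $\tau$-design is a spherical code $C$ such that the average over $C$ of every polynomial in $n$ variables of total degree at most $\tau$ equals its average over $\mathbb{S}^{n-1}$ with respect to normalized surface measure. $\mathcal{B}(n,\tau;T)$ is the minimum of $|C|$ over all $T$-avoiding spherical $\tau$-designs $C\subset\mathbb{S}^{n-1}$. Let $P_i^{(n)}$ be the Gegenbauer polynomials: orthogonal on $[-1,1]$ with weight $(1-t^2)^{(n-3)/2}$, $\deg P_i^{(n)}=i$, $P_i^{(n)}(1)=1$; write a real polynomial as $f=\sum_i f_iP_i^{(n)}$. Linear programming gives $\mathcal{B}(n,\tau;T)\ge f(1)/f_0$ for every real polynomial $f$ with $f\ge0$ on $[-1,1]\setminus T$, $f_0>0$, and $f_i\le0$ for all $i\ge\tau+1$. A $T$-avoiding spherical $\tau$-design $C\subset\mathbb{S}^{n-1}$ is called tight if $|C|=f(1)/f_0$ for some such $f$. The code $C_{1/4}$: let $L\subset\mathbb{S}^{23}$ be the set of the $196560$ minimal vectors of the Leech lattice rescaled to unit length. Fix $x\in L$; $C_{1/4}$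 is the set of vectors $(y-\frac14x)/\sqrt{1-\frac1{16}}$ with $y\in L$, $x\cdot y=\frac14$, regarded as a subset of the unit sphere $\mathbb{S}^{22}$ of $x^\perp\cong\mathbb{R}^{23}$. It is a spherical $7$-design with $47104$ points and inner products $-\frac35,-\frac13,-\frac1{15},\frac15,\frac7{15}$. *)

theory Defs
  imports
    "HOL-Analysis.Analysis"
    "HOL-Computational_Algebra.Polynomial"
    "HOL-Library.Numeral_Type"
begin

section \<open>Spherical codes and designs\<close>

definition spherical_code :: "(real ^ 'n) set \<Rightarrow> bool" where
  "spherical_code C \<longleftrightarrow> finite C \<and> C \<subseteq> sphere 0 1"

definition code_inner_products :: "(real ^ 'n) set \<Rightarrow> real set" where
  "code_inner_products C = {x \<bullet> y | x y. x \<in> C \<and> y \<in> C \<and> x \<noteq> y}"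

definition T_avoiding :: "real set \<Rightarrow> (real ^ 'n) set \<Rightarrow> bool" where
  "T_avoiding T C \<longleftrightarrow> code_inner_products C \<inter> T = {}"

text \<open>
  The normalized surface measure: the measure of a Borel subset \<open>A\<close> of the unit sphere is the
  volume of the cone \<open>{r *\<^sub>R x | x \<in> A, 0 < r < 1}\<close> divided by the volume of the unit ball.
  The map \<^term>\<open>sgn\<close> is \<open>x \<mapsto> x / norm x\<close>. The measure lives on the whole space and is
  concentrated on the sphere.
\<close>
definition sphere_measure :: "(real ^ 'n) measure" where
  "sphere_measure = distr (uniform_measure lborel (ball 0 1)) borel sgn"

text \<open>
  Polynomial functions of total degree at most \<open>d\<close>; the index \<open>\<alpha>\<close> of a monomial is its
  exponent vector, and there are only finitely many \<open>\<alpha>\<close> with \<open>sum \<alpha> UNIV \<le> d\<close>.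
\<close>
definition polynomials_upto :: "nat \<Rightarrow> (real ^ 'n \<Rightarrow> real) set" where
  "polynomials_upto d =
     {p. \<exists>c :: ('n \<Rightarrow> nat) \<Rightarrow> real.
           p = (\<lambda>x. \<Sum>\<alpha> | sum \<alpha> UNIV \<le> d. c \<alpha> * (\<Prod>i\<in>UNIV. (x $ i) ^ \<alpha> i))}"

text \<open>
  The empty code is not a design: for the constant polynomial \<open>1\<close> the left-hand side would
  be \<open>0 / 0 = 0\<close>.
\<close>
definition spherical_design :: "nat \<Rightarrow> (real ^ 'n) set \<Rightarrow> bool" where
  "spherical_design \<tau> C \<longleftrightarrow> spherical_code C \<and>
     (\<forall>p \<in> polynomials_upto \<tau>.
        (\<Sum>x\<in>C. p x) / real (card C) = (\<integral>x. p x \<partial>sphere_measure))"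

text \<open>
  \<open>\<B>(n, \<tau>; T)\<close>, with the dimension \<open>n\<close> given by the index type. \<^term>\<open>Inf\<close> on \<^typ>\<open>nat\<close> is
  attained on nonempty sets and is \<open>0\<close> on the empty set. Designs are nonempty, so the value is
  positive exactly if some \<open>T\<close>-avoiding design exists, and it is then the minimum.
\<close>
definition min_avoiding_design :: "'n::finite itself \<Rightarrow> nat \<Rightarrow> real set \<Rightarrow> nat" where
  "min_avoiding_design _ \<tau> T =
     Inf {card C | C :: (real ^ 'n) set. spherical_design \<tau> C \<and> T_avoiding T C}"

section \<open>Gegenbauer polynomials and tight designs\<close>

definition is_gegenbauer :: "nat \<Rightarrow> (nat \<Rightarrow> real poly) \<Rightarrow> bool" where
  "is_gegenbauer n P \<longleftrightarrow>
     (\<forall>i. degree (P i) = i \<and> poly (P i) 1 = 1) \<and>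
     (\<forall>i j. i \<noteq> j \<longrightarrow>
        integral {-1..1}
          (\<lambda>t. poly (P i) t * poly (P j) t * (1 - t\<^sup>2) powr ((real n - 3) / 2)) = 0)"

text \<open>Such a family exists and is unique for \<open>n \<ge> 2\<close>.\<close>
definition gegenbauer :: "nat \<Rightarrow> nat \<Rightarrow> real poly" where
  "gegenbauer n = (THE P. is_gegenbauer n P)"

definition gegenbauer_expansion :: "nat \<Rightarrow> real poly \<Rightarrow> (nat \<Rightarrow> real) \<Rightarrow> bool" where
  "gegenbauer_expansion n f a \<longleftrightarrow>
     finite {i. a i \<noteq> 0} \<and> f = (\<Sum>i | a i \<noteq> 0. smult (a i) (gegenbauer n i))"

definition tight_avoiding_design :: "nat \<Rightarrow> real set \<Rightarrow> (real ^ 'n) set \<Rightarrow> bool" where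
  "tight_avoiding_design \<tau> T C \<longleftrightarrow>
     spherical_design \<tau> C \<and> T_avoiding T C \<and>
     (\<exists>f a. gegenbauer_expansion CARD('n) f a \<and>
            (\<forall>t \<in> {-1..1} - T. poly f t \<ge> 0) \<and>
            a 0 > 0 \<and> (\<forall>i \<ge> \<tau> + 1. a i \<le> 0) \<and>
            real (card C) = poly f 1 / a 0)"

section \<open>The Leech lattice and the code \<open>C\<^sub>1\<^sub>/\<^sub>4\<close>\<close>

text \<open>
  The binary Golay code as the extended quadratic residue code of length 24. The coordinates
  are the points of the projective line over the field with 23 elements: \<^typ>\<open>23\<close> is the ring
  of integers modulo 23, and \<^term>\<open>None\<close> is the point at infinity. Binary words are identified
  with their supports. The code is spanned by the translates of the set of all nonsquares
  together with infinity (0 counts as a square).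
\<close>
definition nonresidues :: "23 option set" where
  "nonresidues = insert None (Some ` {n. \<not> (\<exists>k. n = k * k)})"

inductive_set golay :: "23 option set set" where
  empty: "{} \<in> golay"
| add: "W \<in> golay \<Longrightarrow> sym_diff W (map_option (\<lambda>n. n + i) ` nonresidues) \<in> golay"

text \<open>
  Conway's standard coordinates: \<open>z / \<surd>8\<close> with \<open>z\<close> integral, all coordinates congruent to
  \<open>m\<close> modulo 2, coordinate sum congruent to \<open>4m\<close> modulo 8, and for each residue class modulo 4
  the positions of the coordinates in that class form a Golay codeword.
\<close>
definition leech_lattice :: "(real ^ 23 option) set" where
  "leech_lattice =
     {(1 / sqrt 8) *\<^sub>R (\<chi> i. real_of_int (z i)) | z :: 23 option \<Rightarrow> int.
        \<exists>m \<in> {0, 1}.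
          (\<forall>i. z i mod 2 = m) \<and>
          (\<Sum>i\<in>UNIV. z i) mod 8 = (4 * m) mod 8 \<and>
          (\<forall>k \<in> {0..3}. {i. z i mod 4 = k} \<in> golay)}"

definition minimal_vectors :: "'a::real_normed_vector set \<Rightarrow> 'a set" where
  "minimal_vectors \<Lambda> = {v \<in> \<Lambda>. v \<noteq> 0 \<and> (\<forall>w \<in> \<Lambda>. w \<noteq> 0 \<longrightarrow> norm v \<le> norm w)}"

definition leech_code :: "(real ^ 23 option) set" where
  "leech_code = sgn ` minimal_vectors leech_lattice"

text \<open>The code \<open>C\<^sub>1\<^sub>/\<^sub>4\<close> based at \<open>x \<in> leech_code\<close>, as a subset of the hyperplane orthogonal to \<open>x\<close>.\<close>
definition C_quarter :: "real ^ 23 option \<Rightarrow> (real ^ 23 option) set" where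
  "C_quarter x =
     {(1 / sqrt (1 - 1 / 16)) *\<^sub>R (y - (1 / 4) *\<^sub>R x) | y. y \<in> leech_code \<and> x \<bullet> y = 1 / 4}"

text \<open>
  Linear maps that restrict to an isometric isomorphism from the orthogonal complement of \<open>x\<close>
  (of dimension 23, for \<open>x \<noteq> 0\<close>) to 23-dimensional Euclidean space.
\<close>
definition isometric_on_complement ::
    "real ^ 23 option \<Rightarrow> (real ^ 23 option \<Rightarrow> real ^ 23) \<Rightarrow> bool" where
  "isometric_on_complement x \<phi> \<longleftrightarrow>
     linear \<phi> \<and> (\<forall>v. x \<bullet> v = 0 \<longrightarrow> norm (\<phi> v) = norm v)"

definition T2 :: "real set" where
  "T2 = {-9/15 <..< -5/15} \<union> {-1/15 <..< 3/15}"

end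

theory Submission
  imports Defs "HOL-Probability.Probability_Measure" "HOL-Library.Option_ord" "HOL-Number_Theory.Cong"
begin

text \<open>
  The linear programming bound for a suitable sextic, whose roots are the five inner products of
  \<open>C\<^sub>1\<^sub>/\<^sub>4\<close> and which is negative only on \<open>T2\<close>, is 47104 already for 6-designs. For the converse one
  needs that \<open>C\<^sub>1\<^sub>/\<^sub>4\<close> is a 7-design with 47104 points. The 196560 minimal vectors of the Leech
  lattice attain the linear programming bound of an even polynomial of degree 10 with positive
  Gegenbauer coefficients in dimension 24. Equality forces all their zonal sums in degrees 2 to 10
  to vanish, so they form an 11-design. Multiplying test polynomials of degree at most 7 by a quartic
  that vanishes at all inner products except \<open>1/4\<close> and \<open>\<plusminus>1\<close> transfers the design property to
  \<open>C\<^sub>1\<^sub>/\<^sub>4\<close>. Designs are handled through their power moments \<open>\<Sum>\<^sub>x (u \<bullet> x)\<^sup>k\<close>, which determine all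
  polynomial averages by polarization.
\<close>

section \<open>The surface measure and its moments\<close>

text \<open>All counting from below is by explicit construction: at least 4096 Golay words, hence at
  least 759 octads and at least 196560 minimal vectors. The matching upper bound is the linear
  programming bound in dimension 24, so exact cardinality and vanishing zonal sums come out of the
  same equation. Of the lattice it takes only that squared norms, in integral coordinates, are
  multiples of 16 and at least 32; together with antipodality this leaves five inner products
  besides 1 and -1. The strengths fit exactly: antipodality raises 10 to 11, and the quartic filter
  costs 4 of the 11 degrees, leaving 7. The sextic has degree 6, so a 6-design evaluates its average
  exactly. Analysis on the sphere is reduced to mixed moments of two linear forms. Their recursion,
  whose denominators carry the dimension, turns reproducing kernels and design conditions into
  identities between polynomials with rational coefficients. The explicit Gegenbauer family enters
  only through the notion of tightness.\<close>

abbreviation sphere_mean :: "(real ^ 'n \<Rightarrow> real) \<Rightarrow> real" where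
  "sphere_mean p \<equiv> \<integral>z. p z \<partial>sphere_measure"

lemma space_sphere_measure [simp]: "space sphere_measure = UNIV"
  by (simp add: sphere_measure_def)

lemma sets_sphere_measure [measurable_cong, simp]: "sets sphere_measure = sets borel"
  by (simp add: sphere_measure_def)

lemma emeasure_unit_ball:
  "emeasure lborel (ball (0 :: 'a :: euclidean_space) 1) \<noteq> 0"
  "emeasure lborel (ball (0 :: 'a :: euclidean_space) 1) \<noteq> \<infinity>"
proof -
  have "measure lborel (ball (0 :: 'a) 1) > 0"
    using content_ball_pos[of 1 "0::'a"] by simp
  then show "emeasure lborel (ball (0 :: 'a) 1) \<noteq> 0"
    by (auto simp: measure_def)
  show "emeasure lborel (ball (0 :: 'a) 1) \<noteq> \<infinity>"
    using emeasure_lborel_ball_finite[of "0::'a" 1] by simp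
qed

lemma measurable_sgn [measurable]: "(sgn :: 'a :: euclidean_space \<Rightarrow> 'a) \<in> borel_measurable borel"
  unfolding sgn_div_norm by measurable

interpretation sphere: prob_space "sphere_measure :: (real ^ 'n) measure"
  unfolding sphere_measure_def
  by (intro prob_space.prob_space_distr prob_space_uniform_measure emeasure_unit_ball) simp_all

text \<open>Only the origin is mapped off the unit sphere by \<open>sgn\<close>, and a point is a
  null set.\<close>

lemma AE_sphere_norm: "AE z in (sphere_measure :: (real ^ 'n) measure). norm z = 1"
proof -
  have "AE x in lborel. x \<in> ball 0 1 \<longrightarrow> norm (sgn (x :: real ^ 'n)) = 1"
    by (rule AE_I'[of "{0}"]) (auto simp: norm_sgn)
  then have "AE x in uniform_measure lborel (ball 0 1). norm (sgn (x :: real ^ 'n)) = 1"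
    by (intro AE_uniform_measureI) auto
  then show ?thesis
    unfolding sphere_measure_def by (subst AE_distr_iff) auto
qed

text \<open>An orthogonal map preserves the ball and Lebesgue measure. The sort
  \<open>wellorder\<close> is that of \<open>measure_orthogonal_image\<close>;
  \<open>Option_ord\<close> provides it for \<open>23 option\<close>.\<close>

lemma distr_uniform_ball_orthogonal:
  fixes f :: "real ^ 'n :: {finite, wellorder} \<Rightarrow> real ^ 'n :: _"
  assumes f: "orthogonal_transformation f"
  shows "distr (uniform_measure lborel (ball 0 1)) borel f = uniform_measure lborel (ball 0 1)"
    (is "?L = ?R")
proof (rule measure_eqI)
  have f_meas [measurable]: "f \<in> borel_measurable borel"
    using f by (intro borel_measurable_continuous_onI linear_continuous_on)
      (simp add: linear_conv_bounded_linear[symmetric] orthogonal_transformation_linear)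
  show "sets ?L = sets ?R" by simp
  fix A assume "A \<in> sets ?L"
  then have A [measurable]: "A \<in> sets borel" by simp
  let ?B = "ball (0 :: real ^ 'n :: _) 1"
  define g where "g = inv f"
  have g: "orthogonal_transformation g"
    using f by (simp add: g_def orthogonal_transformation_inv)
  have gf: "g (f x) = x" and fg: "f (g x) = x" for x
    using f orthogonal_transformation_bij[OF f]
    by (auto simp: g_def bij_is_inj bij_is_surj surj_f_inv_f)
  \<comment> \<open>The preimage under \<open>f\<close> becomes an image under the inverse, so that
    \<open>measure_orthogonal_image\<close> applies.\<close>
  have pre: "?B \<inter> (f -` A) = g ` (?B \<inter> A)"
  proof -
    have nf: "norm (f x) = norm x" and ng: "norm (g x) = norm x" for x
      using f g by (auto simp: orthogonal_transformation_norm)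
    have "x \<in> g ` (?B \<inter> A)" if "norm x < 1" "f x \<in> A" for x
      using that by (intro image_eqI[of _ _ "f x"]) (auto simp: nf gf)
    then show ?thesis
      by (auto simp: ng fg)
  qed
  have fin: "?B \<inter> X \<in> lmeasurable" if "X \<in> sets borel" for X
    using that by (intro bounded_set_imp_lmeasurable bounded_Int) (auto intro!: sets.Int)
  have "emeasure lborel (?B \<inter> (f -` A)) = emeasure lborel (?B \<inter> A)"
  proof -
    have m: "f -` A \<in> sets borel"
      using measurable_sets[OF f_meas A] by simp
    have "measure lebesgue (?B \<inter> (f -` A)) = measure lebesgue (?B \<inter> A)"
      unfolding pre using measure_orthogonal_image[OF g fin[OF A]] .
    moreover have "emeasure lborel (?B \<inter> X) = ennreal (measure lebesgue (?B \<inter> X))"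
      if "X \<in> sets borel" for X
      using fin[OF that] that
      by (subst emeasure_eq_measure2[symmetric]) (simp_all add: sets.Int)
    ultimately show ?thesis using A m by simp
  qed
  then show "emeasure ?L A = emeasure ?R A"
    by (subst emeasure_distr) (auto simp: measurable_sets[OF f_meas A, simplified])
qed

lemma distr_sphere_orthogonal:
  fixes f :: "real ^ 'n :: {finite, wellorder} \<Rightarrow> real ^ 'n :: _"
  assumes f: "orthogonal_transformation f"
  shows "distr sphere_measure borel f = sphere_measure"
proof -
  have f_meas [measurable]: "f \<in> borel_measurable borel"
    using f by (intro borel_measurable_continuous_onI linear_continuous_on)
      (simp add: linear_conv_bounded_linear[symmetric] orthogonal_transformation_linear)
  let ?U = "uniform_measure lborel (ball (0 :: real ^ 'n :: _) 1)"
  have comm: "f \<circ> sgn = sgn \<circ> f"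
    using f by (auto simp: sgn_div_norm orthogonal_transformation_norm
        orthogonal_transformation_scaleR fun_eq_iff)
  have "distr sphere_measure borel f = distr ?U borel (f \<circ> sgn)"
    unfolding sphere_measure_def by (subst distr_distr) auto
  also have "\<dots> = distr (distr ?U borel f) borel sgn"
    unfolding comm by (subst distr_distr) auto
  also have "\<dots> = sphere_measure"
    unfolding distr_uniform_ball_orthogonal[OF f] by (simp add: sphere_measure_def)
  finally show ?thesis .
qed

lemma sphere_mean_orthogonal:
  fixes f :: "real ^ 'n :: {finite, wellorder} \<Rightarrow> real ^ 'n :: _"
  assumes f: "orthogonal_transformation f" and p: "p \<in> borel_measurable borel"
  shows "sphere_mean (\<lambda>z. p (f z)) = sphere_mean p"
proof -
  have "f \<in> borel_measurable borel"
    using f by (intro borel_measurable_continuous_onI linear_continuous_on)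
      (simp add: linear_conv_bounded_linear[symmetric] orthogonal_transformation_linear)
  then have "sphere_mean (\<lambda>z. p (f z)) = (\<integral>z. p z \<partial>distr sphere_measure borel f)"
    using p by (subst integral_distr) (auto simp: measurable_cong_sets[OF sets_sphere_measure refl])
  then show ?thesis by (simp add: distr_sphere_orthogonal[OF f])
qed

text \<open>The sphere is compact and carries the whole measure, so growth of \<open>p\<close>
  elsewhere does no harm.\<close>

lemma integrable_sphere:
  fixes p :: "real ^ 'n \<Rightarrow> real"
  assumes p: "continuous_on UNIV p"
  shows "integrable sphere_measure p"
proof -
  have "compact (p ` sphere 0 1)"
    using p by (intro compact_continuous_image) (auto intro: continuous_on_subset)
  then obtain B where B: "\<And>z. norm z = 1 \<Longrightarrow> norm (p z) \<le> B"
    by (force simp: bounded_iff dest: compact_imp_bounded)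
  show ?thesis
  proof (rule sphere.integrable_const_bound[of _ B])
    show "AE z in sphere_measure. norm (p z) \<le> B"
      using AE_sphere_norm by eventually_elim (rule B)
    show "p \<in> borel_measurable sphere_measure"
      using p by (simp add: measurable_cong_sets[OF sets_sphere_measure refl]
          borel_measurable_continuous_onI)
  qed
qed


section \<open>Linear functionals on polynomial functions, and polarization\<close>

lemma real_polynomial_function_inner [intro]: "real_polynomial_function (\<lambda>z. u \<bullet> z)"
  by (rule real_polynomial_function.intros(1)) (rule bounded_linear_inner_right)

lemma real_polynomial_function_cmult [intro]:
  "real_polynomial_function p \<Longrightarrow> real_polynomial_function (\<lambda>z. c * p z)"
  by (intro real_polynomial_function.intros(2,4))

lemma real_polynomial_function_sum' [intro]:
  "finite I \<Longrightarrow> (\<And>i. i \<in> I \<Longrightarrow> real_polynomial_function (f i)) \<Longrightarrow>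
    real_polynomial_function (\<lambda>x. \<Sum>i\<in>I. f i x)"
  by (induction I rule: finite_induct) auto

lemmas polynomial_intros = real_polynomial_function_inner real_polynomial_function_power
  real_polynomial_function.intros(2-4) real_polynomial_function_sum'

lemma integrable_sphere_polynomial [intro]:
  fixes p :: "real ^ 'n \<Rightarrow> real"
  shows "real_polynomial_function p \<Longrightarrow> integrable sphere_measure p"
  by (intro integrable_sphere continuous_on_polymonial_function)
    (simp add: real_polynomial_function_eq)

text \<open>Linearity is asked on polynomial functions only, because the integral is additive on
  integrable functions. The two instances are \<open>sphere_mean\<close> and the defect of a code
  average against it.\<close>

locale poly_functional =
  fixes \<Lambda> :: "('a :: euclidean_space \<Rightarrow> real) \<Rightarrow> real"
  assumes add: "real_polynomial_function p \<Longrightarrow> real_polynomial_function q \<Longrightarrow>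
      \<Lambda> (\<lambda>z. p z + q z) = \<Lambda> p + \<Lambda> q"
    and cmult: "real_polynomial_function p \<Longrightarrow> \<Lambda> (\<lambda>z. c * p z) = c * \<Lambda> p"
begin

lemma zero: "\<Lambda> (\<lambda>z. 0) = 0"
  using cmult[of "\<lambda>_. 0" 0] by auto

lemma sum:
  "finite I \<Longrightarrow> (\<And>i. i \<in> I \<Longrightarrow> real_polynomial_function (p i)) \<Longrightarrow>
    \<Lambda> (\<lambda>z. \<Sum>i\<in>I. p i z) = (\<Sum>i\<in>I. \<Lambda> (p i))"
  by (induction I rule: finite_induct) (simp_all add: zero add real_polynomial_function_sum')

text \<open>By the binomial theorem the function of \<open>s\<close> is a polynomial in
  \<open>s\<close>, and its derivative at 0 is the coefficient of \<open>s\<close>.\<close>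

lemma has_derivative_power:
  assumes q: "real_polynomial_function q"
  shows "((\<lambda>s. \<Lambda> (\<lambda>z. ((u + s *\<^sub>R v) \<bullet> z) ^ m * q z)) has_real_derivative
      m * \<Lambda> (\<lambda>z. (u \<bullet> z) ^ (m - 1) * (v \<bullet> z) * q z)) (at 0)"
proof -
  define c where "c j = real (m choose j) * \<Lambda> (\<lambda>z. (v \<bullet> z) ^ j * (u \<bullet> z) ^ (m - j) * q z)" for j
  have expand: "\<Lambda> (\<lambda>z. ((u + s *\<^sub>R v) \<bullet> z) ^ m * q z) = (\<Sum>j\<le>m. c j * s ^ j)" for s
  proof -
    have "(\<lambda>z. ((u + s *\<^sub>R v) \<bullet> z) ^ m * q z) =
        (\<lambda>z. \<Sum>j\<le>m. (s ^ j * real (m choose j)) * ((v \<bullet> z) ^ j * (u \<bullet> z) ^ (m - j) * q z))"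
    proof
      fix z
      have "((u + s *\<^sub>R v) \<bullet> z) ^ m = (s * (v \<bullet> z) + u \<bullet> z) ^ m"
        by (simp add: inner_add_left add.commute)
      also have "\<dots> = (\<Sum>j\<le>m. real (m choose j) * (s * (v \<bullet> z)) ^ j * (u \<bullet> z) ^ (m - j))"
        by (rule binomial_ring)
      finally show "((u + s *\<^sub>R v) \<bullet> z) ^ m * q z =
          (\<Sum>j\<le>m. (s ^ j * real (m choose j)) * ((v \<bullet> z) ^ j * (u \<bullet> z) ^ (m - j) * q z))"
        by (simp add: sum_distrib_right sum_distrib_left power_mult_distrib mult_ac)
    qed
    then have "\<Lambda> (\<lambda>z. ((u + s *\<^sub>R v) \<bullet> z) ^ m * q z) = \<Lambda> (\<lambda>z. \<Sum>j\<le>m.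
        (s ^ j * real (m choose j)) * ((v \<bullet> z) ^ j * (u \<bullet> z) ^ (m - j) * q z))"
      by simp
    also have "\<dots> = (\<Sum>j\<le>m. \<Lambda> (\<lambda>z.
        (s ^ j * real (m choose j)) * ((v \<bullet> z) ^ j * (u \<bullet> z) ^ (m - j) * q z)))"
      using q by (intro sum) (auto intro!: polynomial_intros)
    also have "\<dots> = (\<Sum>j\<le>m. c j * s ^ j)"
      using q by (intro sum.cong refl, subst cmult) (auto simp: c_def intro!: polynomial_intros)
    finally show ?thesis .
  qed
  have "((\<lambda>s. \<Sum>j\<le>m. c j * s ^ j) has_real_derivative
      (\<Sum>j\<le>m. c j * (real j * 0 ^ (j - 1)))) (at 0)"
    by (auto intro!: derivative_eq_intros simp: mult_ac)
  \<comment> \<open>Truncated subtraction makes \<open>0 ^ (j - 1)\<close> equal to 1 at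
    \<open>j = 0\<close> as well, but there the factor \<open>real j\<close> vanishes.\<close>
  moreover have "(\<Sum>j\<le>m. c j * (real j * 0 ^ (j - 1))) =
      (\<Sum>j\<le>m. if j = 1 then c j else 0)"
    by (intro sum.cong) (auto simp: le_Suc_eq power_0_left)
  moreover have "\<dots> = m * \<Lambda> (\<lambda>z. (u \<bullet> z) ^ (m - 1) * (v \<bullet> z) * q z)"
    by (cases m) (auto simp: c_def mult_ac)
  ultimately show ?thesis by (simp add: expand)
qed

text \<open>Turns a closed formula \<open>R\<close> for a power moment into one in which a factor
  \<open>u \<bullet> z\<close> is traded for \<open>v \<bullet> z\<close>: both sides are the
  derivative of \<open>R\<close> in direction \<open>v\<close>.\<close>

lemma polarize:
  assumes "real_polynomial_function q" "\<And>u. \<Lambda> (\<lambda>z. (u \<bullet> z) ^ m * q z) = R u"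
    "((\<lambda>s. R (u + s *\<^sub>R v)) has_real_derivative D) (at 0)"
  shows "m * \<Lambda> (\<lambda>z. (u \<bullet> z) ^ (m - 1) * (v \<bullet> z) * q z) = D"
  using has_derivative_power[OF assms(1), of u v m] assms(3) unfolding assms(2)
  by (rule DERIV_unique)

text \<open>Each polarization trades one power of \<open>u\<close> for a new linear factor, keeping
  the total degree. With \<open>k = 0\<close> this reaches arbitrary products of linear
  forms.\<close>

lemma product_of_linear_eq_0:
  assumes "\<And>k u. k \<le> d \<Longrightarrow> \<Lambda> (\<lambda>z. (u \<bullet> z) ^ k) = 0"
  shows "k + length vs \<le> d \<Longrightarrow> \<Lambda> (\<lambda>z. (u \<bullet> z) ^ k * (\<Prod>v\<leftarrow>vs. v \<bullet> z)) = 0"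
proof (induction vs arbitrary: k u)
  case Nil
  then show ?case using assms by simp
next
  case (Cons v vs)
  have q: "real_polynomial_function (\<lambda>z. \<Prod>v\<leftarrow>vs. v \<bullet> z)"
    by (induction vs) auto
  have "real (Suc k) * \<Lambda> (\<lambda>z. (u \<bullet> z) ^ (Suc k - 1) * (v \<bullet> z) * (\<Prod>v\<leftarrow>vs. v \<bullet> z)) = 0"
    using Cons.prems by (intro polarize[OF q, where R = "\<lambda>_. 0"] Cons.IH) auto
  then show ?case by (simp add: mult_ac)
qed

end

interpretation sphere: poly_functional "sphere_mean :: (real ^ 'n \<Rightarrow> real) \<Rightarrow> real"
  by standard (auto simp: integrable_sphere_polynomial)


text \<open>A rotation carries \<open>e\<close> to the direction of \<open>u\<close>; homogeneity
  supplies the power of the norm.\<close>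

lemma sphere_mean_power:
  fixes u e :: "real ^ 'n :: {finite, wellorder}"
  assumes e: "norm e = 1"
  shows "sphere_mean (\<lambda>z. (u \<bullet> z) ^ m) = sphere_mean (\<lambda>z. (e \<bullet> z) ^ m) * norm u ^ m"
proof -
  obtain w where w: "norm w = 1" "u = norm u *\<^sub>R w"
  proof (cases "u = 0")
    case True
    then show ?thesis using that[of e] e by simp
  next
    case False
    then show ?thesis using that[of "sgn u"] by (simp add: norm_sgn sgn_div_norm)
  qed
  obtain f where f: "orthogonal_transformation f" "f e = w"
    using orthogonal_transformation_exists[of e w] e w by auto
  have "sphere_mean (\<lambda>z. (w \<bullet> z) ^ m) = sphere_mean (\<lambda>z. (w \<bullet> f z) ^ m)"
    by (intro sphere_mean_orthogonal[symmetric] f(1)) measurable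
  also have "(\<lambda>z. (w \<bullet> f z) ^ m) = (\<lambda>z. (e \<bullet> z) ^ m)"
    using f by (auto simp: orthogonal_transformation_def)
  finally have *: "sphere_mean (\<lambda>z. (w \<bullet> z) ^ m) = sphere_mean (\<lambda>z. (e \<bullet> z) ^ m)" .
  have "(\<lambda>z. (u \<bullet> z) ^ m) = (\<lambda>z. norm u ^ m * (w \<bullet> z) ^ m)"
    by (subst w(2)) (simp add: power_mult_distrib)
  then show ?thesis by (simp add: *)
qed

lemma sphere_mean_odd:
  fixes p :: "real ^ 'n :: {finite, wellorder} \<Rightarrow> real"
  assumes "real_polynomial_function p" "\<And>z. p (- z) = - p z"
  shows "sphere_mean p = 0"
proof -
  have "p \<in> borel_measurable borel"
    using assms(1) by (intro borel_measurable_continuous_onI continuous_on_polymonial_function)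
      (simp add: real_polynomial_function_eq)
  then have "sphere_mean (\<lambda>z. p (- z)) = sphere_mean p"
    by (intro sphere_mean_orthogonal) (simp_all add: orthogonal_transformation_neg)
  then show ?thesis using assms(2) by simp
qed

lemma sphere_mean_cong_sphere:
  assumes "\<And>z. norm z = 1 \<Longrightarrow> p z = q z"
    and "real_polynomial_function p" "real_polynomial_function q"
  shows "sphere_mean p = sphere_mean q"
proof (rule integral_cong_AE)
  show "AE z in sphere_measure. p z = q z"
    using AE_sphere_norm by eventually_elim (rule assms(1))
qed (use assms in \<open>auto dest: integrable_sphere_polynomial intro: borel_measurable_integrable\<close>)

lemma DERIV_inner_self_power:
  "((\<lambda>s. ((u + s *\<^sub>R v) \<bullet> (u + s *\<^sub>R v)) ^ k) has_real_derivative
      real k * (u \<bullet> u) ^ (k - 1) * (2 * (u \<bullet> v))) (at 0)" for u v :: "'a :: real_inner"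
proof -
  have "((\<lambda>s. (u \<bullet> u + 2 * s * (u \<bullet> v) + s\<^sup>2 * (v \<bullet> v)) ^ k) has_real_derivative
      real k * (u \<bullet> u) ^ (k - 1) * (2 * (u \<bullet> v))) (at 0)"
    by (auto intro!: derivative_eq_intros)
  then show ?thesis
    by (simp add: inner_add_left inner_add_right inner_commute[of v u] power2_eq_square algebra_simps)
qed

text \<open>Apply the Laplacian to
  \<open>u \<mapsto> \<integral> (u \<bullet> z)\<^sup>2\<^sup>k\<close>, which by rotation invariance is a multiple of \<open>(u \<bullet> u)\<^sup>k\<close>.\<close>

lemma sphere_mean_power_linear:
  fixes u v :: "real ^ 'n :: {finite, wellorder}"
  shows "(real CARD('n) + real m) * sphere_mean (\<lambda>z. (u \<bullet> z) ^ Suc m * (v \<bullet> z)) =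
      real (Suc m) * (u \<bullet> v) * sphere_mean (\<lambda>z. (u \<bullet> z) ^ m)"
proof (cases "even m")
  case False
  then have "sphere_mean (\<lambda>z. (u \<bullet> z) ^ m) = 0"
    and "sphere_mean (\<lambda>z. (u \<bullet> z) ^ Suc m * (v \<bullet> z)) = 0"
    by (auto intro!: sphere_mean_odd polynomial_intros)
  then show ?thesis by simp
next
  case True
  then obtain k where m: "m = 2 * k" by blast
  obtain e :: "real ^ 'n :: _" where e: "norm e = 1"
    using vector_choose_size[of 1] by auto
  define c where "c j = sphere_mean (\<lambda>z. (e \<bullet> z) ^ (2 * j))" for j
  have mean: "sphere_mean (\<lambda>z. (u \<bullet> z) ^ (2 * j)) = c j * (u \<bullet> u) ^ j" for u :: "real ^ 'n :: _" and j
    using sphere_mean_power[OF e, of u "2 * j"]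
    by (simp add: c_def power_mult dot_square_norm)
  \<comment> \<open>Polarization of \<open>mean\<close> at \<open>Suc k\<close>; the factor
    \<open>2 * Suc k\<close> cancels. \<open>second\<close> polarizes once more in the same
    direction.\<close>
  have first: "sphere_mean (\<lambda>z. (u \<bullet> z) ^ Suc m * (v \<bullet> z)) = c (Suc k) * (u \<bullet> u) ^ k * (u \<bullet> v)"
    for u v :: "real ^ 'n :: _"
  proof -
    have "real (2 * Suc k) * sphere_mean (\<lambda>z. (u \<bullet> z) ^ (2 * Suc k - 1) * (v \<bullet> z) * 1) =
        c (Suc k) * (real (Suc k) * (u \<bullet> u) ^ (Suc k - 1) * (2 * (u \<bullet> v)))"
      by (rule sphere.polarize[where R = "\<lambda>u. c (Suc k) * (u \<bullet> u) ^ Suc k"])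
        (use mean[of _ "Suc k"] in \<open>auto intro!: DERIV_cmult DERIV_inner_self_power[of _ _ "Suc _", simplified diff_Suc_1] simp del: power_Suc of_nat_Suc\<close>)
    then have "real (2 * Suc k) * sphere_mean (\<lambda>z. (u \<bullet> z) ^ Suc m * (v \<bullet> z)) =
        real (2 * Suc k) * (c (Suc k) * (u \<bullet> u) ^ k * (u \<bullet> v))"
      by (simp add: m mult_ac)
    then show ?thesis by (simp only: mult_cancel_left of_nat_eq_0_iff) simp
  qed
  have second: "real (Suc m) * sphere_mean (\<lambda>z. (u \<bullet> z) ^ m * (v \<bullet> z) * (v \<bullet> z)) =
      c (Suc k) * (real k * (u \<bullet> u) ^ (k - 1) * (2 * (u \<bullet> v)) * (u \<bullet> v) + (v \<bullet> v) * (u \<bullet> u) ^ k)"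
    for u v :: "real ^ 'n :: _"
  proof -
    have "real (Suc m) * sphere_mean (\<lambda>z. (u \<bullet> z) ^ (Suc m - 1) * (v \<bullet> z) * (v \<bullet> z)) =
      c (Suc k) * (real k * (u \<bullet> u) ^ (k - 1) * (2 * (u \<bullet> v)) * (u \<bullet> v) + (v \<bullet> v) * (u \<bullet> u) ^ k)"
    proof (rule sphere.polarize)
      have "((\<lambda>s. (u + s *\<^sub>R v) \<bullet> v) has_real_derivative v \<bullet> v) (at 0)"
        by (auto simp: inner_add_left intro!: derivative_eq_intros)
      from DERIV_mult[OF DERIV_inner_self_power[of u v k] this]
      show "((\<lambda>s. c (Suc k) * (((u + s *\<^sub>R v) \<bullet> (u + s *\<^sub>R v)) ^ k * ((u + s *\<^sub>R v) \<bullet> v)))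
          has_real_derivative
          c (Suc k) * (real k * (u \<bullet> u) ^ (k - 1) * (2 * (u \<bullet> v)) * (u \<bullet> v) +
            (v \<bullet> v) * (u \<bullet> u) ^ k)) (at 0)"
        by (intro DERIV_cmult) simp
    qed (use first in \<open>auto simp: mult.assoc\<close>)
    then show ?thesis by simp
  qed
  \<comment> \<open>Summing \<open>second\<close> over the coordinate axes forms the Laplacian. On
    the sphere the squared coordinates add up to 1, so the sum is again a moment of order
    \<open>m\<close>, and the ratio of \<open>c k\<close> to \<open>c (Suc k)\<close>
    results.\<close>
  have "real (Suc m) * c k * (e \<bullet> e) ^ k =
      real (Suc m) * sphere_mean (\<lambda>z. \<Sum>i\<in>UNIV. (e \<bullet> z) ^ m * (axis i 1 \<bullet> z) * (axis i 1 \<bullet> z))"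
  proof -
    have "sphere_mean (\<lambda>z. (e \<bullet> z) ^ m) =
        sphere_mean (\<lambda>z. \<Sum>i\<in>UNIV. (e \<bullet> z) ^ m * (axis i 1 \<bullet> z) * (axis i 1 \<bullet> z))"
    proof (rule sphere_mean_cong_sphere)
      fix z :: "real ^ 'n :: _" assume "norm z = 1"
      then have "(\<Sum>i\<in>UNIV. z $ i * z $ i) = 1"
        by (simp add: norm_eq_1 inner_vec_def)
      then show "(e \<bullet> z) ^ m = (\<Sum>i\<in>UNIV. (e \<bullet> z) ^ m * (axis i 1 \<bullet> z) * (axis i 1 \<bullet> z))"
        by (simp add: inner_axis' mult.assoc sum_distrib_left[symmetric])
    qed (intro polynomial_intros finite)+
    then show ?thesis using mean[of e k] by (simp add: m)
  qed
  also have "\<dots> = (\<Sum>i\<in>UNIV. real (Suc m) * sphere_mean (\<lambda>z. (e \<bullet> z) ^ m * (axis i 1 \<bullet> z) * (axis i 1 \<bullet> z)))"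
    by (subst sphere.sum) (auto simp: sum_distrib_left intro!: polynomial_intros)
  also have "\<dots> = c (Suc k) * (2 * real k * (\<Sum>i\<in>UNIV. e $ i * e $ i) + CARD('n))"
    unfolding second using e
    by (simp add: norm_eq_1 inner_axis sum.distrib sum_distrib_left algebra_simps inner_axis_axis)
  also have "(\<Sum>i\<in>UNIV. e $ i * e $ i) = 1"
    using e by (simp add: norm_eq_1 inner_vec_def)
  finally have "real (Suc m) * c k = c (Suc k) * (2 * real k + CARD('n))"
    using e by (simp add: norm_eq_1)
  then have "c (Suc k) * (2 * real k + CARD('n)) * ((u \<bullet> v) * (u \<bullet> u) ^ k) =
      real (Suc m) * c k * ((u \<bullet> v) * (u \<bullet> u) ^ k)"
    by simp
  then show ?thesis
    unfolding first using mean[of u k] by (simp add: m algebra_simps)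
qed

text \<open>An analogue of the Wick formula: \<open>v\<close> is paired with each other factor in
  turn. Induction on \<open>b\<close>: the formula for exponents \<open>Suc (Suc a)\<close> and
  \<open>b\<close> is differentiated in \<open>u\<close> along \<open>w\<close>, which turns one
  factor \<open>u \<bullet> z\<close> into \<open>w \<bullet> z\<close>.\<close>

lemma sphere_mean_linear_recurrence:
  fixes u w v :: "real ^ 'n :: {finite, wellorder}"
  shows "(real CARD('n) + real (a + b)) * sphere_mean (\<lambda>z. (u \<bullet> z) ^ Suc a * (w \<bullet> z) ^ b * (v \<bullet> z)) =
      real (Suc a) * (u \<bullet> v) * sphere_mean (\<lambda>z. (u \<bullet> z) ^ a * (w \<bullet> z) ^ b) +
      real b * (w \<bullet> v) * sphere_mean (\<lambda>z. (u \<bullet> z) ^ Suc a * (w \<bullet> z) ^ (b - 1))"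
proof (induction b arbitrary: a u)
  case 0
  then show ?case using sphere_mean_power_linear[of a u v] by simp
next
  case (Suc b)
  let ?N = "real CARD('n) + real (Suc a + b)"
  have N: "?N \<noteq> 0" by (metis add_gr_0 of_nat_add of_nat_eq_0_iff zero_less_Suc less_numeral_extra(3))
  have IH: "sphere_mean (\<lambda>z. (u \<bullet> z) ^ Suc (Suc a) * ((w \<bullet> z) ^ b * (v \<bullet> z))) =
      (real (Suc (Suc a)) * ((u \<bullet> v) * sphere_mean (\<lambda>z. (u \<bullet> z) ^ Suc a * (w \<bullet> z) ^ b)) +
      real b * (w \<bullet> v) * sphere_mean (\<lambda>z. (u \<bullet> z) ^ Suc (Suc a) * (w \<bullet> z) ^ (b - 1))) / ?N" for u
    using Suc.IH[of "Suc a" u] N by (simp add: field_simps)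
  have lin: "((\<lambda>s. (u + s *\<^sub>R w) \<bullet> v) has_real_derivative w \<bullet> v) (at 0)"
    by (auto simp: inner_add_left intro!: derivative_eq_intros)
  define A where "A = sphere_mean (\<lambda>z. (u \<bullet> z) ^ Suc a * (w \<bullet> z) ^ Suc b * (v \<bullet> z))"
  define B where "B = sphere_mean (\<lambda>z. (u \<bullet> z) ^ Suc a * (w \<bullet> z) ^ b)"
  define C where "C = sphere_mean (\<lambda>z. (u \<bullet> z) ^ a * (w \<bullet> z) ^ Suc b)"
  define D where "D = sphere_mean (\<lambda>z. (u \<bullet> z) ^ Suc a * (w \<bullet> z) * (w \<bullet> z) ^ (b - 1))"
  have "real (Suc (Suc a)) * sphere_mean (\<lambda>z. (u \<bullet> z) ^ (Suc (Suc a) - 1) * (w \<bullet> z) *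
        ((w \<bullet> z) ^ b * (v \<bullet> z))) =
     (real (Suc (Suc a)) * ((w \<bullet> v) * sphere_mean (\<lambda>z. (u \<bullet> z) ^ Suc a * (w \<bullet> z) ^ b) +
        (real (Suc a) * sphere_mean (\<lambda>z. (u \<bullet> z) ^ a * (w \<bullet> z) * (w \<bullet> z) ^ b)) * (u \<bullet> v)) +
      real b * (w \<bullet> v) * (real (Suc (Suc a)) *
        sphere_mean (\<lambda>z. (u \<bullet> z) ^ Suc a * (w \<bullet> z) * (w \<bullet> z) ^ (b - 1)))) / ?N"
  proof (rule sphere.polarize[OF _ IH])
    have d: "((\<lambda>s. sphere_mean (\<lambda>z. ((u + s *\<^sub>R w) \<bullet> z) ^ m * (w \<bullet> z) ^ j)) has_real_derivative
      m * sphere_mean (\<lambda>z. (u \<bullet> z) ^ (m - 1) * (w \<bullet> z) * (w \<bullet> z) ^ j)) (at 0)" for m j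
      by (intro sphere.has_derivative_power) auto
    from DERIV_mult[OF lin d[of "Suc a" b]] d[of "Suc (Suc a)" "b - 1"]
    show "((\<lambda>s. (real (Suc (Suc a)) * (((u + s *\<^sub>R w) \<bullet> v) *
        sphere_mean (\<lambda>z. ((u + s *\<^sub>R w) \<bullet> z) ^ Suc a * (w \<bullet> z) ^ b)) +
      real b * (w \<bullet> v) * sphere_mean (\<lambda>z. ((u + s *\<^sub>R w) \<bullet> z) ^ Suc (Suc a) * (w \<bullet> z) ^ (b - 1))) / ?N)
      has_real_derivative
      (real (Suc (Suc a)) * ((w \<bullet> v) * sphere_mean (\<lambda>z. (u \<bullet> z) ^ Suc a * (w \<bullet> z) ^ b) +
        (real (Suc a) * sphere_mean (\<lambda>z. (u \<bullet> z) ^ a * (w \<bullet> z) * (w \<bullet> z) ^ b)) * (u \<bullet> v)) +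
      real b * (w \<bullet> v) * (real (Suc (Suc a)) *
        sphere_mean (\<lambda>z. (u \<bullet> z) ^ Suc a * (w \<bullet> z) * (w \<bullet> z) ^ (b - 1)))) / ?N) (at 0)"
      by (intro DERIV_cdivide DERIV_add DERIV_cmult) simp_all
  qed (intro polynomial_intros)
  then have "real (Suc (Suc a)) * A = (real (Suc (Suc a)) * ((w \<bullet> v) * B + (real (Suc a) * C) * (u \<bullet> v)) +
      real b * (w \<bullet> v) * (real (Suc (Suc a)) * D)) / ?N"
    unfolding A_def B_def C_def D_def by (simp add: mult_ac)
  also have "real b * (w \<bullet> v) * (real (Suc (Suc a)) * D) = real (Suc (Suc a)) * ((w \<bullet> v) * (real b * B))"
    by (cases b) (simp_all add: D_def B_def mult_ac)
  finally have "real (Suc (Suc a)) * A =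
      real (Suc (Suc a)) * ((real (Suc b) * (w \<bullet> v) * B + real (Suc a) * (u \<bullet> v) * C) / ?N)"
    by (simp add: algebra_simps)
  then have "A = (real (Suc b) * (w \<bullet> v) * B + real (Suc a) * (u \<bullet> v) * C) / ?N"
    by (simp only: mult_cancel_left of_nat_eq_0_iff) simp
  then have "?N * A = real (Suc a) * (u \<bullet> v) * C + real (Suc b) * (w \<bullet> v) * B"
    using N by (simp only: nonzero_eq_divide_eq) (simp add: mult.commute add.commute)
  then show ?case
    by (simp add: A_def B_def C_def)
qed

section \<open>Polynomials of bounded degree, and designs in terms of power moments\<close>

lemma monomial_as_product_of_linear:
  fixes \<alpha> :: "'n :: finite \<Rightarrow> nat"
  shows "\<exists>vs :: (real ^ 'n) list. length vs = sum \<alpha> UNIV \<and>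
    (\<forall>z. (\<Prod>v\<leftarrow>vs. v \<bullet> z) = (\<Prod>i\<in>UNIV. (z $ i) ^ \<alpha> i))"
proof -
  have "\<exists>vs :: (real ^ 'n) list. length vs = sum \<alpha> S \<and>
      (\<forall>z. (\<Prod>v\<leftarrow>vs. v \<bullet> z) = (\<Prod>i\<in>S. (z $ i) ^ \<alpha> i))" if "finite S" for S
    using that
  proof (induction S)
    case (insert i S)
    then obtain vs :: "(real ^ 'n) list" where "length vs = sum \<alpha> S"
      "\<forall>z. (\<Prod>v\<leftarrow>vs. v \<bullet> z) = (\<Prod>i\<in>S. (z $ i) ^ \<alpha> i)" by blast
    moreover have "(\<Prod>v\<leftarrow>replicate k (axis i 1). v \<bullet> z) = (z $ i) ^ k" for k and z :: "real ^ 'n"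
      by (simp add: inner_axis' prod_list_replicate)
    ultimately show ?case
      using insert.hyps by (intro exI[of _ "replicate (\<alpha> i) (axis i 1) @ vs"]) simp
  qed simp
  from this[of UNIV] show ?thesis by simp
qed

lemma finite_exponents: "finite {\<alpha> :: 'n :: finite \<Rightarrow> nat. sum \<alpha> UNIV \<le> d}"
proof (rule finite_subset)
  show "{\<alpha> :: 'n \<Rightarrow> nat. sum \<alpha> UNIV \<le> d} \<subseteq> (UNIV :: 'n set) \<rightarrow>\<^sub>E {..d}"
  proof safe
    fix \<alpha> :: "'n \<Rightarrow> nat" and i :: 'n assume "sum \<alpha> UNIV \<le> d"
    with member_le_sum[of i UNIV \<alpha>] show "\<alpha> i \<le> d" by simp
  qed simp
  show "finite ((UNIV :: 'n set) \<rightarrow>\<^sub>E {..d})"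
    by (intro finite_PiE) auto
qed

lemma polynomials_upto_add:
  assumes "p \<in> polynomials_upto d" "q \<in> polynomials_upto d"
  shows "(\<lambda>x. p x + q x) \<in> polynomials_upto d"
proof -
  from assms obtain b c where
    "p = (\<lambda>x. \<Sum>\<alpha> | sum \<alpha> UNIV \<le> d. b \<alpha> * (\<Prod>i\<in>UNIV. (x $ i) ^ \<alpha> i))"
    "q = (\<lambda>x. \<Sum>\<alpha> | sum \<alpha> UNIV \<le> d. c \<alpha> * (\<Prod>i\<in>UNIV. (x $ i) ^ \<alpha> i))"
    unfolding polynomials_upto_def by blast
  then show ?thesis
    unfolding polynomials_upto_def
    by (intro CollectI exI[of _ "\<lambda>\<alpha>. b \<alpha> + c \<alpha>"]) (simp add: sum.distrib algebra_simps)
qed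

lemma polynomials_upto_cmult:
  assumes "p \<in> polynomials_upto d"
  shows "(\<lambda>x. a * p x) \<in> polynomials_upto d"
proof -
  from assms obtain b where
    "p = (\<lambda>x. \<Sum>\<alpha> | sum \<alpha> UNIV \<le> d. b \<alpha> * (\<Prod>i\<in>UNIV. (x $ i) ^ \<alpha> i))"
    unfolding polynomials_upto_def by blast
  then show ?thesis
    unfolding polynomials_upto_def
    by (intro CollectI exI[of _ "\<lambda>\<alpha>. a * b \<alpha>"]) (simp add: sum_distrib_left mult.assoc)
qed

lemma polynomials_upto_0: "(\<lambda>x. 0) \<in> polynomials_upto d"
  unfolding polynomials_upto_def by (intro CollectI exI[of _ "\<lambda>_. 0"]) simp

lemma polynomials_upto_sum:
  "finite I \<Longrightarrow> (\<And>i. i \<in> I \<Longrightarrow> p i \<in> polynomials_upto d) \<Longrightarrow>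
    (\<lambda>x. \<Sum>i\<in>I. p i x) \<in> polynomials_upto d"
  by (induction I rule: finite_induct) (simp_all add: polynomials_upto_0 polynomials_upto_add)

lemma monomial_in_polynomials_upto:
  assumes "sum \<alpha> UNIV \<le> d"
  shows "(\<lambda>x. \<Prod>i\<in>UNIV. (x $ i) ^ \<alpha> i) \<in> polynomials_upto d"
  unfolding polynomials_upto_def
  by (intro CollectI exI[of _ "\<lambda>\<beta>. if \<beta> = \<alpha> then 1 else 0"])
    (use assms in \<open>simp add: finite_exponents if_distrib[of "\<lambda>x. x * _"] sum.delta cong: if_cong\<close>)

lemma polynomials_upto_linear_mult:
  fixes p :: "real ^ 'n \<Rightarrow> real"
  assumes p: "p \<in> polynomials_upto d"
  shows "(\<lambda>x. (u \<bullet> x) * p x) \<in> polynomials_upto (Suc d)"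
proof -
  from p obtain b where
    b: "p = (\<lambda>x. \<Sum>\<alpha> | sum \<alpha> UNIV \<le> d. b \<alpha> * (\<Prod>i\<in>UNIV. (x $ i) ^ \<alpha> i))"
    unfolding polynomials_upto_def by blast
  have shift: "(\<lambda>x. x $ j * p x) \<in> polynomials_upto (Suc d)" for j
  proof -
    have "(\<lambda>x. x $ j * p x) = (\<lambda>x. \<Sum>\<alpha> | sum \<alpha> UNIV \<le> d.
        b \<alpha> * (\<Prod>i\<in>UNIV. (x $ i) ^ (\<alpha>(j := Suc (\<alpha> j))) i))"
    proof
      fix x :: "real ^ 'n"
      have "(\<Prod>i\<in>UNIV. (x $ i) ^ (\<alpha>(j := Suc (\<alpha> j))) i) = x $ j * (\<Prod>i\<in>UNIV. (x $ i) ^ \<alpha> i)" for \<alpha>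
        by (subst (1 2) prod.remove[of UNIV j]) (auto intro!: prod.cong)
      then show "x $ j * p x = (\<Sum>\<alpha> | sum \<alpha> UNIV \<le> d.
          b \<alpha> * (\<Prod>i\<in>UNIV. (x $ i) ^ (\<alpha>(j := Suc (\<alpha> j))) i))"
        by (simp add: b sum_distrib_left mult_ac)
    qed
    also have "\<dots> \<in> polynomials_upto (Suc d)"
    proof (intro polynomials_upto_sum polynomials_upto_cmult monomial_in_polynomials_upto)
      fix \<alpha> :: "'n \<Rightarrow> nat" assume "\<alpha> \<in> {\<alpha>. sum \<alpha> UNIV \<le> d}"
      moreover have "sum (\<alpha>(j := Suc (\<alpha> j))) UNIV = Suc (sum \<alpha> UNIV)"
        by (subst (1 2) sum.remove[of UNIV j]) (auto intro!: sum.cong)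
      ultimately show "sum (\<alpha>(j := Suc (\<alpha> j))) UNIV \<le> Suc d" by simp
    qed (rule finite_exponents)
    finally show ?thesis .
  qed
  have "(\<lambda>x. (u \<bullet> x) * p x) = (\<lambda>x. \<Sum>j\<in>UNIV. u $ j * (x $ j * p x))"
    by (simp add: inner_vec_def sum_distrib_right mult.assoc)
  also have "\<dots> \<in> polynomials_upto (Suc d)"
    by (intro polynomials_upto_sum polynomials_upto_cmult shift) simp
  finally show ?thesis .
qed

lemma linear_powers_in_polynomials_upto:
  "a + b \<le> d \<Longrightarrow> (\<lambda>x. (u \<bullet> x) ^ a * (v \<bullet> x) ^ b) \<in> polynomials_upto d"
proof (induction "a + b" arbitrary: a b d)
  case 0
  show ?case using 0 monomial_in_polynomials_upto[of "\<lambda>_. 0" d] by simp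
next
  case (Suc n)
  obtain e where e: "d = Suc e" "n \<le> e" using Suc.hyps(2) Suc.prems by (cases d) auto
  show ?case
  proof (cases a)
    case 0
    then obtain b' where b: "b = Suc b'" using Suc.hyps(2) by (cases b) auto
    have "(\<lambda>x. (u \<bullet> x) ^ a * (v \<bullet> x) ^ b') \<in> polynomials_upto e"
      using Suc.hyps 0 b e by (intro Suc.hyps(1)) auto
    from polynomials_upto_linear_mult[OF this, of v] show ?thesis
      by (simp add: e(1) b mult_ac)
  next
    case a: (Suc a')
    have "(\<lambda>x. (u \<bullet> x) ^ a' * (v \<bullet> x) ^ b) \<in> polynomials_upto e"
      using Suc.hyps a e by (intro Suc.hyps(1)) auto
    from polynomials_upto_linear_mult[OF this, of u] show ?thesis
      by (simp add: e(1) a mult_ac)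
  qed
qed

lemma power_of_linear_in_polynomials_upto:
  "k \<le> d \<Longrightarrow> (\<lambda>x. (u \<bullet> x) ^ k) \<in> polynomials_upto d"
  using linear_powers_in_polynomials_upto[of k 0 d u u] by simp

theorem spherical_design_iff_power_means:
  fixes C :: "(real ^ 'n) set"
  shows "spherical_design \<tau> C \<longleftrightarrow> spherical_code C \<and>
    (\<forall>k\<le>\<tau>. \<forall>u. (\<Sum>x\<in>C. (u \<bullet> x) ^ k) / real (card C) = sphere_mean (\<lambda>z. (u \<bullet> z) ^ k))"
    (is "_ \<longleftrightarrow> _ \<and> ?P")
proof safe
  assume "spherical_code C" and P: ?P
  then have C: "finite C" by (simp add: spherical_code_def)
  \<comment> \<open>The defect of the code average. The hypothesis \<open>?P\<close> says that it
    kills powers of linear forms, and \<open>product_of_linear_eq_0\<close> extends this to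
    monomials.\<close>
  define \<Lambda> where "\<Lambda> p = (\<Sum>x\<in>C. p x) / real (card C) - sphere_mean p" for p :: "real ^ 'n \<Rightarrow> real"
  interpret poly_functional \<Lambda>
  proof
    fix p q :: "real ^ 'n \<Rightarrow> real" and c
    assume p: "real_polynomial_function p" and q: "real_polynomial_function q"
    show "\<Lambda> (\<lambda>z. p z + q z) = \<Lambda> p + \<Lambda> q"
      unfolding \<Lambda>_def sphere.add[OF p q] by (simp add: sum.distrib add_divide_distrib)
    show "\<Lambda> (\<lambda>z. c * p z) = c * \<Lambda> p"
      unfolding \<Lambda>_def sphere.cmult[OF p] sum_distrib_left[symmetric] by (simp add: right_diff_distrib)
  qed
  have "\<Lambda> p = 0" if p: "p \<in> polynomials_upto \<tau>" for p
  proof -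
    from p obtain b where
      b: "p = (\<lambda>x. \<Sum>\<alpha> | sum \<alpha> UNIV \<le> \<tau>. b \<alpha> * (\<Prod>i\<in>UNIV. (x $ i) ^ \<alpha> i))"
      unfolding polynomials_upto_def by blast
    have poly: "real_polynomial_function (\<lambda>x :: real ^ 'n. \<Prod>i\<in>UNIV. (x $ i) ^ \<alpha> i)" for \<alpha>
      by (intro real_polynomial_function_prod real_polynomial_function_power
          real_polynomial_function.intros(1) bounded_linear_vec_nth) auto
    have "\<Lambda> (\<lambda>x. \<Prod>i\<in>UNIV. (x $ i) ^ \<alpha> i) = 0" if "sum \<alpha> UNIV \<le> \<tau>" for \<alpha>
    proof -
      obtain vs :: "(real ^ 'n) list" where "length vs = sum \<alpha> UNIV"
        "\<And>z. (\<Prod>v\<leftarrow>vs. v \<bullet> z) = (\<Prod>i\<in>UNIV. (z $ i) ^ \<alpha> i)"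
        using monomial_as_product_of_linear[of \<alpha>] by blast
      then show ?thesis
        using product_of_linear_eq_0[of \<tau> 0 vs 0] P that by (simp add: \<Lambda>_def)
    qed
    then show ?thesis
      unfolding b
      by (subst sum[OF finite_exponents], intro real_polynomial_function_cmult poly,
          intro sum.neutral ballI, subst cmult[OF poly]) simp
  qed
  then have "(\<Sum>x\<in>C. p x) / real (card C) = sphere_mean p" if "p \<in> polynomials_upto \<tau>" for p
    using that unfolding \<Lambda>_def by (metis eq_iff_diff_eq_0)
  then show "spherical_design \<tau> C"
    using \<open>spherical_code C\<close> unfolding spherical_design_def by (intro conjI ballI)
next
  fix k u assume *: "spherical_design \<tau> C" "k \<le> \<tau>"
  have "\<forall>p\<in>polynomials_upto \<tau>. (\<Sum>x\<in>C. p x) / real (card C) = sphere_mean p"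
    using *(1) unfolding spherical_design_def by (rule conjunct2)
  from bspec[OF this power_of_linear_in_polynomials_upto[OF *(2), of u]]
  show "(\<Sum>x\<in>C. (u \<bullet> x) ^ k) / real (card C) = sphere_mean (\<lambda>z. (u \<bullet> z) ^ k)" .
next
  assume "spherical_design \<tau> C"
  then show "spherical_code C"
    unfolding spherical_design_def by (rule conjunct1)
qed

section \<open>The binary Golay code\<close>

lemma UNIV_23: "(UNIV :: 23 set) = {0,1,2,3,4,5,6,7,8,9,10,11,12,13,14,15,16,17,18,19,20,21,22}"
proof -
  have "(UNIV :: 23 set) = of_nat ` {..<23}"
  proof safe
    fix x :: 23
    show "x \<in> of_nat ` {..<23}"
    proof (cases x)
      case (of_int z)
      then show ?thesis
        by (intro image_eqI[of _ _ "nat z"]) (auto simp: of_nat_nat)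
    qed
  qed simp
  also have "{..<23} = {0,1,2,3,4,5,6,7,8,9,10,11,12,13,14,15,16,17,18,19,20,21,22 :: nat}"
    by (simp add: lessThan_nat_numeral lessThan_Suc insert_commute)
  finally show ?thesis by simp
qed

lemma all_23: "(\<forall>x :: 23. P x) \<longleftrightarrow> (\<forall>x \<in> {0,1,2,3,4,5,6,7,8,9,10,11,12,13,14,15,16,17,18,19,20,21,22}. P x)"
  by (simp only: UNIV_23[symmetric]) simp

lemma ex_23: "(\<exists>x :: 23. P x) \<longleftrightarrow> (\<exists>x \<in> {0,1,2,3,4,5,6,7,8,9,10,11,12,13,14,15,16,17,18,19,20,21,22}. P x)"
  by (simp only: UNIV_23[symmetric]) simp

definition NR :: "23 set" where "NR = {5,7,10,11,14,15,17,19,20,21,22}"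

text \<open>Differences \<open>a - i\<close> of numerals can simplify to negative numerals, so the
  finite checks need membership for both signs.\<close>

lemma NR_numeral [simp]:
  "- 22 \<notin> NR" "- 21 \<notin> NR" "- 20 \<notin> NR" "- 19 \<notin> NR" "- 18 \<in> NR" "- 17 \<notin> NR" "- 16 \<in> NR"
  "- 15 \<notin> NR" "- 14 \<notin> NR" "- 13 \<in> NR" "- 12 \<in> NR" "- 11 \<notin> NR" "- 10 \<notin> NR" "- 9 \<in> NR"
  "- 8 \<in> NR" "- 7 \<notin> NR" "- 6 \<in> NR" "- 5 \<notin> NR" "- 4 \<in> NR" "- 3 \<in> NR" "- 2 \<in> NR"
  "- 1 \<in> NR" "0 \<notin> NR" "1 \<notin> NR" "2 \<notin> NR" "3 \<notin> NR" "4 \<notin> NR" "5 \<in> NR"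
  "6 \<notin> NR" "7 \<in> NR" "8 \<notin> NR" "9 \<notin> NR" "10 \<in> NR" "11 \<in> NR" "12 \<notin> NR"
  "13 \<notin> NR" "14 \<in> NR" "15 \<in> NR" "16 \<notin> NR" "17 \<in> NR" "18 \<notin> NR" "19 \<in> NR"
  "20 \<in> NR" "21 \<in> NR" "22 \<in> NR"
  by (simp_all add: NR_def)

lemma nonsquares_23: "{n :: 23. \<not> (\<exists>k. n = k * k)} = NR"
proof -
  have "(\<not> (\<exists>k. n = k * k)) \<longleftrightarrow> n \<in> NR" for n :: 23
  proof -
    have "\<forall>n :: 23. (\<not> (\<exists>k. n = k * k)) \<longleftrightarrow> n \<in> NR"
      by (simp add: all_23 ex_23 NR_def)
    then show ?thesis by blast
  qed
  then show ?thesis by blast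
qed

definition generator :: "23 \<Rightarrow> 23 option set" where
  "generator i = map_option (\<lambda>n. n + i) ` nonresidues"

lemma None_in_gen [simp]: "None \<in> generator i"
  by (auto simp: generator_def nonresidues_def image_iff)

lemma Some_in_gen: "Some a \<in> generator i \<longleftrightarrow> a - i \<in> NR"
  unfolding generator_def nonresidues_def nonsquares_23
  by (auto simp: image_iff intro: bexI[of _ "a - i"])

lemma golay_gen_sym_diff: "W \<in> golay \<Longrightarrow> sym_diff W (generator i) \<in> golay"
  unfolding generator_def by (rule golay.add)

lemma golay_gen: "generator i \<in> golay"
  using golay_gen_sym_diff[OF golay.empty, of i] by simp

lemma golay_induct [consumes 1, case_names empty add]:
  assumes "W \<in> golay" "P {}" "\<And>W i. W \<in> golay \<Longrightarrow> P W \<Longrightarrow> P (sym_diff W (generator i))"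
  shows "P W"
  using assms(1)
  by (induction rule: golay.induct) (use assms(2,3) in \<open>auto simp: generator_def\<close>)

lemma golay_sym_diff:
  assumes W: "W \<in> golay" and V: "V \<in> golay"
  shows "sym_diff W V \<in> golay"
  using V
proof (induction V rule: golay_induct)
  case (add V i)
  have "sym_diff W (sym_diff V (generator i)) = sym_diff (sym_diff W V) (generator i)" by auto
  then show ?case using add by (simp add: golay_gen_sym_diff)
qed (simp add: W)

lemma golay_translate: "W \<in> golay \<Longrightarrow> map_option (\<lambda>n. n + t) ` W \<in> golay"
proof (induction W rule: golay_induct)
  case (add W i)
  have inj: "inj (map_option (\<lambda>n :: 23. n + t))"
    by (intro option.inj_map) (simp add: inj_def)
  have "map_option (\<lambda>n. n + t) ` generator i = generator (i + t)"
    by (auto simp: generator_def image_image option.map_comp o_def add.assoc)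
  then show ?case
    using add.IH golay_gen_sym_diff
    by (simp add: image_Un image_set_diff[OF inj])
qed (simp add: golay.empty)

lemma in_sym_diff_iff: "x \<in> sym_diff A B \<longleftrightarrow> (x \<in> A) \<noteq> (x \<in> B)"
  by auto

lemma golay_UNIV: "UNIV \<in> golay"
proof -
  \<comment> \<open>Every generator contains \<open>None\<close>, so the number of summands has to
    be odd; here it is seven.\<close>
  have "UNIV = sym_diff (sym_diff (sym_diff (sym_diff (sym_diff (sym_diff (generator 0) (generator 1)) (generator 2)) (generator 3)) (generator 9)) (generator 12)) (generator 21)"
    (is "UNIV = ?G")
  proof -
    have some: "\<forall>a. Some a \<in> ?G"
      unfolding all_23 ball_simps in_sym_diff_iff Some_in_gen by (intro conjI) simp_all
    have none: "None \<in> ?G"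
      unfolding in_sym_diff_iff by simp
    have "x \<in> ?G" for x
    proof (cases x)
      case None
      show ?thesis unfolding None by (rule none)
    next
      case (Some a)
      show ?thesis unfolding Some by (rule some[rule_format])
    qed
    then show ?thesis by (intro equalityI subsetI UNIV_I)
  qed
  then show ?thesis
    by (rule ssubst) (intro golay_gen_sym_diff golay_gen)
qed

lemma golay_Compl: "W \<in> golay \<Longrightarrow> - W \<in> golay"
  using golay_sym_diff[OF golay_UNIV, of W] by (simp add: Compl_eq_Diff_UNIV)

lemma card_sym_diff:
  assumes "finite A" "finite B"
  shows "card (sym_diff A B) + 2 * card (A \<inter> B) = card A + card B"
proof -
  have "card (sym_diff A B) = card (A - B) + card (B - A)"
    using assms by (intro card_Un_disjoint) auto
  moreover have "card A = card (A - B) + card (A \<inter> B)" "card B = card (B - A) + card (A \<inter> B)"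
    using assms by (metis Int_commute card_Diff_subset_Int card_Int_Diff finite_Int add.commute)+
  ultimately show ?thesis by simp
qed

lemma even_card_sym_diff_Int:
  assumes "finite A" "finite B" "even (card (A \<inter> C))" "even (card (B \<inter> C))"
  shows "even (card (sym_diff A B \<inter> C))"
proof -
  have "sym_diff A B \<inter> C = sym_diff (A \<inter> C) (B \<inter> C)" by auto
  then show ?thesis
    using card_sym_diff[of "A \<inter> C" "B \<inter> C"] assms by (metis even_add even_mult_iff even_numeral finite_Int)
qed

text \<open>Since 23 is 3 modulo 4, the nonsquares form a (23, 11, 5) difference set: the count is
  11 for \<open>d = 0\<close> and 5 otherwise. The point at infinity makes generator intersections
  even.\<close>

lemma card_NR_translate: "odd (card {b \<in> NR. b + d \<in> NR})" 
proof -
  have "\<forall>d :: 23. odd (card {b \<in> NR. b + d \<in> NR})"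
    unfolding all_23 NR_def by (simp add: Collect_conv_if conj_disj_distribR Collect_disj_eq)
  then show ?thesis by blast
qed

lemma card_NR: "card NR = 11"
  by (simp add: NR_def)

lemma card_gen_Int: "card (generator i \<inter> generator j) = Suc (card {b \<in> NR. b + (i - j) \<in> NR})"
proof -
  have "generator i \<inter> generator j = insert None ((\<lambda>b. Some (b + i)) ` {b \<in> NR. b + (i - j) \<in> NR})"
  proof (rule set_eqI)
    fix x show "x \<in> generator i \<inter> generator j \<longleftrightarrow> x \<in> insert None ((\<lambda>b. Some (b + i)) ` {b \<in> NR. b + (i - j) \<in> NR})"
    proof (cases x)
      case (Some a)
      have "a \<in> (\<lambda>b. b + i) ` {b \<in> NR. b + (i - j) \<in> NR} \<longleftrightarrow> a - i \<in> NR \<and> a - j \<in> NR"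
      proof
        assume "a - i \<in> NR \<and> a - j \<in> NR"
        then show "a \<in> (\<lambda>b. b + i) ` {b \<in> NR. b + (i - j) \<in> NR}"
          by (intro image_eqI[of _ _ "a - i"]) auto
      qed (auto simp: algebra_simps)
      then show ?thesis by (auto simp: Some Some_in_gen)
    qed simp
  qed
  then show ?thesis
    by (simp add: card_insert_if card_image inj_on_def image_iff)
qed


lemma even_card_gen_Int: "even (card (generator i \<inter> generator j))"
  using card_NR_translate[of "i - j"] by (simp add: card_gen_Int)

lemma card_gen: "card (generator i) = 12"
  using card_gen_Int[of i i] card_NR by (simp add: Collect_mem_eq)

lemma golay_self_orthogonal:
  assumes "V \<in> golay" "W \<in> golay"
  shows "even (card (V \<inter> W))"
proof -
  have gen: "even (card (V \<inter> generator i))" if "V \<in> golay" for V i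
    using that by (induction V rule: golay_induct)
      (simp_all add: even_card_sym_diff_Int even_card_gen_Int)
  have "even (card (W \<inter> V))"
    using assms(2)
  proof (induction W rule: golay_induct)
    case (add W i)
    then show ?case
      using gen[OF assms(1), of i] by (intro even_card_sym_diff_Int) (simp_all add: Int_commute)
  qed simp
  then show ?thesis by (simp add: Int_commute)
qed

text \<open>Generators have weight 12, and by self-orthogonality twice the size of an intersection
  is divisible by 4, so weights add modulo 4.\<close>

lemma golay_doubly_even: "W \<in> golay \<Longrightarrow> 4 dvd card W"
proof (induction W rule: golay_induct)
  case (add W i)
  have "even (card (W \<inter> generator i))"
    using add.hyps golay_gen by (rule golay_self_orthogonal)
  then have "4 dvd 2 * card (W \<inter> generator i)" by (auto elim!: evenE)
  moreover have "card (sym_diff W (generator i)) + 2 * card (W \<inter> generator i) = card W + 12"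
    using card_sym_diff[of W "generator i"] by (simp add: card_gen)
  ultimately show ?case
    using add.IH by presburger
qed simp

text \<open>\<open>generator a\<close> omits \<open>Some a\<close>, and as -1 is a nonsquare modulo
  23, one of \<open>generator a\<close> and \<open>generator b\<close> contains the other's omitted
  point.\<close>

lemma golay_separates_points:
  assumes "p \<noteq> q"
  obtains W where "W \<in> golay" "p \<in> W \<longleftrightarrow> q \<notin> W"
proof -
  have zero: "0 \<notin> NR" by (simp add: NR_def)
  have total: "d \<in> NR \<or> - d \<in> NR" if "d \<noteq> 0" for d
  proof -
    have "\<forall>d. d \<noteq> 0 \<longrightarrow> d \<in> NR \<or> - d \<in> NR"
      by (simp add: all_23 NR_def)
    then show ?thesis using that by blast
  qed
  show ?thesis
  proof (cases p)
    case None
    then show ?thesis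
      using assms that[OF golay_gen, of "the q"] by (cases q) (auto simp: Some_in_gen zero)
  next
    case (Some a)
    show ?thesis
    proof (cases q)
      case None
      then show ?thesis
        using that[OF golay_gen, of a] Some by (auto simp: Some_in_gen zero)
    next
      case q: (Some b)
      then have "a - b \<in> NR \<or> b - a \<in> NR"
        using total[of "a - b"] assms Some by simp
      then show ?thesis
        using that[OF golay_gen, of a] that[OF golay_gen, of b] Some q
        by (auto simp: Some_in_gen zero)
    qed
  qed
qed

text \<open>The word \<open>short_word\<close> has its finite points in a window of length 12, so its cyclic shifts are
  triangular on the positions \<open>0, \<dots>, 11\<close>, which therefore form an information set.\<close>

definition short_word :: "23 option set" where
  "short_word = sym_diff (sym_diff (generator 0) (generator 1)) (generator 20)"

lemma Some_in_short_word: "Some a \<in> short_word \<longleftrightarrow> a \<in> {0, 2, 4, 5, 6, 10, 11}"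
proof -
  have "\<forall>a. Some a \<in> short_word \<longleftrightarrow> a \<in> {0, 2, 4, 5, 6, 10, 11}"
    unfolding short_word_def all_23 ball_simps in_sym_diff_iff Some_in_gen by simp
  then show ?thesis by blast
qed

lemma short_word_golay: "short_word \<in> golay"
  unfolding short_word_def by (intro golay_gen_sym_diff golay_gen)

lemma of_nat_eq_iff_23: "(of_nat a :: 23) = of_nat b \<longleftrightarrow> a mod 23 = b mod 23"
  by (simp add: of_nat_eq_iff_cong_CHAR cong_def)

text \<open>Elimination from the top position downwards shows that every subset of the positions 0
  to 11 is the trace of a codeword, which gives 2 to the 12 words.\<close>

lemma card_golay_ge: "4096 \<le> card golay"
proof -
  define tr where "tr W = {j \<in> {..<12}. Some (of_nat j) \<in> W}" for W :: "23 option set"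
  have tr_sym: "tr (sym_diff V W) = sym_diff (tr V) (tr W)" for V W
    by (auto simp: tr_def)
  \<comment> \<open>The shift takes 11, the last window position, to \<open>k\<close>. Positions
    that would become negative wrap around to 12, ..., 22, outside the information set.\<close>
  define w where "w k = map_option (\<lambda>n. n + (of_nat k - 11)) ` short_word" for k :: nat
  have w: "w k \<in> golay" for k
    unfolding w_def by (rule golay_translate[OF short_word_golay])
  have Some_w: "Some (of_nat j) \<in> w k \<longleftrightarrow> (j + 11 - k) mod 23 \<in> {0, 2, 4, 5, 6, 10, 11}"
    if "k < 12" for j k
  proof -
    have "Some (of_nat j) \<in> w k \<longleftrightarrow> (of_nat j - (of_nat k - 11) :: 23) \<in> {0, 2, 4, 5, 6, 10, 11}"
      unfolding w_def Some_in_short_word[symmetric]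
      by (auto simp: image_iff map_option_case split: option.splits intro!: bexI[of _ "Some (of_nat j - (of_nat k - 11))"])
    also have "of_nat j - (of_nat k - 11) = (of_nat (j + 11 - k) :: 23)"
      using that by (simp add: of_nat_diff)
    also have "\<dots> \<in> {0, 2, 4, 5, 6, 10, 11} \<longleftrightarrow> (of_nat (j + 11 - k) :: 23) \<in> of_nat ` {0, 2, 4, 5, 6, 10, 11}"
      by simp
    also have "\<dots> \<longleftrightarrow> (j + 11 - k) mod 23 \<in> {0, 2, 4, 5, 6, 10, 11}"
      unfolding image_iff of_nat_eq_iff_23 by simp
    finally show ?thesis .
  qed
  have "A \<subseteq> {..<k} \<Longrightarrow> k \<le> 12 \<Longrightarrow> \<exists>W\<in>golay. tr W = A" for A k
  proof (induction k arbitrary: A)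
    case 0
    then show ?case by (intro bexI[of _ "{}"]) (auto simp: tr_def golay.empty)
  next
    case (Suc k)
    show ?case
    proof (cases "k \<in> A")
      case False
      then show ?thesis using Suc by (intro Suc.IH) (auto simp: less_Suc_eq)
    next
      case True
      have "tr (w k) \<subseteq> {..k}"
      proof
        fix j assume "j \<in> tr (w k)"
        then have "(j + 11 - k) mod 23 \<in> {0, 2, 4, 5, 6, 10, 11}" "j < 12"
          using Suc.prems by (auto simp: tr_def Some_w)
        then show "j \<in> {..k}" using Suc.prems by (cases "j \<le> k") auto
      qed
      moreover have "k \<in> tr (w k)" using Suc.prems by (simp add: tr_def Some_w)
      ultimately have "sym_diff A (tr (w k)) \<subseteq> {..<k}"
        using True Suc.prems(1) by (force simp: less_Suc_eq_le le_less)
      then have "\<exists>W\<in>golay. tr W = sym_diff A (tr (w k))"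
        using Suc.prems(2) by (intro Suc.IH) simp_all
      then obtain W where W: "W \<in> golay" "tr W = sym_diff A (tr (w k))" by blast
      have "tr (sym_diff W (w k)) = A"
        unfolding tr_sym W(2) by auto
      then show ?thesis using golay_sym_diff[OF W(1) w] by blast
    qed
  qed
  then have "A \<in> tr ` golay" if "A \<subseteq> {..<12}" for A
    using that by (metis image_eqI order_refl)
  then have "Pow {..<12} \<subseteq> tr ` golay" by blast
  then have "card (Pow {..<12 :: nat}) \<le> card golay"
    by (meson card_mono card_image_le finite finite_imageI order_trans)
  then show ?thesis by (simp add: card_Pow)
qed

section \<open>Minimum weight of the Golay code\<close>

lemma NR_iff: "n \<in> NR \<longleftrightarrow> (\<nexists>k. n = k * k)"
  using nonsquares_23 by blast

lemma square_inverse_23: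
  assumes "q \<notin> NR" "q \<noteq> 0"
  obtains r where "q * r = 1" "r \<notin> NR" "r \<noteq> 0"
proof -
  have "\<forall>q :: 23. q \<noteq> 0 \<longrightarrow> (\<exists>r. q * r = 1)"
    by (simp add: all_23 ex_23)
  then obtain r where r: "q * r = 1" using assms by blast
  obtain k where "q = k * k" using assms by (auto simp: NR_iff)
  then have "r = (r * k) * (r * k)" using r by (metis mult.assoc mult.commute mult.right_neutral)
  then have "r \<notin> NR" unfolding NR_iff by blast
  moreover have "r \<noteq> 0" using r by auto
  ultimately show ?thesis using r that by blast
qed

text \<open>The nonzero squares form a group under multiplication. Scaling by one of them is the
  symmetry that normalizes a square difference of two points to 1.\<close>

lemma NR_mult_square:
  assumes "q \<notin> NR" "q \<noteq> 0"
  shows "q * x \<in> NR \<longleftrightarrow> x \<in> NR"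
proof -
  have *: "q * x \<notin> NR" if "q \<notin> NR" "x \<notin> NR" for q x
  proof -
    obtain k l where "q = k * k" "x = l * l" using \<open>q \<notin> NR\<close> \<open>x \<notin> NR\<close> by (auto simp: NR_iff)
    then have "q * x = (k * l) * (k * l)" by (simp add: mult_ac)
    then show ?thesis unfolding NR_iff by blast
  qed
  obtain r where r: "q * r = 1" "r \<notin> NR"
    using square_inverse_23 assms by blast
  have "r * (q * x) = x" using r by (metis mult.assoc mult.commute mult_1)
  then show ?thesis using *[of q x] *[of r "q * x"] assms r by metis
qed

lemma NR_antisym: "x \<noteq> 0 \<Longrightarrow> - x \<in> NR \<longleftrightarrow> x \<notin> NR"
proof -
  have "\<forall>x. x \<noteq> 0 \<longrightarrow> (- x \<in> NR \<longleftrightarrow> x \<notin> NR)"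
    unfolding all_23 ball_simps by simp
  then show "x \<noteq> 0 \<Longrightarrow> - x \<in> NR \<longleftrightarrow> x \<notin> NR" by blast
qed

lemma zero_notin_NR: "0 \<notin> NR"
  by simp

text \<open>The next two lemmas exclude words of weight 4 with and without the point at infinity. Each
  reduces to a few cases because the squares act on the generators by multiplication. For the
  second, \<open>a \<rightarrow> b \<longleftrightarrow> b - a \<in> NR\<close> is a tournament in which the four points have even outdegrees
  among themselves, so that one of them has outdegree 0.\<close>

lemma no_parity_triple:
  assumes "b \<noteq> a" "c \<noteq> a"
    and par: "\<And>i. (a - i \<in> NR) = ((b - i \<in> NR) = (c - i \<in> NR))"
  shows False
proof -
  have *: False if b: "b \<noteq> 0" and c: "c \<noteq> 0" "c \<notin> NR"
    and par: "\<And>j. (- j \<in> NR) = ((b - j \<in> NR) = (c - j \<in> NR))" for b c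
  proof -
    obtain r where r: "c * r = 1" "r \<notin> NR" "r \<noteq> 0"
      using square_inverse_23 c by blast
    define d where "d = r * b"
    have b_eq: "b = c * d" using r by (simp add: d_def mult.assoc[symmetric])
    have par': "(- j \<in> NR) = ((d - j \<in> NR) = (1 - j \<in> NR))" for j
      using par[of "c * j"] NR_mult_square[OF c(2,1), of "- j"] NR_mult_square[OF c(2,1), of "d - j"]
        NR_mult_square[OF c(2,1), of "1 - j"]
      by (simp add: b_eq algebra_simps)
    have "d \<in> NR" using par'[of 0] zero_notin_NR by simp
    \<comment> \<open>After translation and scaling the points are 0, \<open>d\<close> and 1; three
      generators already refute each of the eleven nonsquares \<open>d\<close>.\<close>
    moreover have "\<forall>d. d \<in> NR \<longrightarrow> \<not> (\<forall>j\<in>{1,3,18}. (- j \<in> NR) = ((d - j \<in> NR) = (1 - j \<in> NR)))"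
      unfolding all_23 ball_simps by simp
    ultimately show False using par' by blast
  qed
  have par0: "(- j \<in> NR) = ((b - a - j \<in> NR) = (c - a - j \<in> NR))" for j
    using par[of "j + a"] by (simp add: algebra_simps)
  show False
  proof (cases "c - a \<in> NR")
    case False
    then show False using *[of "b - a" "c - a"] par0 assms by simp
  next
    case True
    \<comment> \<open>Parity at 0 makes exactly one of \<open>b - a\<close> and \<open>c - a\<close>
      a nonsquare, so exchanging \<open>b\<close> and \<open>c\<close> leads back to the normalized
      situation.\<close>
    then have "b - a \<notin> NR" using par0[of 0] zero_notin_NR by simp
    moreover have "(- j \<in> NR) = ((c - a - j \<in> NR) = (b - a - j \<in> NR))" for j
      using par0[of j] by argo
    ultimately show False using *[of "c - a" "b - a"] assms by simp
  qed
qed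

lemma no_parity_quadruple:
  assumes dist: "distinct [a, b, c, d]"
    and par: "\<And>i. ((a - i \<in> NR) = (b - i \<in> NR)) = ((c - i \<in> NR) = (d - i \<in> NR))"
  shows False
proof -
  have *: False if dist: "distinct [a, b, c, d]"
    and par: "\<And>i. ((a - i \<in> NR) = (b - i \<in> NR)) = ((c - i \<in> NR) = (d - i \<in> NR))"
    and sink: "b - a \<notin> NR" "c - a \<notin> NR" "d - a \<notin> NR" for a b c d
  proof -
    define q where "q = b - a"
    have q: "q \<notin> NR" "q \<noteq> 0" using sink dist by (auto simp: q_def)
    obtain r where r: "q * r = 1" "r \<notin> NR" "r \<noteq> 0"
      using square_inverse_23 q by blast
    define x where "x = r * (c - a)"
    define y where "y = r * (d - a)"
    have eqs: "b = a + q" "c = a + q * x" "d = a + q * y"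
      using r by (simp_all add: x_def y_def q_def mult.assoc[symmetric])
    have par': "((- j \<in> NR) = (1 - j \<in> NR)) = ((x - j \<in> NR) = (y - j \<in> NR))" for j
      using par[of "a + q * j"] NR_mult_square[OF q, of "- j"] NR_mult_square[OF q, of "1 - j"]
        NR_mult_square[OF q, of "x - j"] NR_mult_square[OF q, of "y - j"]
      by (simp add: eqs algebra_simps)
    have "x \<notin> NR" "y \<notin> NR" using sink r by (simp_all add: x_def y_def NR_mult_square)
    moreover have "distinct [0, 1, x, y]" using dist by (auto simp: eqs)
    \<comment> \<open>The sink sits at 0 and a second point at 1; four generators exclude every
      remaining pair of distinct squares.\<close>
    moreover have "\<forall>x. x \<notin> NR \<longrightarrow> (\<forall>y. y \<notin> NR \<longrightarrow> distinct [0, 1, x, y] \<longrightarrow>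
        \<not> (\<forall>j\<in>{1,2,20,21}. ((- j \<in> NR) = (1 - j \<in> NR)) = ((x - j \<in> NR) = (y - j \<in> NR))))"
      unfolding all_23 ball_simps by simp
    ultimately show False using par' by blast
  qed
  have anti: "u - v \<in> NR \<longleftrightarrow> v - u \<notin> NR" if "u \<noteq> v" for u v
    using NR_antisym[of "v - u"] that by simp
  have "a \<noteq> b" "a \<noteq> c" "a \<noteq> d" "b \<noteq> c" "b \<noteq> d" "c \<noteq> d" using dist by auto
  note A = anti[OF this(1)] anti[OF this(2)] anti[OF this(3)] anti[OF this(4)] anti[OF this(5)] anti[OF this(6)]
  note P = par[of a] par[of b] par[of c] par[of d]
  \<comment> \<open>The six arcs are distributed over four even outdegrees of at most 3, which must
    be 2, 2, 2 and 0.\<close>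
  consider "b - a \<notin> NR" "c - a \<notin> NR" "d - a \<notin> NR" | "a - b \<notin> NR" "c - b \<notin> NR" "d - b \<notin> NR"
    | "a - c \<notin> NR" "b - c \<notin> NR" "d - c \<notin> NR" | "a - d \<notin> NR" "b - d \<notin> NR" "c - d \<notin> NR"
    using A P zero_notin_NR unfolding diff_self by argo
  then show False
  proof cases
    case 1
    then show False using *[of a b c d] dist par by blast
  next
    case 2
    have "((b - i \<in> NR) = (a - i \<in> NR)) = ((c - i \<in> NR) = (d - i \<in> NR))" for i
      using par[of i] by argo
    then show False using *[of b a c d] 2 dist by auto
  next
    case 3
    have "((c - i \<in> NR) = (a - i \<in> NR)) = ((b - i \<in> NR) = (d - i \<in> NR))" for i
      using par[of i] by argo
    then show False using *[of c a b d] 3 dist by auto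
  next
    case 4
    have "((d - i \<in> NR) = (a - i \<in> NR)) = ((b - i \<in> NR) = (c - i \<in> NR))" for i
      using par[of i] by argo
    then show False using *[of d a b c] 4 dist by auto
  qed
qed

lemma even_card_Int_4:
  assumes "distinct [p, q, r, s]"
  shows "even (card ({p, q, r, s} \<inter> G)) \<longleftrightarrow> ((p \<in> G) = (q \<in> G)) = ((r \<in> G) = (s \<in> G))"
  using assms by (auto simp: Int_insert_left card_insert_if)

lemma golay_card_neq_4:
  assumes W: "W \<in> golay"
  shows "card W \<noteq> 4"
proof
  assume "card W = 4"
  moreover obtain xs where xs: "set xs = W" "distinct xs"
    using finite_distinct_list[of W] by auto
  ultimately have "length xs = Suc (Suc (Suc (Suc 0)))"
    using distinct_card[OF xs(2)] by simp
  then obtain p q r s where "xs = [p, q, r, s]"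
    by (auto simp: length_Suc_conv)
  with xs have pqrs: "W = {p, q, r, s}" "distinct [p, q, r, s]"
    by auto
  have par: "((p \<in> generator i) = (q \<in> generator i)) = ((r \<in> generator i) = (s \<in> generator i))" for i
    using golay_self_orthogonal[OF W golay_gen[of i]]
    unfolding pqrs(1) even_card_Int_4[OF pqrs(2)] .
  have none: False if dist: "distinct [None, q, r, s]"
    and par: "\<And>i. ((None \<in> generator i) = (q \<in> generator i)) = ((r \<in> generator i) = (s \<in> generator i))" for q r s
  proof -
    obtain a where "q = Some a" using dist by (cases q) auto
    moreover obtain b where "r = Some b" using dist by (cases r) auto
    moreover obtain c where "s = Some c" using dist by (cases s) auto
    moreover note dist
    ultimately have "b \<noteq> a" "c \<noteq> a" "(a - i \<in> NR) = ((b - i \<in> NR) = (c - i \<in> NR))" for i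
      using par[of i] by (auto simp: Some_in_gen)
    then show False by (rule no_parity_triple)
  qed
  show False
  proof (cases "None \<in> W")
    case True
    then consider "p = None" | "q = None" | "r = None" | "s = None" using pqrs by auto
    then show False
    proof cases
      case 1
      from pqrs(2) par show False unfolding 1 by (rule none)
    next
      case 2
      have "((None \<in> generator i) = (p \<in> generator i)) = ((r \<in> generator i) = (s \<in> generator i))" for i
        using par[of i] unfolding 2 by argo
      moreover have "distinct [None, p, r, s]" using pqrs(2) unfolding 2 by auto
      ultimately show False using none by iprover
    next
      case 3
      have "((None \<in> generator i) = (p \<in> generator i)) = ((q \<in> generator i) = (s \<in> generator i))" for i
        using par[of i] unfolding 3 by argo
      moreover have "distinct [None, p, q, s]" using pqrs(2) unfolding 3 by auto
      ultimately show False using none by iprover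
    next
      case 4
      have "((None \<in> generator i) = (p \<in> generator i)) = ((q \<in> generator i) = (r \<in> generator i))" for i
        using par[of i] unfolding 4 by argo
      moreover have "distinct [None, p, q, r]" using pqrs(2) unfolding 4 by auto
      ultimately show False using none by iprover
    qed
  next
    case False
    have "p \<noteq> None" "q \<noteq> None" "r \<noteq> None" "s \<noteq> None" using False pqrs(1) by auto
    then obtain a b c d where abcd: "p = Some a" "q = Some b" "r = Some c" "s = Some d" by auto
    then have "distinct [a, b, c, d]" using pqrs(2) by simp
    moreover have
      "((a - i \<in> NR) = (b - i \<in> NR)) = ((c - i \<in> NR) = (d - i \<in> NR))" for i
      using par[of i] unfolding abcd Some_in_gen .
    ultimately show False using no_parity_quadruple by iprover
  qed
qed

lemma card_points: "CARD(23 option) = 24"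
  by (simp add: card_UNIV_option)

lemma card_Compl_points: "card (- W) = 24 - card W" for W :: "23 option set"
  by (simp add: Compl_eq_Diff_UNIV card_Diff_subset card_points)

text \<open>Complementation turns the exclusion of weight 4 into that of weight 20.\<close>

lemma golay_weights:
  assumes "W \<in> golay"
  shows "card W \<in> {0, 8, 12, 16, 24}"
proof -
  have "card W \<le> 24"
    using card_mono[of UNIV W] by (simp add: card_points)
  moreover have "card W \<noteq> 20"
    using golay_card_neq_4[OF golay_Compl[OF assms]] by (simp add: card_Compl_points)
  ultimately show ?thesis
    using golay_doubly_even[OF assms] golay_card_neq_4[OF assms]
    unfolding insert_iff empty_iff by presburger
qed

lemma golay_min_weight: "W \<in> golay \<Longrightarrow> W \<noteq> {} \<Longrightarrow> 8 \<le> card W"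
  using golay_weights[of W] by auto

text \<open>Since the code separates points, the characters \<open>W \<mapsto> (-1)\<^bsup>[p \<in> W] + [q \<in> W]\<^esup>\<close> for \<open>p \<noteq> q\<close> sum to
  zero. This gives the second moment of \<open>24 - 2 |W|\<close> and hence the number of octads.\<close>

lemma card_octads_ge: "759 \<le> card {W \<in> golay. card W = 8}"
proof -
  define ch where "ch p W = (if p \<in> W then -1 else 1 :: int)" for p :: "23 option" and W
  have fin: "finite golay" by (rule finite)
  have sum_ch: "(\<Sum>p\<in>UNIV. ch p W) = 24 - 2 * int (card W)" for W
  proof -
    have "(\<Sum>p\<in>UNIV. ch p W) = (\<Sum>p\<in>UNIV. 1 - 2 * (if p \<in> W then 1 else 0))"
      by (intro sum.cong) (auto simp: ch_def)
    also have "\<dots> = 24 - 2 * int (card W)"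
      by (simp add: sum_subtractf sum_distrib_left[symmetric] card_points sum.If_cases)
    finally show ?thesis .
  qed
  have orth: "(\<Sum>W\<in>golay. ch p W * ch q W) = (if p = q then int (card golay) else 0)" for p q
  proof (cases "p = q")
    case True
    have "ch q W * ch q W = 1" for W by (simp add: ch_def)
    then show ?thesis using True by simp
  next
    case False
    obtain V where V: "V \<in> golay" "p \<in> V \<longleftrightarrow> q \<notin> V"
      using golay_separates_points[OF False] .
    have invol: "sym_diff (sym_diff W V) V = W" for W by auto
    have "(\<Sum>W\<in>golay. ch p W * ch q W) = (\<Sum>W\<in>golay. ch p (sym_diff W V) * ch q (sym_diff W V))"
      by (rule sum.reindex_bij_witness[of _ "\<lambda>W. sym_diff W V" "\<lambda>W. sym_diff W V"])
        (use V golay_sym_diff in \<open>simp_all only: invol\<close>)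
    also have "\<dots> = (\<Sum>W\<in>golay. - (ch p W * ch q W))"
      using V by (intro sum.cong) (auto simp: ch_def)
    finally show ?thesis using False by (simp add: sum_negf)
  qed
  have "(\<Sum>W\<in>golay. (24 - 2 * int (card W))\<^sup>2) = (\<Sum>W\<in>golay. \<Sum>p\<in>UNIV. \<Sum>q\<in>UNIV. ch p W * ch q W)"
    by (simp add: sum_ch[symmetric] power2_eq_square sum_product)
  also have "\<dots> = (\<Sum>p\<in>UNIV. \<Sum>q\<in>UNIV. \<Sum>W\<in>golay. ch p W * ch q W)"
    by (subst sum.swap, intro sum.cong refl, subst sum.swap) simp
  also have "\<dots> = 24 * int (card golay)"
    by (simp add: orth card_points)
  finally have moment: "(\<Sum>W\<in>golay. (24 - 2 * int (card W))\<^sup>2) = 24 * int (card golay)" .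
  have count: "(\<Sum>W\<in>golay. k * of_bool (P W)) = k * int (card {W \<in> golay. P W})"
    for k :: int and P
    by (simp add: sum_distrib_left[symmetric] of_bool_def sum.If_cases Int_def)
  have "(\<Sum>W\<in>golay. (24 - 2 * int (card W))\<^sup>2) =
      (\<Sum>W\<in>golay. 576 * of_bool (card W = 0) + 576 * of_bool (card W = 24) +
        64 * of_bool (card W = 8) + 64 * of_bool (card W = 16))"
    using golay_weights by (intro sum.cong) auto
  also have "\<dots> = 576 * int (card {W \<in> golay. card W = 0}) + 576 * int (card {W \<in> golay. card W = 24}) +
      64 * int (card {W \<in> golay. card W = 8}) + 64 * int (card {W \<in> golay. card W = 16})"
    by (simp only: sum.distrib count)
  finally have split: "(\<Sum>W\<in>golay. (24 - 2 * int (card W))\<^sup>2) =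
      576 * int (card {W \<in> golay. card W = 0}) + 576 * int (card {W \<in> golay. card W = 24}) +
      64 * int (card {W \<in> golay. card W = 8}) + 64 * int (card {W \<in> golay. card W = 16})" .
  have "{W \<in> golay. card W = 0} = {{}}"
    using golay.empty by auto
  then have c0: "card {W \<in> golay. card W = 0} = 1" by (metis card_1_singleton_iff One_nat_def)
  have "W = UNIV" if "card W = 24" for W :: "23 option set"
    using that card_subset_eq[of UNIV W] by (simp add: card_points)
  then have "{W \<in> golay. card W = 24} = {UNIV}"
    using golay_UNIV by (auto simp: card_points)
  then have c24: "card {W \<in> golay. card W = 24} = 1" by (metis card_1_singleton_iff One_nat_def)
  have c16: "card {W \<in> golay. card W = 16} = card {W \<in> golay. card W = 8}"
    by (rule bij_betw_same_card[of uminus], rule bij_betw_byWitness[of _ uminus])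
      (auto simp: golay_Compl card_Compl_points)
  show ?thesis
    \<comment> \<open>With \<open>N\<close> words and \<open>A\<close> octads the identity reads
      \<open>24 * N = 1152 + 128 * A\<close>: weight 12 contributes nothing, and weights 8 and 16
      occur equally often. For \<open>N = 4096\<close> this is \<open>A = 759\<close>.\<close>
    using split card_golay_ge unfolding moment c0 c24 c16 by linarith
qed

section \<open>The minimal vectors of the Leech lattice\<close>

text \<open>In this parametrization of \<open>\<surd>8 \<Lambda>\<close>, the class \<open>m\<close> is an arbitrary integer, not only 0 or 1.\<close>

definition leech_vec :: "int \<Rightarrow> 23 option set \<Rightarrow> (23 option \<Rightarrow> int) \<Rightarrow> 23 option \<Rightarrow> int" where
  "leech_vec m W a i = m + 2 * of_bool (i \<in> W) + 4 * a i"

definition leech_ints :: "(23 option \<Rightarrow> int) set" where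
  "leech_ints = {leech_vec m W a | m W a. W \<in> golay \<and> even (sum a UNIV - m)}"

definition sqnorm :: "(23 option \<Rightarrow> int) \<Rightarrow> int" where
  "sqnorm z = (\<Sum>i\<in>UNIV. (z i)\<^sup>2)"

lemma leech_intsI: "W \<in> golay \<Longrightarrow> even (sum a UNIV - m) \<Longrightarrow> leech_vec m W a \<in> leech_ints"
  unfolding leech_ints_def by blast

lemma sum_of_bool_mem: "(\<Sum>i\<in>UNIV. of_bool (i \<in> W)) = int (card W)" for W :: "23 option set"
  by (simp add: of_bool_def sum.If_cases)

lemma sum_leech_vec: "(\<Sum>i\<in>UNIV. leech_vec m W a i) = 24 * m + 2 * int (card W) + 4 * sum a UNIV"
  by (simp add: leech_vec_def sum.distrib sum_distrib_left[symmetric] sum_of_bool_mem card_points)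

text \<open>Lowering \<open>m\<close> by 2 complements \<open>W\<close> and carries 1 into
  \<open>a\<close> on \<open>W\<close>. The parity condition survives because \<open>card W\<close>
  is divisible by 4.\<close>

lemma leech_ints_reduced:
  assumes "z \<in> leech_ints"
  obtains m W a where "m \<in> {0, 1}" "W \<in> golay" "even (sum a UNIV - m)" "z = leech_vec m W a"
proof -
  from assms obtain m W a where z: "z = leech_vec m W a" and W: "W \<in> golay" and par: "even (sum a UNIV - m)"
    unfolding leech_ints_def by blast
  define r where "r = m mod 2"
  define q where "q = m div 4"
  have r: "r \<in> {0, 1}" unfolding r_def by auto
  have m: "m = r + 4 * q \<or> m = r + 2 + 4 * q"
    unfolding r_def q_def by presburger
  then show ?thesis
  proof
    assume m: "m = r + 4 * q"
    have "z = leech_vec r W (\<lambda>i. a i + q)"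
      by (rule ext) (simp add: z m leech_vec_def)
    moreover have "even (sum (\<lambda>i. a i + q) UNIV - r)"
      using par by (simp add: sum.distrib card_points m)
    ultimately show ?thesis using that r W by blast
  next
    assume m: "m = r + 2 + 4 * q"
    have "z = leech_vec r (- W) (\<lambda>i. a i + q + of_bool (i \<in> W))"
      by (rule ext) (simp add: z m leech_vec_def)
    moreover have "even (sum (\<lambda>i. a i + q + of_bool (i \<in> W)) UNIV - r)"
      using par golay_doubly_even[OF W] by (auto simp: sum.distrib card_points m sum_of_bool_mem)
    ultimately show ?thesis using that r golay_Compl[OF W] by blast
  qed
qed

lemma sum_leech_vec_mod:
  assumes "4 dvd card W"
  shows "(\<Sum>i\<in>UNIV. leech_vec m W a i) mod 8 = (4 * m) mod 8 \<longleftrightarrow> even (sum a UNIV - m)"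
proof -
  obtain q where q: "card W = 4 * q" using assms by blast
  have "(\<Sum>i\<in>UNIV. leech_vec m W a i) - 4 * m = 8 * (3 * m + int q) + 4 * (sum a UNIV - m)"
    by (simp add: sum_leech_vec q algebra_simps)
  then have "(\<Sum>i\<in>UNIV. leech_vec m W a i) mod 8 = (4 * m) mod 8 \<longleftrightarrow> 8 dvd 4 * (sum a UNIV - m)"
    by (simp only: mod_eq_dvd_iff dvd_add_right_iff[OF dvd_triv_left])
  also have "\<dots> \<longleftrightarrow> even (sum a UNIV - m)"
    using dvd_mult_cancel_left[of 4 2 "sum a UNIV - m"] by simp
  finally show ?thesis .
qed

lemma leech_ints_iff:
  "z \<in> leech_ints \<longleftrightarrow> (\<exists>m \<in> {0, 1}. (\<forall>i. z i mod 2 = m) \<and>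
      (\<Sum>i\<in>UNIV. z i) mod 8 = (4 * m) mod 8 \<and> (\<forall>k \<in> {0..3}. {i. z i mod 4 = k} \<in> golay))"
    (is "_ \<longleftrightarrow> ?R")
proof
  assume "z \<in> leech_ints"
  then obtain m W a where m: "m \<in> {0, 1}" and W: "W \<in> golay" and par: "even (sum a UNIV - m)"
    and z: "z = leech_vec m W a"
    by (rule leech_ints_reduced)
  have "z i mod 2 = m" for i
  proof -
    have "z i = m + 2 * (of_bool (i \<in> W) + 2 * a i)" by (simp add: z leech_vec_def)
    then show ?thesis using m by (simp only: mod_mult_self2) auto
  qed
  moreover have "(\<Sum>i\<in>UNIV. z i) mod 8 = (4 * m) mod 8"
    using par unfolding z sum_leech_vec_mod[OF golay_doubly_even[OF W]] .
  moreover have "{i. z i mod 4 = k} \<in> golay" for k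
  proof -
    have "z i mod 4 = (if i \<in> W then m + 2 else m)" for i
      using m by (auto simp: z leech_vec_def)
    then have "{i. z i mod 4 = k} \<in> {W, - W, {}}"
      by (auto split: if_splits)
    then show ?thesis using W golay_Compl golay.empty by auto
  qed
  ultimately show ?R using m by blast
next
  assume ?R
  then obtain m where m: "m \<in> {0, 1}" and z2: "\<And>i. z i mod 2 = m"
    and z8: "(\<Sum>i\<in>UNIV. z i) mod 8 = (4 * m) mod 8" and G: "\<And>k. k \<in> {0..3} \<Longrightarrow> {i. z i mod 4 = k} \<in> golay"
    by blast
  define W where "W = {i. z i mod 4 = m + 2}"
  define a where "a i = (z i - m - 2 * of_bool (i \<in> W)) div 4" for i
  have W: "W \<in> golay" unfolding W_def using m by (intro G) auto
  have z: "z = leech_vec m W a"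
  proof
    fix i
    have "4 dvd z i - m - 2 * of_bool (i \<in> W)"
      using m z2[of i] unfolding W_def of_bool_def by (auto split: if_splits) presburger+
    then show "z i = leech_vec m W a i" by (simp add: leech_vec_def a_def)
  qed
  have "even (sum a UNIV - m)"
    using z8 unfolding z sum_leech_vec_mod[OF golay_doubly_even[OF W]] .
  then show "z \<in> leech_ints" using W z leech_intsI by blast
qed

lemma leech_lattice_eq:
  "leech_lattice = (\<lambda>z. (1 / sqrt 8) *\<^sub>R (\<chi> i. real_of_int (z i))) ` leech_ints"
  unfolding leech_lattice_def leech_ints_iff[symmetric] by blast

lemma leech_ints_diff:
  assumes "z \<in> leech_ints" "w \<in> leech_ints"
  shows "(\<lambda>i. z i - w i) \<in> leech_ints"
proof -
  obtain m V a where z: "z = leech_vec m V a" and V: "V \<in> golay" and a: "even (sum a UNIV - m)"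
    using assms(1) unfolding leech_ints_def by blast
  obtain n W b where w: "w = leech_vec n W b" and W: "W \<in> golay" and b: "even (sum b UNIV - n)"
    using assms(2) unfolding leech_ints_def by blast
  \<comment> \<open>Subtracting the binary digits of \<open>W\<close> from those of \<open>V\<close>
    borrows exactly on \<open>W - V\<close>, whose size is even because \<open>card W\<close> and
    \<open>card (V \<inter> W)\<close> are.\<close>
  define c where "c i = a i - b i - of_bool (i \<in> W - V)" for i
  have "(\<lambda>i. z i - w i) = leech_vec (m - n) (sym_diff V W) c"
    by (rule ext) (auto simp: z w leech_vec_def c_def)
  moreover have "even (sum c UNIV - (m - n))"
  proof -
    have "card W = card (W - V) + card (V \<inter> W)"
      by (metis Int_commute add.commute card_Diff_subset_Int card_Int_Diff finite)
    then have "even (card (W - V))"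
      using golay_self_orthogonal[OF V W] golay_doubly_even[OF W] by presburger
    moreover have "sum c UNIV = sum a UNIV - sum b UNIV - int (card (W - V))"
      unfolding c_def sum_subtractf sum_of_bool_mem ..
    ultimately show ?thesis using a b by presburger
  qed
  ultimately show ?thesis using leech_intsI golay_sym_diff V W by metis
qed

lemma leech_ints_0: "(\<lambda>_. 0) \<in> leech_ints"
  using leech_intsI[OF golay.empty, of "\<lambda>_. 0" 0] by (simp add: leech_vec_def[abs_def])

lemma leech_ints_uminus: "z \<in> leech_ints \<Longrightarrow> (\<lambda>i. - z i) \<in> leech_ints"
  using leech_ints_diff[OF leech_ints_0] by simp

text \<open>In the scale of the lattice: squared norms are even integers. Modulo 16 the terms are
  absorbed by \<open>4 dvd card W\<close> and the parity of \<open>sum a UNIV - m\<close>.\<close>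

lemma dvd_sqnorm:
  assumes "z \<in> leech_ints"
  shows "16 dvd sqnorm z"
proof -
  obtain m W a where z: "z = leech_vec m W a" and W: "W \<in> golay" and par: "even (sum a UNIV - m)"
    using assms unfolding leech_ints_def by blast
  obtain k where k: "card W = 4 * k" using golay_doubly_even[OF W] by blast
  obtain s where "sum a UNIV - m = 2 * s" using par by (rule evenE)
  then have s: "sum a UNIV = m + 2 * s" by simp
  define t where "t = (\<Sum>i\<in>UNIV. (a i)\<^sup>2 + of_bool (i \<in> W) * a i)"
  have "(leech_vec m W a i)\<^sup>2 = m\<^sup>2 + (4 + 4 * m) * of_bool (i \<in> W) + 8 * m * a i +
      16 * ((a i)\<^sup>2 + of_bool (i \<in> W) * a i)" for i
    by (cases "i \<in> W") (simp_all add: leech_vec_def power2_eq_square algebra_simps)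
  then have "sqnorm z = 24 * m\<^sup>2 + (4 + 4 * m) * int (card W) + 8 * m * sum a UNIV + 16 * t"
    by (simp only: sqnorm_def z sum.distrib sum_distrib_left[symmetric] sum_of_bool_mem t_def)
      (simp add: card_points)
  also have "\<dots> = 16 * (2 * m\<^sup>2 + (1 + m) * int k + m * s + t)"
    by (simp add: k s power2_eq_square algebra_simps)
  finally show ?thesis by simp
qed

text \<open>By \<open>dvd_sqnorm\<close> it suffices to exceed 16. Odd vectors have 24 nonzero
  entries. Even ones with nonempty \<open>W\<close> have at least 8 entries of absolute value at
  least 2. In the remaining case \<open>z\<close> is 4 times a vector whose squared length is even,
  as its coordinate sum is.\<close>

lemma sqnorm_ge:
  assumes "z \<in> leech_ints" "z \<noteq> (\<lambda>_. 0)"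
  shows "32 \<le> sqnorm z"
proof -
  obtain m W a where m: "m \<in> {0, 1}" and W: "W \<in> golay" and par: "even (sum a UNIV - m)"
    and z: "z = leech_vec m W a"
    using assms(1) by (rule leech_ints_reduced)
  have sq: "k\<^sup>2 \<ge> 1" if "k \<noteq> 0" for k :: int
    using that by (metis int_one_le_iff_zero_less zero_less_power2)
  have "sqnorm z > 16"
  proof (cases "m = 1")
    case True
    have "1 \<le> (z i)\<^sup>2" for i
    proof (rule sq)
      have "z i = 1 + 2 * (of_bool (i \<in> W) + 2 * a i)" by (simp add: z True leech_vec_def)
      then show "z i \<noteq> 0" by presburger
    qed
    then have "(\<Sum>i\<in>(UNIV :: 23 option set). 1) \<le> sqnorm z"
      unfolding sqnorm_def by (intro sum_mono)
    then show ?thesis by (simp add: card_points)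
  next
    case False
    with m have m: "m = 0" by simp
    show ?thesis
    proof (cases "W = {}")
      case False
      have "4 * of_bool (i \<in> W) \<le> (z i)\<^sup>2" for i
      proof (cases "i \<in> W")
        case True
        have "1 + 2 * a i \<noteq> 0" by presburger
        from sq[OF this] show ?thesis
          using True by (simp add: z m leech_vec_def power2_eq_square algebra_simps)
      qed simp
      then have "(\<Sum>i\<in>UNIV. 4 * of_bool (i \<in> W)) \<le> sqnorm z"
        unfolding sqnorm_def by (intro sum_mono)
      then have "4 * int (card W) \<le> sqnorm z"
        by (simp only: sum_distrib_left[symmetric] sum_of_bool_mem)
      then show ?thesis using golay_min_weight[OF W False] by simp
    next
      case True
      have zi: "z i = 4 * a i" for i by (simp add: z m leech_vec_def True)
      have "\<exists>j. a j \<noteq> 0"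
      proof (rule ccontr)
        assume "\<nexists>j. a j \<noteq> 0"
        then have "z = (\<lambda>_. 0)" using zi by (intro ext) simp
        with assms(2) show False by contradiction
      qed
      then obtain j where "a j \<noteq> 0" by blast
      then have "1 \<le> (a j)\<^sup>2" by (rule sq)
      also have "\<dots> \<le> (\<Sum>i\<in>UNIV. (a i)\<^sup>2)" by (rule member_le_sum) simp_all
      finally have ge: "1 \<le> (\<Sum>i\<in>UNIV. (a i)\<^sup>2)" .
      have "even (\<Sum>i\<in>UNIV. (a i)\<^sup>2 - a i)"
        by (rule dvd_sum) (simp add: power2_eq_square)
      then have "even (\<Sum>i\<in>UNIV. (a i)\<^sup>2)"
        using par m by (simp add: sum_subtractf)
      with ge have "2 \<le> (\<Sum>i\<in>UNIV. (a i)\<^sup>2)" by presburger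
      then show ?thesis
        by (simp add: sqnorm_def zi power_mult_distrib sum_distrib_left[symmetric])
    qed
  qed
  then show ?thesis using dvd_sqnorm[OF assms(1)] by presburger
qed


abbreviation leech_point :: "(23 option \<Rightarrow> int) \<Rightarrow> real ^ 23 option" where
  "leech_point z \<equiv> (1 / sqrt 32) *\<^sub>R (\<chi> i. real_of_int (z i))"

definition min_leech_ints :: "(23 option \<Rightarrow> int) set" where
  "min_leech_ints = {z \<in> leech_ints. sqnorm z = 32}"

lemma inner_leech_point:
  "leech_point z \<bullet> leech_point w = real_of_int (\<Sum>i\<in>UNIV. z i * w i) / 32"
proof -
  have "leech_point z \<bullet> leech_point w = (\<Sum>i\<in>UNIV. real_of_int (z i) * real_of_int (w i)) / (sqrt 32 * sqrt 32)"
    by (simp add: inner_vec_def sum_divide_distrib)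
  then show ?thesis by simp
qed

lemma sqnorm_diff:
  "sqnorm (\<lambda>i. z i - w i) = sqnorm z + sqnorm w - 2 * (\<Sum>i\<in>UNIV. z i * w i)"
  by (simp add: sqnorm_def power2_diff sum.distrib sum_subtractf sum_distrib_left mult.assoc)

lemma norm_leech_point: "z \<in> min_leech_ints \<Longrightarrow> norm (leech_point z) = 1"
  unfolding norm_eq_1 inner_leech_point
  by (simp add: min_leech_ints_def sqnorm_def power2_eq_square)

lemma inj_leech_point: "leech_point z = leech_point w \<longleftrightarrow> z = w"
  by (auto simp: vec_eq_iff fun_eq_iff)

text \<open>Support \<open>P\<close>, negative signs on \<open>N\<close>. Multiplied by 4 for a pair
  \<open>P\<close>, or by 2 for an octad \<open>P\<close>, it gives two of the three shapes of
  minimal vectors.\<close>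

definition octad_vec :: "23 option set \<Rightarrow> 23 option set \<Rightarrow> 23 option \<Rightarrow> int" where
  "octad_vec P N i = (if i \<in> N then -1 else if i \<in> P then 1 else 0)"

text \<open>The third shape: one entry of absolute value 3, at \<open>j\<close>, and 23 entries of
  absolute value 1, with all signs switched on the codeword \<open>W\<close>.\<close>

definition odd_vec :: "23 option set \<Rightarrow> 23 option \<Rightarrow> 23 option \<Rightarrow> int" where
  "odd_vec W j i = (if i \<in> W then -1 else 1) * (if i = j then -3 else 1)"

lemma sum_octad_vec: "N \<subseteq> P \<Longrightarrow> sum (octad_vec P N) UNIV = int (card P) - 2 * int (card N)"
proof -
  assume "N \<subseteq> P"
  then have "octad_vec P N = (\<lambda>i. of_bool (i \<in> P) - 2 * of_bool (i \<in> N))"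
    by (auto simp: octad_vec_def fun_eq_iff)
  then show "sum (octad_vec P N) UNIV = int (card P) - 2 * int (card N)"
    by (simp only: sum_subtractf sum_distrib_left[symmetric] sum_of_bool_mem)
qed

lemma sqnorm_octad_vec: "N \<subseteq> P \<Longrightarrow> sqnorm (\<lambda>i. k * octad_vec P N i) = k\<^sup>2 * int (card P)"
proof -
  assume "N \<subseteq> P"
  then have "(k * octad_vec P N i)\<^sup>2 = k\<^sup>2 * of_bool (i \<in> P)" for i
    by (auto simp: octad_vec_def power2_eq_square)
  then show "sqnorm (\<lambda>i. k * octad_vec P N i) = k\<^sup>2 * int (card P)"
    by (simp only: sqnorm_def sum_distrib_left[symmetric] sum_of_bool_mem)
qed

lemma octad_vec_cancel:
  assumes "N \<subseteq> P" "N' \<subseteq> P'" "k \<noteq> 0" "(\<lambda>i. k * octad_vec P N i) = (\<lambda>i. k * octad_vec P' N' i)"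
  shows "P = P' \<and> N = N'"
proof -
  have "octad_vec P N = octad_vec P' N'"
    using assms(3,4) by (auto simp: fun_eq_iff)
  moreover have "N = {i. octad_vec P N i = -1}" "P = {i. octad_vec P N i \<noteq> 0}" if "N \<subseteq> P" for N P
    using that by (auto simp: octad_vec_def)
  ultimately show ?thesis using assms(1,2) by metis
qed

lemma pair_vec_min:
  assumes "card P = 2" "N \<subseteq> P"
  shows "(\<lambda>i. 4 * octad_vec P N i) \<in> min_leech_ints"
proof -
  have "(\<lambda>i. 4 * octad_vec P N i) = leech_vec 0 {} (octad_vec P N)"
    by (rule ext) (simp add: leech_vec_def)
  also have "\<dots> \<in> leech_ints"
    using assms by (intro leech_intsI golay.empty) (simp add: sum_octad_vec)
  finally show ?thesis
    using assms by (simp add: min_leech_ints_def sqnorm_octad_vec)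
qed

text \<open>The coordinate sum is \<open>16 - 4 * card N\<close>, so evenness of
  \<open>card N\<close> is the condition modulo 8.\<close>

lemma octad_vec_min:
  assumes "W \<in> golay" "card W = 8" "N \<subseteq> W" "even (card N)"
  shows "(\<lambda>i. 2 * octad_vec W N i) \<in> min_leech_ints"
proof -
  have "(\<lambda>i. 2 * octad_vec W N i) = leech_vec 0 W (\<lambda>i. - of_bool (i \<in> N))"
    using assms(3) by (intro ext) (auto simp: leech_vec_def octad_vec_def)
  also have "\<dots> \<in> leech_ints"
    using assms by (intro leech_intsI) (simp_all only: sum_negf sum_of_bool_mem, simp)
  finally show ?thesis
    using assms by (simp add: min_leech_ints_def sqnorm_octad_vec)
qed

lemma odd_vec_min:
  assumes "W \<in> golay"
  shows "odd_vec W j \<in> min_leech_ints"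
proof -
  define a :: "23 option \<Rightarrow> int"
    where "a i = (2 * of_bool (j \<in> W) - 1) * of_bool (i \<in> {j}) - of_bool (i \<in> W)" for i
  have "odd_vec W j = leech_vec 1 W a"
    by (rule ext) (auto simp: leech_vec_def odd_vec_def a_def)
  also have "\<dots> \<in> leech_ints"
  proof (rule leech_intsI[OF assms])
    have "sum a UNIV = (2 * of_bool (j \<in> W) - 1) * int (card {j}) - int (card W)"
      unfolding a_def sum_subtractf sum_distrib_left[symmetric] sum_of_bool_mem ..
    then show "even (sum a UNIV - 1)"
      using golay_doubly_even[OF assms] by (auto simp: of_bool_def)
  qed
  finally have "odd_vec W j \<in> leech_ints" .
  moreover have "(odd_vec W j i)\<^sup>2 = 1 + 8 * of_bool (i \<in> {j})" for i
    by (auto simp: odd_vec_def)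
  then have "sqnorm (odd_vec W j) = 32"
    by (simp only: sqnorm_def sum.distrib sum_distrib_left[symmetric] sum_of_bool_mem) (simp add: card_points)
  ultimately show ?thesis by (simp add: min_leech_ints_def)
qed

lemma odd_vec_cancel:
  assumes "odd_vec W j = odd_vec W' j'"
  shows "W = W' \<and> j = j'"
proof -
  have j: "{j} = {i. \<bar>odd_vec W j i\<bar> = 3}" for W j by (auto simp: odd_vec_def)
  \<comment> \<open>As -3 is 1 modulo 4, the large entry fits the same residue pattern as the
    others: 3 on \<open>W\<close> and 1 off it.\<close>
  have W: "W = {i. odd_vec W j i mod 4 = 3}" for W j by (auto simp: odd_vec_def split: if_splits)
  show ?thesis using j[of j W] j[of j' W'] W[of W j] W[of W' j'] assms by (metis singleton_inject)
qed

lemma card_even_subsets_ge: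
  assumes "finite W" "card W = Suc n"
  shows "2 ^ n \<le> card {N. N \<subseteq> W \<and> even (card N)}"
proof -
  obtain p where p: "p \<in> W" using assms by fastforce
  have "Pow (W - {p}) \<subseteq> (\<lambda>N. N - {p}) ` {N. N \<subseteq> W \<and> even (card N)}"
  proof
    fix M assume M: "M \<in> Pow (W - {p})"
    then have fin: "finite M" using assms(1) by (auto intro: finite_subset)
    define N where "N = (if even (card M) then M else insert p M)"
    have "N \<subseteq> W" using M p by (auto simp: N_def)
    moreover have "even (card N)"
      using M fin by (auto simp: N_def card_insert_if)
    moreover have "M = N - {p}" using M by (auto simp: N_def)
    ultimately show "M \<in> (\<lambda>N. N - {p}) ` {N. N \<subseteq> W \<and> even (card N)}" by blast
  qed
  then have "card (Pow (W - {p})) \<le> card {N. N \<subseteq> W \<and> even (card N)}"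
    using assms(1) by (intro surj_card_le) auto
  then show ?thesis using assms p by (simp add: card_Pow)
qed

lemma finite_min_leech_ints: "finite min_leech_ints"
proof (rule finite_subset)
  show "min_leech_ints \<subseteq> UNIV \<rightarrow>\<^sub>E {-6..6}"
  proof
    fix z assume "z \<in> min_leech_ints"
    then have z: "sqnorm z = 32" by (simp add: min_leech_ints_def)
    have "z i \<in> {-6..6}" for i
    proof -
      have "(z i)\<^sup>2 \<le> sqnorm z" unfolding sqnorm_def by (rule member_le_sum) simp_all
      then have "\<bar>z i\<bar>\<^sup>2 \<le> 6\<^sup>2" using z by simp
      then have "\<bar>z i\<bar> \<le> 6" by (rule power2_le_imp_le) simp
      then show ?thesis by auto
    qed
    then show "z \<in> UNIV \<rightarrow>\<^sub>E {-6..6}" by auto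
  qed
qed (intro finite_PiE finite; simp)

text \<open>The sum is 1104 + 97152 + 98304. The families are disjoint by residues: all entries
  divisible by 4, all even with some entry 2 modulo 4, all odd. That nothing else is minimal follows
  later from \<open>card_leech_code\<close>.\<close>

lemma card_min_leech_ints_ge: "196560 \<le> card min_leech_ints"
proof -
  define I1 where "I1 = Sigma {P :: 23 option set. card P = 2} Pow"
  define I2 where "I2 = Sigma {W \<in> golay. card W = 8} (\<lambda>W. {N. N \<subseteq> W \<and> even (card N)})"
  define I3 where "I3 = golay \<times> (UNIV :: 23 option set)"
  define f where "f k = (\<lambda>(P, N) i. k * octad_vec P N i)" for k
  define F1 where "F1 = f 4 ` I1"
  define F2 where "F2 = f 2 ` I2"
  define F3 where "F3 = case_prod odd_vec ` I3"
  have "card I1 = (\<Sum>P | card P = 2. card (Pow (P :: 23 option set)))"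
    unfolding I1_def by (intro card_SigmaI) auto
  also have "\<dots> = (\<Sum>P \<in> {P :: 23 option set. card P = 2}. 4)"
    by (intro sum.cong) (auto simp: card_Pow)
  also have "\<dots> = 1104"
    using n_subsets[of "UNIV :: 23 option set" 2] by (simp add: card_points choose_two)
  finally have I1: "card I1 = 1104" .
  have "759 * 128 \<le> card {W \<in> golay. card W = 8} * 128"
    using card_octads_ge by simp
  also have "\<dots> = (\<Sum>W \<in> {W \<in> golay. card W = 8}. 128)" by simp
  also have "\<dots> \<le> (\<Sum>W \<in> {W \<in> golay. card W = 8}. card {N. N \<subseteq> W \<and> even (card N)})"
  proof (rule sum_mono)
    fix W assume "W \<in> {W \<in> golay. card W = 8}"
    then show "128 \<le> card {N. N \<subseteq> W \<and> even (card N)}"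
      using card_even_subsets_ge[of W 7] by simp
  qed
  also have "\<dots> = card I2"
    unfolding I2_def by (intro card_SigmaI[symmetric]) auto
  finally have I2: "97152 \<le> card I2" by simp
  have I3: "98304 \<le> card I3"
    using card_golay_ge by (simp add: I3_def card_cartesian_product card_points)
  have "inj_on (f 4) I1"
    by (auto simp: inj_on_def f_def I1_def dest!: octad_vec_cancel[rotated 3])
  then have F1: "card F1 = 1104" by (simp add: F1_def card_image I1)
  have "inj_on (f 2) I2"
    by (auto simp: inj_on_def f_def I2_def dest!: octad_vec_cancel[rotated 3])
  then have F2: "97152 \<le> card F2" using I2 by (simp add: F2_def card_image)
  have "inj_on (case_prod odd_vec) I3"
    by (auto simp: inj_on_def dest: odd_vec_cancel)
  then have F3: "98304 \<le> card F3" using I3 by (simp add: F3_def card_image)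
  have sub: "F1 \<union> F2 \<union> F3 \<subseteq> min_leech_ints"
    by (auto simp: F1_def F2_def F3_def f_def I1_def I2_def I3_def pair_vec_min octad_vec_min odd_vec_min)
  have mod4: "z i mod 4 = 0" if "z \<in> F1" for z i
    using that by (auto simp: F1_def f_def)
  have mod2: "z i mod 2 = 0" if "z \<in> F2" for z i
    using that by (auto simp: F2_def f_def)
  have ex2: "\<exists>i. z i mod 4 = 2" if z: "z \<in> F2" for z
  proof -
    from z obtain W N where W: "card W = 8" "z = (\<lambda>i. 2 * octad_vec W N i)"
      by (auto simp: F2_def f_def I2_def)
    then obtain i where "i \<in> W" by fastforce
    then show ?thesis using W by (intro exI[of _ i]) (simp add: octad_vec_def)
  qed
  have odd: "z i mod 2 = 1" if "z \<in> F3" for z i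
    using that by (auto simp: F3_def odd_vec_def)
  have "F1 \<inter> F2 = {}" using mod4 ex2 by fastforce
  moreover have "(F1 \<union> F2) \<inter> F3 = {}"
  proof -
    have "z i mod 2 = 0" if "z \<in> F1 \<union> F2" for z i
      using that
    proof
      assume "z \<in> F1"
      from mod4[OF this, of i] show ?thesis by presburger
    qed (rule mod2)
    then show ?thesis using odd by fastforce
  qed
  moreover have "finite (F1 \<union> F2)" "finite F3"
    using sub finite_min_leech_ints by (auto intro: finite_subset)
  ultimately have "card (F1 \<union> F2 \<union> F3) = card F1 + card F2 + card F3"
    by (simp add: card_Un_disjoint)
  then show ?thesis
    using card_mono[OF finite_min_leech_ints sub] F1 F2 F3 by simp
qed

text \<open>The explicit vectors show that the bound of \<open>sqnorm_ge\<close> is attained.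
  Minimal vectors therefore have norm 2, and normalizing them turns \<open>sqrt 8\<close> into
  \<open>sqrt 32\<close>.\<close>

lemma leech_code_eq: "leech_code = leech_point ` min_leech_ints"
proof -
  let ?v = "\<lambda>z. (1 / sqrt 8) *\<^sub>R (\<chi> i. real_of_int (z i)) :: real ^ 23 option"
  have norm_v: "norm (?v z) = sqrt (real_of_int (sqnorm z) / 8)" for z
  proof -
    have "?v z \<bullet> ?v z = (\<Sum>i\<in>UNIV. real_of_int (z i) * real_of_int (z i)) / (sqrt 8 * sqrt 8)"
      by (simp add: inner_vec_def sum_divide_distrib)
    then show ?thesis by (simp add: norm_eq_sqrt_inner sqnorm_def power2_eq_square)
  qed
  have v0: "?v z = 0 \<longleftrightarrow> z = (\<lambda>_. 0)" for z
    by (auto simp: vec_eq_iff fun_eq_iff)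
  have nonempty: "min_leech_ints \<noteq> {}" using card_min_leech_ints_ge by auto
  have "minimal_vectors leech_lattice = ?v ` min_leech_ints"
  proof (intro equalityI subsetI)
    fix x assume "x \<in> minimal_vectors leech_lattice"
    then obtain z where z: "x = ?v z" "z \<in> leech_ints" "x \<noteq> 0"
      and le: "\<And>w. w \<in> leech_ints \<Longrightarrow> ?v w \<noteq> 0 \<Longrightarrow> norm x \<le> norm (?v w)"
      by (auto simp: minimal_vectors_def leech_lattice_eq)
    obtain w where w: "w \<in> min_leech_ints" using nonempty by blast
    then have "?v w \<noteq> 0" unfolding v0 by (auto simp: min_leech_ints_def sqnorm_def)
    then have "norm (?v z) \<le> norm (?v w)"
      using le[of w] w unfolding z(1) by (simp add: min_leech_ints_def del: norm_scaleR)
    then have "sqnorm z \<le> 32"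
      using w by (simp only: norm_v min_leech_ints_def mem_Collect_eq real_sqrt_le_iff)
    moreover have "32 \<le> sqnorm z" using z v0 by (intro sqnorm_ge) auto
    ultimately show "x \<in> ?v ` min_leech_ints"
      using z by (auto simp: min_leech_ints_def)
  next
    fix x assume "x \<in> ?v ` min_leech_ints"
    then obtain z where z: "x = ?v z" "z \<in> leech_ints" "sqnorm z = 32"
      by (auto simp: min_leech_ints_def)
    then have "x \<noteq> 0" unfolding z(1) v0 by (auto simp: sqnorm_def)
    moreover have "norm x \<le> norm (?v w)" if "w \<in> leech_ints" "?v w \<noteq> 0" for w
      using sqnorm_ge[OF that(1)] that(2) unfolding v0 z(1) norm_v z(3) real_sqrt_le_iff by simp
    ultimately show "x \<in> minimal_vectors leech_lattice"
      using z by (auto simp: minimal_vectors_def leech_lattice_eq)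
  qed
  moreover have "sgn (?v z) = leech_point z" if "z \<in> min_leech_ints" for z
  proof -
    have n: "norm (?v z) = 2"
      using that unfolding norm_v by (simp add: min_leech_ints_def)
    have "sqrt 32 = 2 * sqrt 8"
      using real_sqrt_mult[of 4 8] by simp
    then show ?thesis unfolding sgn_div_norm n by simp
  qed
  ultimately show ?thesis by (simp add: leech_code_def image_image)
qed

lemma card_leech_code_ge: "196560 \<le> card leech_code"
proof -
  have "card leech_code = card min_leech_ints"
    unfolding leech_code_eq by (intro card_image inj_onI) (simp only: inj_leech_point)
  then show ?thesis using card_min_leech_ints_ge by simp
qed

lemma finite_leech_code: "finite leech_code"
  by (simp add: leech_code_eq finite_min_leech_ints)

lemma norm_leech_code: "x \<in> leech_code \<Longrightarrow> norm x = 1"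
  by (auto simp: leech_code_eq norm_leech_point simp del: norm_scaleR)

lemma uminus_leech_code: "x \<in> leech_code \<Longrightarrow> - x \<in> leech_code"
proof -
  assume "x \<in> leech_code"
  then obtain z where z: "z \<in> min_leech_ints" "x = leech_point z" by (auto simp: leech_code_eq)
  have "(\<lambda>i. - z i) \<in> min_leech_ints"
    using z by (auto simp: min_leech_ints_def leech_ints_uminus sqnorm_def)
  moreover have "- x = leech_point (\<lambda>i. - z i)"
    by (simp add: z vec_eq_iff)
  ultimately show "- x \<in> leech_code" unfolding leech_code_eq by (intro image_eqI)
qed

text \<open>\<open>x - y\<close> corresponds to an integral vector of \<open>sqnorm\<close> equal to
  \<open>16 * k\<close> and at least 32, whence \<open>x \<bullet> y = 1 - k / 4\<close> with
  \<open>k \<ge> 2\<close>. The same for \<open>- y\<close> bounds the inner product from the other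
  side.\<close>

lemma inner_leech_code:
  assumes "x \<in> leech_code" "y \<in> leech_code" "x \<noteq> y" "x \<noteq> - y"
  shows "x \<bullet> y \<in> {-1/2, -1/4, 0, 1/4, 1/2}"
proof -
  have *: "\<exists>k \<ge> 2. x \<bullet> y = 1 - real_of_int k / 4" 
    if xy: "x \<in> leech_code" "y \<in> leech_code" "x \<noteq> y" for x y
  proof -
    obtain z w where z: "z \<in> min_leech_ints" "x = leech_point z" and w: "w \<in> min_leech_ints" "y = leech_point w"
      using xy unfolding leech_code_eq by blast
    have d: "(\<lambda>i. z i - w i) \<in> leech_ints"
      using z w by (auto simp: min_leech_ints_def intro: leech_ints_diff)
    have "(\<lambda>i. z i - w i) \<noteq> (\<lambda>_. 0)"
      using xy(3) unfolding z(2) w(2) inj_leech_point by (auto simp: fun_eq_iff)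
    then have ge: "32 \<le> sqnorm (\<lambda>i. z i - w i)" by (rule sqnorm_ge[OF d])
    obtain k where k: "sqnorm (\<lambda>i. z i - w i) = 16 * k" using dvd_sqnorm[OF d] by (rule dvdE)
    then have "(\<Sum>i\<in>UNIV. z i * w i) = 32 - 8 * k"
      using z w by (simp add: sqnorm_diff min_leech_ints_def)
    then have "x \<bullet> y = 1 - real_of_int k / 4"
      unfolding z(2) w(2) inner_leech_point by simp
    then show ?thesis using ge k by (intro exI[of _ k]) simp
  qed
  obtain k where k: "k \<ge> 2" "x \<bullet> y = 1 - real_of_int k / 4"
    using * assms by blast
  obtain l where l: "l \<ge> 2" "x \<bullet> (- y) = 1 - real_of_int l / 4"
    using *[of x "- y"] assms uminus_leech_code by blast
  have "real_of_int (k + l) = 8" using k l by simp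
  then have "k + l = 8" by linarith
  then have "k \<in> {2, 3, 4, 5, 6}" using k l by auto
  then show ?thesis using k(2) by auto
qed

section \<open>The Leech code is an 11-design\<close>

text \<open>The mean of \<open>(u \<bullet> z)\<^sup>a (w \<bullet> z)\<^sup>b\<close> over the unit sphere of dimension \<open>n\<close>, for unit vectors
  \<open>u\<close>, \<open>w\<close> with \<open>u \<bullet> w = t\<close>.\<close>

fun joint_moment :: "nat \<Rightarrow> real \<Rightarrow> nat \<Rightarrow> nat \<Rightarrow> real" where
  "joint_moment n t 0 0 = 1"
| "joint_moment n t 0 (Suc 0) = 0"
| "joint_moment n t 0 (Suc (Suc b)) = real (Suc b) * joint_moment n t 0 b / (real n + real b)"
| "joint_moment n t (Suc 0) b = real b * t * joint_moment n t 0 (b - 1) / (real n + real b - 1)"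
| "joint_moment n t (Suc (Suc a)) b =
     (real (Suc a) * joint_moment n t a b + real b * t * joint_moment n t (Suc a) (b - 1)) /
       (real n + real (a + b))"

lemma joint_moment_0_rec:
  "2 \<le> b \<Longrightarrow> joint_moment n t 0 b = real (b - 1) * joint_moment n t 0 (b - 2) / (real n + real (b - 2))"
  using joint_moment.simps(3)[of n t "b - 2"] by (auto simp: numeral_2_eq_2 Suc_diff_Suc)

lemma joint_moment_rec:
  "2 \<le> a \<Longrightarrow> joint_moment n t a b =
     (real (a - 1) * joint_moment n t (a - 2) b + real b * t * joint_moment n t (a - 1) (b - 1)) /
       (real n + real (a - 2 + b))"
  using joint_moment.simps(5)[of n t "a - 2" b] by (auto simp: numeral_2_eq_2 Suc_diff_Suc)

lemma sphere_mean_joint_moment: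
  fixes u w :: "real ^ 'n :: {finite, wellorder}"
  assumes u: "norm u = 1" and w: "norm w = 1"
  shows "sphere_mean (\<lambda>z. (u \<bullet> z) ^ a * (w \<bullet> z) ^ b) = joint_moment CARD('n) (u \<bullet> w) a b"
proof -
  have uu: "u \<bullet> u = 1" and ww: "w \<bullet> w = 1" using u w by (simp_all add: norm_eq_1)
  have pos: "real CARD('n) + real k \<noteq> 0" for k
    using of_nat_0_le_iff[of k] by (metis add_pos_nonneg less_irrefl of_nat_0_less_iff zero_less_card_finite)
  show ?thesis
    using refl[of "CARD('n)"] refl[of "u \<bullet> w"]
  proof (induction "CARD('n)" "u \<bullet> w" a b rule: joint_moment.induct)
    case 1
    show ?case using sphere.prob_space by simp
  next
    case 2
    show ?case by (simp add: sphere_mean_odd real_polynomial_function_inner)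
  next
    case (3 b)
    show ?case
      using 3 sphere_mean_power_linear[of b w w] pos[of b]
      by (simp add: ww field_simps)
  next
    case (4 b)
    show ?case
    proof (cases b)
      case 0
      then show ?thesis by (simp add: sphere_mean_odd real_polynomial_function_inner)
    next
      case (Suc m)
      then show ?thesis
        using 4 sphere_mean_power_linear[of m w u] pos[of m]
        by (simp add: inner_commute[of w u] field_simps)
    qed
  next
    case (5 a b)
    have "(\<lambda>z. (u \<bullet> z) ^ Suc (Suc a) * (w \<bullet> z) ^ b) = (\<lambda>z. (u \<bullet> z) ^ Suc a * (w \<bullet> z) ^ b * (u \<bullet> z))"
      by (simp add: mult_ac)
    then show ?case
      using 5 sphere_mean_linear_recurrence[of a b u w u] pos[of "a + b"]
      by (simp add: uu inner_commute[of w u] eq_divide_eq mult_ac)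
  qed
qed

text \<open>The table evaluates the kernels of \<open>reproducing_zonal\<close>. Odd arguments occur
  because the recursion also lowers both arguments by 1.\<close>

lemma joint_moment_24:
  fixes t :: real
  shows "joint_moment 24 t 0 0 = 1"
    and "joint_moment 24 t 1 1 = 1 / 24 * t ^ 1"
    and "joint_moment 24 t 0 2 = 1 / 24"
    and "joint_moment 24 t 2 2 = 1 / 624 + 1 / 312 * t ^ 2"
    and "joint_moment 24 t 1 3 = 1 / 208 * t ^ 1"
    and "joint_moment 24 t 3 3 = 3 / 5824 * t ^ 1 + 1 / 2912 * t ^ 3"
    and "joint_moment 24 t 0 4 = 1 / 208"
    and "joint_moment 24 t 2 4 = 1 / 5824 + 1 / 1456 * t ^ 2"
    and "joint_moment 24 t 4 4 = 1 / 58240 + 1 / 7280 * t ^ 2 + 1 / 21840 * t ^ 4"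
    and "joint_moment 24 t 1 5 = 5 / 5824 * t ^ 1"
    and "joint_moment 24 t 3 5 = 1 / 11648 * t ^ 1 + 1 / 8736 * t ^ 3"
    and "joint_moment 24 t 5 5 = 5 / 372736 * t ^ 1 + 5 / 139776 * t ^ 3 + 1 / 139776 * t ^ 5"
    and "joint_moment 24 t 0 6 = 5 / 5824"
    and "joint_moment 24 t 2 6 = 1 / 34944 + 1 / 5824 * t ^ 2"
    and "joint_moment 24 t 4 6 = 1 / 372736 + 3 / 93184 * t ^ 2 + 1 / 46592 * t ^ 4"
    and "joint_moment 24 t 6 6 = 5 / 12673024 + 45 / 6336512 * t ^ 2 + 15 / 1584128 * t ^ 4 + 1 / 792064 * t ^ 6"
    and "joint_moment 24 t 1 7 = 1 / 4992 * t ^ 1"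
    and "joint_moment 24 t 3 7 = 1 / 53248 * t ^ 1 + 1 / 26624 * t ^ 3"
    and "joint_moment 24 t 5 7 = 5 / 1810432 * t ^ 1 + 5 / 452608 * t ^ 3 + 1 / 226304 * t ^ 5"
    and "joint_moment 24 t 7 7 = 35 / 65175552 * t ^ 1 + 35 / 10862592 * t ^ 3 + 7 / 2715648 * t ^ 5 + 1 / 4073472 * t ^ 7"
    and "joint_moment 24 t 0 8 = 1 / 4992"
    and "joint_moment 24 t 2 8 = 1 / 159744 + 1 / 19968 * t ^ 2"
    and "joint_moment 24 t 4 8 = 1 / 1810432 + 1 / 113152 * t ^ 2 + 1 / 113152 * t ^ 4"
    and "joint_moment 24 t 6 8 = 5 / 65175552 + 5 / 2715648 * t ^ 2 + 5 / 1357824 * t ^ 4 + 1 / 1018368 * t ^ 6"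
    and "joint_moment 24 t 8 8 = 35 / 2476670976 + 35 / 77395968 * t ^ 2 + 35 / 25798656 * t ^ 4 + 7 / 9674496 * t ^ 6 + 1 / 19348992 * t ^ 8"
    and "joint_moment 24 t 1 9 = 3 / 53248 * t ^ 1"
    and "joint_moment 24 t 3 9 = 9 / 1810432 * t ^ 1 + 3 / 226304 * t ^ 3"
    and "joint_moment 24 t 5 9 = 5 / 7241728 * t ^ 1 + 5 / 1357824 * t ^ 3 + 1 / 452608 * t ^ 5"
    and "joint_moment 24 t 7 9 = 35 / 275185664 * t ^ 1 + 35 / 34398208 * t ^ 3 + 21 / 17199104 * t ^ 5 + 1 / 4299776 * t ^ 7"
    and "joint_moment 24 t 9 9 = 63 / 2201485312 * t ^ 1 + 21 / 68796416 * t ^ 3 + 189 / 343982080 * t ^ 5 + 9 / 42997760 * t ^ 7 + 1 / 85995520 * t ^ 9"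
    and "joint_moment 24 t 0 10 = 3 / 53248"
    and "joint_moment 24 t 2 10 = 3 / 1810432 + 15 / 905216 * t ^ 2"
    and "joint_moment 24 t 4 10 = 1 / 7241728 + 5 / 1810432 * t ^ 2 + 5 / 1357824 * t ^ 4"
    and "joint_moment 24 t 6 10 = 5 / 275185664 + 75 / 137592832 * t ^ 2 + 25 / 17199104 * t ^ 4 + 5 / 8599552 * t ^ 6"
    and "joint_moment 24 t 8 10 = 7 / 2201485312 + 35 / 275185664 * t ^ 2 + 35 / 68796416 * t ^ 4 + 7 / 17199104 * t ^ 6 + 1 / 17199104 * t ^ 8"
    and "joint_moment 24 t 10 10 = 3 / 4402970624 + 75 / 2201485312 * t ^ 2 + 25 / 137592832 * t ^ 4 + 15 / 68796416 * t ^ 6 + 15 / 240787456 * t ^ 8 + 1 / 361181184 * t ^ 10"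
proof -
  show m0_0: "joint_moment 24 t 0 0 = 1"
    by (simp add: field_simps power_numeral_reduce)
  show m1_1: "joint_moment 24 t 1 1 = 1 / 24 * t ^ 1"
    by (simp add: m0_0 field_simps power_numeral_reduce)
  show m0_2: "joint_moment 24 t 0 2 = 1 / 24"
    by (simp add: joint_moment_0_rec[of 2] m0_0 field_simps power_numeral_reduce)
  show m2_2: "joint_moment 24 t 2 2 = 1 / 624 + 1 / 312 * t ^ 2"
    by (simp add: joint_moment_rec[of 2 24 t 2] m0_2 m1_1[unfolded One_nat_def] field_simps power_numeral_reduce del: joint_moment.simps)
  show m1_3: "joint_moment 24 t 1 3 = 1 / 208 * t ^ 1"
    by (simp add: m0_2 field_simps power_numeral_reduce)
  show m3_3: "joint_moment 24 t 3 3 = 3 / 5824 * t ^ 1 + 1 / 2912 * t ^ 3"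
    by (simp add: joint_moment_rec[of 3 24 t 3] m1_3[unfolded One_nat_def] m2_2 field_simps power_numeral_reduce del: joint_moment.simps)
  show m0_4: "joint_moment 24 t 0 4 = 1 / 208"
    by (simp add: joint_moment_0_rec[of 4] m0_2 field_simps power_numeral_reduce)
  show m2_4: "joint_moment 24 t 2 4 = 1 / 5824 + 1 / 1456 * t ^ 2"
    by (simp add: joint_moment_rec[of 2 24 t 4] m0_4 m1_3[unfolded One_nat_def] field_simps power_numeral_reduce del: joint_moment.simps)
  show m4_4: "joint_moment 24 t 4 4 = 1 / 58240 + 1 / 7280 * t ^ 2 + 1 / 21840 * t ^ 4"
    by (simp add: joint_moment_rec[of 4 24 t 4] m2_4 m3_3 field_simps power_numeral_reduce del: joint_moment.simps)
  show m1_5: "joint_moment 24 t 1 5 = 5 / 5824 * t ^ 1"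
    by (simp add: m0_4 field_simps power_numeral_reduce)
  show m3_5: "joint_moment 24 t 3 5 = 1 / 11648 * t ^ 1 + 1 / 8736 * t ^ 3"
    by (simp add: joint_moment_rec[of 3 24 t 5] m1_5[unfolded One_nat_def] m2_4 field_simps power_numeral_reduce del: joint_moment.simps)
  show m5_5: "joint_moment 24 t 5 5 = 5 / 372736 * t ^ 1 + 5 / 139776 * t ^ 3 + 1 / 139776 * t ^ 5"
    by (simp add: joint_moment_rec[of 5 24 t 5] m3_5 m4_4 field_simps power_numeral_reduce del: joint_moment.simps)
  show m0_6: "joint_moment 24 t 0 6 = 5 / 5824"
    by (simp add: joint_moment_0_rec[of 6] m0_4 field_simps power_numeral_reduce)
  show m2_6: "joint_moment 24 t 2 6 = 1 / 34944 + 1 / 5824 * t ^ 2"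
    by (simp add: joint_moment_rec[of 2 24 t 6] m0_6 m1_5[unfolded One_nat_def] field_simps power_numeral_reduce del: joint_moment.simps)
  show m4_6: "joint_moment 24 t 4 6 = 1 / 372736 + 3 / 93184 * t ^ 2 + 1 / 46592 * t ^ 4"
    by (simp add: joint_moment_rec[of 4 24 t 6] m2_6 m3_5 field_simps power_numeral_reduce del: joint_moment.simps)
  show m6_6: "joint_moment 24 t 6 6 = 5 / 12673024 + 45 / 6336512 * t ^ 2 + 15 / 1584128 * t ^ 4 + 1 / 792064 * t ^ 6"
    by (simp add: joint_moment_rec[of 6 24 t 6] m4_6 m5_5 field_simps power_numeral_reduce del: joint_moment.simps)
  show m1_7: "joint_moment 24 t 1 7 = 1 / 4992 * t ^ 1"
    by (simp add: m0_6 field_simps power_numeral_reduce)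
  show m3_7: "joint_moment 24 t 3 7 = 1 / 53248 * t ^ 1 + 1 / 26624 * t ^ 3"
    by (simp add: joint_moment_rec[of 3 24 t 7] m1_7[unfolded One_nat_def] m2_6 field_simps power_numeral_reduce del: joint_moment.simps)
  show m5_7: "joint_moment 24 t 5 7 = 5 / 1810432 * t ^ 1 + 5 / 452608 * t ^ 3 + 1 / 226304 * t ^ 5"
    by (simp add: joint_moment_rec[of 5 24 t 7] m3_7 m4_6 field_simps power_numeral_reduce del: joint_moment.simps)
  show m7_7: "joint_moment 24 t 7 7 = 35 / 65175552 * t ^ 1 + 35 / 10862592 * t ^ 3 + 7 / 2715648 * t ^ 5 + 1 / 4073472 * t ^ 7"
    by (simp add: joint_moment_rec[of 7 24 t 7] m5_7 m6_6 field_simps power_numeral_reduce del: joint_moment.simps)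
  show m0_8: "joint_moment 24 t 0 8 = 1 / 4992"
    by (simp add: joint_moment_0_rec[of 8] m0_6 field_simps power_numeral_reduce)
  show m2_8: "joint_moment 24 t 2 8 = 1 / 159744 + 1 / 19968 * t ^ 2"
    by (simp add: joint_moment_rec[of 2 24 t 8] m0_8 m1_7[unfolded One_nat_def] field_simps power_numeral_reduce del: joint_moment.simps)
  show m4_8: "joint_moment 24 t 4 8 = 1 / 1810432 + 1 / 113152 * t ^ 2 + 1 / 113152 * t ^ 4"
    by (simp add: joint_moment_rec[of 4 24 t 8] m2_8 m3_7 field_simps power_numeral_reduce del: joint_moment.simps)
  show m6_8: "joint_moment 24 t 6 8 = 5 / 65175552 + 5 / 2715648 * t ^ 2 + 5 / 1357824 * t ^ 4 + 1 / 1018368 * t ^ 6"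
    by (simp add: joint_moment_rec[of 6 24 t 8] m4_8 m5_7 field_simps power_numeral_reduce del: joint_moment.simps)
  show m8_8: "joint_moment 24 t 8 8 = 35 / 2476670976 + 35 / 77395968 * t ^ 2 + 35 / 25798656 * t ^ 4 + 7 / 9674496 * t ^ 6 + 1 / 19348992 * t ^ 8"
    by (simp add: joint_moment_rec[of 8 24 t 8] m6_8 m7_7 field_simps power_numeral_reduce del: joint_moment.simps)
  show m1_9: "joint_moment 24 t 1 9 = 3 / 53248 * t ^ 1"
    by (simp add: m0_8 field_simps power_numeral_reduce)
  show m3_9: "joint_moment 24 t 3 9 = 9 / 1810432 * t ^ 1 + 3 / 226304 * t ^ 3"
    by (simp add: joint_moment_rec[of 3 24 t 9] m1_9[unfolded One_nat_def] m2_8 field_simps power_numeral_reduce del: joint_moment.simps)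
  show m5_9: "joint_moment 24 t 5 9 = 5 / 7241728 * t ^ 1 + 5 / 1357824 * t ^ 3 + 1 / 452608 * t ^ 5"
    by (simp add: joint_moment_rec[of 5 24 t 9] m3_9 m4_8 field_simps power_numeral_reduce del: joint_moment.simps)
  show m7_9: "joint_moment 24 t 7 9 = 35 / 275185664 * t ^ 1 + 35 / 34398208 * t ^ 3 + 21 / 17199104 * t ^ 5 + 1 / 4299776 * t ^ 7"
    by (simp add: joint_moment_rec[of 7 24 t 9] m5_9 m6_8 field_simps power_numeral_reduce del: joint_moment.simps)
  show m9_9: "joint_moment 24 t 9 9 = 63 / 2201485312 * t ^ 1 + 21 / 68796416 * t ^ 3 + 189 / 343982080 * t ^ 5 + 9 / 42997760 * t ^ 7 + 1 / 85995520 * t ^ 9"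
    by (simp add: joint_moment_rec[of 9 24 t 9] m7_9 m8_8 field_simps power_numeral_reduce del: joint_moment.simps)
  show m0_10: "joint_moment 24 t 0 10 = 3 / 53248"
    by (simp add: joint_moment_0_rec[of 10] m0_8 field_simps power_numeral_reduce)
  show m2_10: "joint_moment 24 t 2 10 = 3 / 1810432 + 15 / 905216 * t ^ 2"
    by (simp add: joint_moment_rec[of 2 24 t 10] m0_10 m1_9[unfolded One_nat_def] field_simps power_numeral_reduce del: joint_moment.simps)
  show m4_10: "joint_moment 24 t 4 10 = 1 / 7241728 + 5 / 1810432 * t ^ 2 + 5 / 1357824 * t ^ 4"
    by (simp add: joint_moment_rec[of 4 24 t 10] m2_10 m3_9 field_simps power_numeral_reduce del: joint_moment.simps)
  show m6_10: "joint_moment 24 t 6 10 = 5 / 275185664 + 75 / 137592832 * t ^ 2 + 25 / 17199104 * t ^ 4 + 5 / 8599552 * t ^ 6"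
    by (simp add: joint_moment_rec[of 6 24 t 10] m4_10 m5_9 field_simps power_numeral_reduce del: joint_moment.simps)
  show m8_10: "joint_moment 24 t 8 10 = 7 / 2201485312 + 35 / 275185664 * t ^ 2 + 35 / 68796416 * t ^ 4 + 7 / 17199104 * t ^ 6 + 1 / 17199104 * t ^ 8"
    by (simp add: joint_moment_rec[of 8 24 t 10] m6_10 m7_9 field_simps power_numeral_reduce del: joint_moment.simps)
  show m10_10: "joint_moment 24 t 10 10 = 3 / 4402970624 + 75 / 2201485312 * t ^ 2 + 25 / 137592832 * t ^ 4 + 15 / 68796416 * t ^ 6 + 15 / 240787456 * t ^ 8 + 1 / 361181184 * t ^ 10"
    by (simp add: joint_moment_rec[of 10 24 t 10] m8_10 m9_9 field_simps power_numeral_reduce del: joint_moment.simps)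
qed

text \<open>Only even powers are recorded, since antipodality of the code settles the odd
  degrees.\<close>

definition even_poly :: "real list \<Rightarrow> real \<Rightarrow> real" where
  "even_poly c t = (\<Sum>i<length c. c ! i * t ^ (2 * i))"

lemma real_polynomial_function_even_poly [intro]:
  "real_polynomial_function f \<Longrightarrow> real_polynomial_function (\<lambda>z. even_poly c (f z))"
  unfolding even_poly_def by (intro polynomial_intros finite_lessThan) auto

text \<open>Kernels reproduced by convolution over the sphere are positive semidefinite. The zonal
  polynomials below are multiples of Gegenbauer polynomials in dimension 24.\<close>

definition reproducing :: "real \<Rightarrow> real list \<Rightarrow> bool" where
  "reproducing \<kappa> c \<longleftrightarrow> 0 < \<kappa> \<and> (\<forall>x y :: real ^ 23 option. norm x = 1 \<longrightarrow> norm y = 1 \<longrightarrow>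
     sphere_mean (\<lambda>z. even_poly c (x \<bullet> z) * even_poly c (y \<bullet> z)) = \<kappa> * even_poly c (x \<bullet> y))"

lemma sphere_mean_even_poly_product:
  fixes x y :: "real ^ 23 option"
  assumes "norm x = 1" "norm y = 1"
  shows "sphere_mean (\<lambda>z. even_poly c (x \<bullet> z) * even_poly c (y \<bullet> z)) =
    (\<Sum>i<length c. \<Sum>j<length c. c ! i * c ! j *
      joint_moment 24 (x \<bullet> y) (min (2 * i) (2 * j)) (max (2 * i) (2 * j)))"
proof -
  have "(\<lambda>z. even_poly c (x \<bullet> z) * even_poly c (y \<bullet> z)) =
      (\<lambda>z. \<Sum>i<length c. \<Sum>j<length c. (c ! i * c ! j) * ((x \<bullet> z) ^ (2 * i) * (y \<bullet> z) ^ (2 * j)))"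
    by (simp add: even_poly_def sum_product mult_ac)
  then have "sphere_mean (\<lambda>z. even_poly c (x \<bullet> z) * even_poly c (y \<bullet> z)) =
      sphere_mean (\<lambda>z. \<Sum>i<length c. \<Sum>j<length c. (c ! i * c ! j) * ((x \<bullet> z) ^ (2 * i) * (y \<bullet> z) ^ (2 * j)))"
    by (simp only:)
  also have "\<dots> = (\<Sum>i<length c. sphere_mean (\<lambda>z. \<Sum>j<length c.
      (c ! i * c ! j) * ((x \<bullet> z) ^ (2 * i) * (y \<bullet> z) ^ (2 * j))))"
    by (rule sphere.sum) (intro polynomial_intros finite_lessThan)+
  also have "\<dots> = (\<Sum>i<length c. \<Sum>j<length c.
      sphere_mean (\<lambda>z. (c ! i * c ! j) * ((x \<bullet> z) ^ (2 * i) * (y \<bullet> z) ^ (2 * j))))"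
    by (intro sum.cong refl sphere.sum polynomial_intros finite_lessThan)
  also have "\<dots> = (\<Sum>i<length c. \<Sum>j<length c. c ! i * c ! j *
      joint_moment 24 (x \<bullet> y) (min (2 * i) (2 * j)) (max (2 * i) (2 * j)))"
  proof (intro sum.cong refl)
    fix i j
    have *: "sphere_mean (\<lambda>z. (x \<bullet> z) ^ a * (y \<bullet> z) ^ b) = joint_moment 24 (x \<bullet> y) (min a b) (max a b)"
      for a b
    proof (cases "a \<le> b")
      case True
      then show ?thesis using sphere_mean_joint_moment[OF assms, of a b] by (simp add: card_points)
    next
      case False
      then show ?thesis using sphere_mean_joint_moment[OF assms(2,1), of b a]
        by (simp add: card_points inner_commute mult.commute)
    qed
    have "sphere_mean (\<lambda>z. (c ! i * c ! j) * ((x \<bullet> z) ^ (2 * i) * (y \<bullet> z) ^ (2 * j))) =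
        (c ! i * c ! j) * sphere_mean (\<lambda>z. (x \<bullet> z) ^ (2 * i) * (y \<bullet> z) ^ (2 * j))"
      by (rule sphere.cmult) (intro polynomial_intros)
    then show "sphere_mean (\<lambda>z. (c ! i * c ! j) * ((x \<bullet> z) ^ (2 * i) * (y \<bullet> z) ^ (2 * j))) =
        c ! i * c ! j * joint_moment 24 (x \<bullet> y) (min (2 * i) (2 * j)) (max (2 * i) (2 * j))"
      by (simp only: *)
  qed
  finally show ?thesis .
qed

lemma reproducingI:
  assumes "0 < \<kappa>"
    and "\<And>t. (\<Sum>i<length c. \<Sum>j<length c. c ! i * c ! j *
      joint_moment 24 t (min (2 * i) (2 * j)) (max (2 * i) (2 * j))) = \<kappa> * even_poly c t"
  shows "reproducing \<kappa> c"
  unfolding reproducing_def using assms by (simp add: sphere_mean_even_poly_product)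

text \<open>Each constant is the value of the polynomial at 1 divided by the dimension of the space
  of harmonic polynomials of that degree in 24 variables, for instance 23 / 299 = 1 / 13 in degree
  2.\<close>

lemma reproducing_zonal:
  shows "reproducing (1 / 13) [- 1, 24]"
    and "reproducing (1 / 30) [3, - 156, 728]"
    and "reproducing (1 / 442) [- 1, 84, - 840, 1792]"
    and "reproducing (1 / 247) [7, - 840, 13440, - 60928, 78336]"
    and "reproducing (1 / 273) [- 21, 3360, - 76160, 548352, - 1488384, 1323008]"
  by (rule reproducingI; simp add: even_poly_def joint_moment_24[unfolded One_nat_def]
      lessThan_Suc lessThan_nat_numeral numeral_2_eq_2[symmetric] algebra_simps power_numeral_reduce)+

lemma reproducing_sum_square:
  fixes S :: "(real ^ 23 option) set"
  assumes c: "reproducing \<kappa> c" and S: "finite S" "S \<subseteq> sphere 0 1"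
  shows "sphere_mean (\<lambda>z. (\<Sum>x\<in>S. even_poly c (x \<bullet> z))\<^sup>2) =
    \<kappa> * (\<Sum>x\<in>S. \<Sum>y\<in>S. even_poly c (x \<bullet> y))"
proof -
  have "sphere_mean (\<lambda>z. (\<Sum>x\<in>S. even_poly c (x \<bullet> z))\<^sup>2) =
      sphere_mean (\<lambda>z. \<Sum>x\<in>S. \<Sum>y\<in>S. even_poly c (x \<bullet> z) * even_poly c (y \<bullet> z))"
    by (simp add: power2_eq_square sum_product)
  also have "\<dots> = (\<Sum>x\<in>S. \<Sum>y\<in>S. sphere_mean (\<lambda>z. even_poly c (x \<bullet> z) * even_poly c (y \<bullet> z)))"
    using S(1) by (subst sphere.sum) (auto intro!: polynomial_intros sum.cong sphere.sum
        real_polynomial_function_even_poly)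
  also have "\<dots> = (\<Sum>x\<in>S. \<Sum>y\<in>S. \<kappa> * even_poly c (x \<bullet> y))"
    using c subsetD[OF S(2)] by (intro sum.cong refl) (simp add: reproducing_def)
  finally show ?thesis by (simp add: sum_distrib_left)
qed

lemma reproducing_sum_nonneg:
  fixes S :: "(real ^ 23 option) set"
  assumes "reproducing \<kappa> c" "finite S" "S \<subseteq> sphere 0 1"
  shows "0 \<le> (\<Sum>x\<in>S. \<Sum>y\<in>S. even_poly c (x \<bullet> y))"
proof -
  have "0 \<le> sphere_mean (\<lambda>z. (\<Sum>x\<in>S. even_poly c (x \<bullet> z))\<^sup>2)"
    by (intro integral_nonneg_AE) simp
  then show ?thesis
    using assms(1) unfolding reproducing_sum_square[OF assms] reproducing_def
    by (simp add: zero_le_mult_iff)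
qed

lemma linear_term_eq_0:
  fixes A B :: real
  assumes "\<And>s. 0 \<le> s\<^sup>2 * A + 2 * s * B"
  shows "B = 0"
proof (rule ccontr)
  assume "B \<noteq> 0"
  have "0 \<le> A" using assms[of 1] assms[of "- 1"] by simp
  \<comment> \<open>The minimizer of the quadratic would be \<open>- B / A\<close>; adding 1 keeps
    the denominator positive when \<open>A = 0\<close>.\<close>
  define s where "s = - B / (A + 1)"
  have "s\<^sup>2 * A + 2 * s * B = - (B\<^sup>2 * (A + 2)) / (A + 1)\<^sup>2"
    using \<open>0 \<le> A\<close> by (simp add: s_def field_simps power2_eq_square add_nonneg_eq_0_iff)
  also have "\<dots> < 0"
    using \<open>B \<noteq> 0\<close> \<open>0 \<le> A\<close> by (simp add: zero_less_mult_iff add_nonneg_eq_0_iff)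
  finally show False using assms[of s] by simp
qed

text \<open>The hypothesis forces \<open>h\<close> to have mean square 0. By the Cauchy-Schwarz
  argument of \<open>linear_term_eq_0\<close> it is then orthogonal to every zonal function
  \<open>g\<close>, and the reproducing property reads this off as the value of \<open>h\<close> at
  \<open>u\<close>.\<close>

lemma reproducing_sum_eq_0:
  fixes S :: "(real ^ 23 option) set"
  assumes c: "reproducing \<kappa> c" and S: "finite S" "S \<subseteq> sphere 0 1"
    and le: "(\<Sum>x\<in>S. \<Sum>y\<in>S. even_poly c (x \<bullet> y)) \<le> 0" and u: "norm u = 1"
  shows "(\<Sum>y\<in>S. even_poly c (u \<bullet> y)) = 0"
proof -
  define g where "g z = even_poly c (u \<bullet> z)" for z
  define h where "h z = (\<Sum>y\<in>S. even_poly c (y \<bullet> z))" for z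
  have poly: "real_polynomial_function g" "real_polynomial_function h"
    using S(1) by (auto simp: g_def[abs_def] h_def[abs_def] intro!: polynomial_intros
        real_polynomial_function_even_poly)
  have "(\<Sum>x\<in>S. \<Sum>y\<in>S. even_poly c (x \<bullet> y)) = 0"
    using reproducing_sum_nonneg[OF c S] le by simp
  then have hh: "sphere_mean (\<lambda>z. (h z)\<^sup>2) = 0"
    unfolding h_def reproducing_sum_square[OF c S] by simp
  have gh: "sphere_mean (\<lambda>z. g z * h z) = \<kappa> * (\<Sum>y\<in>S. even_poly c (u \<bullet> y))"
  proof -
    have "sphere_mean (\<lambda>z. g z * h z) = (\<Sum>y\<in>S. sphere_mean (\<lambda>z. even_poly c (u \<bullet> z) * even_poly c (y \<bullet> z)))"
      unfolding g_def h_def sum_distrib_left using S(1)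
      by (intro sphere.sum polynomial_intros real_polynomial_function_even_poly)
    also have "\<dots> = (\<Sum>y\<in>S. \<kappa> * even_poly c (u \<bullet> y))"
      using c subsetD[OF S(2)] u by (intro sum.cong refl) (simp add: reproducing_def)
    finally show ?thesis by (simp add: sum_distrib_left)
  qed
  have "0 \<le> s\<^sup>2 * sphere_mean (\<lambda>z. (g z)\<^sup>2) + 2 * s * sphere_mean (\<lambda>z. g z * h z)" for s
  proof -
    have "0 \<le> sphere_mean (\<lambda>z. (s * g z + h z)\<^sup>2)"
      by (intro integral_nonneg_AE) simp
    also have "\<dots> = sphere_mean (\<lambda>z. (s\<^sup>2 * (g z)\<^sup>2 + (2 * s) * (g z * h z)) + (h z)\<^sup>2)"
      by (simp add: power2_eq_square algebra_simps)
    also have "\<dots> = sphere_mean (\<lambda>z. s\<^sup>2 * (g z)\<^sup>2 + (2 * s) * (g z * h z)) + sphere_mean (\<lambda>z. (h z)\<^sup>2)"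
      by (intro sphere.add polynomial_intros poly)
    also have "sphere_mean (\<lambda>z. s\<^sup>2 * (g z)\<^sup>2 + (2 * s) * (g z * h z)) =
        sphere_mean (\<lambda>z. s\<^sup>2 * (g z)\<^sup>2) + sphere_mean (\<lambda>z. (2 * s) * (g z * h z))"
      by (intro sphere.add polynomial_intros poly)
    also have "sphere_mean (\<lambda>z. s\<^sup>2 * (g z)\<^sup>2) = s\<^sup>2 * sphere_mean (\<lambda>z. (g z)\<^sup>2)"
      by (intro sphere.cmult polynomial_intros poly)
    also have "sphere_mean (\<lambda>z. (2 * s) * (g z * h z)) = (2 * s) * sphere_mean (\<lambda>z. g z * h z)"
      by (intro sphere.cmult polynomial_intros poly)
    finally show ?thesis using hh by simp
  qed
  then have "sphere_mean (\<lambda>z. g z * h z) = 0" by (rule linear_term_eq_0)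
  then show ?thesis using c by (auto simp: gh reproducing_def)
qed

lemma leech_code_sphere: "leech_code \<subseteq> sphere 0 1"
  by (auto simp: norm_leech_code)

abbreviation "Z2 \<equiv> [- 1, 24]"
abbreviation "Z4 \<equiv> [3, - 156, 728]"
abbreviation "Z6 \<equiv> [- 1, 84, - 840, 1792]"
abbreviation "Z8 \<equiv> [7, - 840, 13440, - 60928, 78336]"
abbreviation "Z10 \<equiv> [- 21, 3360, - 76160, 548352, - 1488384, 1323008]"

lemmas zonal_simps = even_poly_def lessThan_nat_numeral lessThan_Suc

text \<open>The constant term 1 / 2184 is the mean over the sphere. As the polynomial is 45 at 1 and
  at -1, the bound is 2 * 45 * 2184 = 196560.\<close>

lemma leech_lp_polynomial:
  "64 * t ^ 10 - 20 * t ^ 8 + t ^ 6 = 1 / 2184 + 137 / 45696 * even_poly Z2 t + 955 / 396032 * even_poly Z4 t + 2551 / 306432 * even_poly Z6 t + 13 / 19584 * even_poly Z8 t + 1 / 20672 * even_poly Z10 t"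
  by (simp add: zonal_simps field_simps power_numeral_reduce)

text \<open>The polynomial \<open>64 t\<^sup>1\<^sup>0 - 20 t\<^sup>8 + t\<^sup>6 = 64 t\<^sup>6 (t\<^sup>2 - 1/4) (t\<^sup>2 - 1/16)\<close> vanishes at the inner
  products other than \<open>\<plusminus>1\<close> and has positive zonal coefficients. The linear programming bound
  it gives for antipodal codes is attained, which forces all zonal sums to vanish.\<close>

lemma
  shows card_leech_code: "card leech_code = 196560"
    and zonal_sums: "c \<in> {Z2, Z4, Z6, Z8, Z10} \<Longrightarrow> norm u = 1 \<Longrightarrow> (\<Sum>y\<in>leech_code. even_poly c (u \<bullet> y)) = 0"
proof -
  define L where "L = leech_code"
  define F :: "real \<Rightarrow> real" where "F t = 64 * t ^ 10 - 20 * t ^ 8 + t ^ 6" for t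
  define S where "S c = (\<Sum>x\<in>L. \<Sum>y\<in>L. even_poly c (x \<bullet> y))" for c
  have L: "finite L" "L \<subseteq> sphere 0 1"
    by (simp_all add: L_def finite_leech_code leech_code_sphere)
  have "(\<Sum>y\<in>L. F (x \<bullet> y)) = 90" if x: "x \<in> L" for x
  proof -
    have xx: "x \<bullet> x = 1" using norm_leech_code[of x] x by (simp add: L_def norm_eq_1)
    then have nx: "x \<noteq> - x" by (metis inner_minus_right one_neq_neg_one)
    have "(\<Sum>y\<in>L. F (x \<bullet> y)) = (\<Sum>y\<in>{x, - x}. F (x \<bullet> y))"
    proof (rule sum.mono_neutral_right[OF L(1)])
      show "{x, - x} \<subseteq> L" using x uminus_leech_code by (auto simp: L_def)
      show "\<forall>y\<in>L - {x, - x}. F (x \<bullet> y) = 0"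
      proof
        fix y assume "y \<in> L - {x, - x}"
        then have "x \<bullet> y \<in> {-1/2, -1/4, 0, 1/4, 1/2}"
          using inner_leech_code[of x y] x by (auto simp: L_def equation_minus_iff[of x y])
        then show "F (x \<bullet> y) = 0"
          by (elim insertE emptyE) (simp_all only: F_def, simp_all add: power_divide)
      qed
    qed
    also have "\<dots> = F (x \<bullet> x) + F (- (x \<bullet> x))" using nx by simp
    also have "\<dots> = 90" using xx by (simp add: F_def)
    finally show ?thesis .
  qed
  then have "(\<Sum>x\<in>L. \<Sum>y\<in>L. F (x \<bullet> y)) = 90 * card L" by simp
  moreover have "(\<Sum>x\<in>L. \<Sum>y\<in>L. F (x \<bullet> y)) = (card L)\<^sup>2 / 2184 + 137 / 45696 * S Z2 + 955 / 396032 * S Z4 + 2551 / 306432 * S Z6 + 13 / 19584 * S Z8 + 1 / 20672 * S Z10"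
    unfolding F_def leech_lp_polynomial S_def sum.distrib sum_distrib_left[symmetric]
    by (simp add: power2_eq_square)
  ultimately have eq: "137 / 45696 * S Z2 + 955 / 396032 * S Z4 + 2551 / 306432 * S Z6 + 13 / 19584 * S Z8 + 1 / 20672 * S Z10 =
      real (card L) * (196560 - real (card L)) / 2184"
    by (simp add: field_simps power2_eq_square)
  have ge: "196560 \<le> real (card L)" using card_leech_code_ge by (simp add: L_def)
  have S_nonneg: "0 \<le> S c" if "c \<in> {Z2, Z4, Z6, Z8, Z10}" for c
    unfolding S_def using that reproducing_zonal reproducing_sum_nonneg[OF _ L] by blast
  have nonneg: "0 \<le> S Z2" "0 \<le> S Z4" "0 \<le> S Z6" "0 \<le> S Z8" "0 \<le> S Z10"
    by (rule S_nonneg; blast)+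
  have "real (card L) * (196560 - real (card L)) / 2184 \<le> 0"
    using ge by (simp add: mult_le_0_iff)
  then have zero: "S Z2 = 0" "S Z4 = 0" "S Z6 = 0" "S Z8 = 0" "S Z10 = 0"
    using nonneg unfolding eq[symmetric] by linarith+
  then have "real (card L) * (196560 - real (card L)) / 2184 = 0"
    using eq by simp
  then show "card leech_code = 196560" using ge by (auto simp: L_def)
  show "(\<Sum>y\<in>leech_code. even_poly c (u \<bullet> y)) = 0" if c: "c \<in> {Z2, Z4, Z6, Z8, Z10}" and u: "norm u = 1"
  proof -
    obtain \<kappa> where "reproducing \<kappa> c" using c reproducing_zonal by blast
    moreover have "S c = 0" using c zero by blast
    ultimately show ?thesis using reproducing_sum_eq_0[OF _ L _ u] by (simp add: L_def S_def)
  qed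
qed

lemma even_power_zonal:
  "(t :: real) ^ 2 = 1 / 24 + 1 / 24 * even_poly Z2 t"
  "(t :: real) ^ 4 = 1 / 208 + 1 / 112 * even_poly Z2 t + 1 / 728 * even_poly Z4 t"
  "(t :: real) ^ 6 = 5 / 5824 + 1 / 448 * even_poly Z2 t + 15 / 23296 * even_poly Z4 t + 1 / 1792 * even_poly Z6 t"
  "(t :: real) ^ 8 = 1 / 4992 + 1 / 1536 * even_poly Z2 t + 15 / 56576 * even_poly Z4 t + 1 / 2304 * even_poly Z6 t + 1 / 78336 * even_poly Z8 t"
  "(t :: real) ^ 10 = 3 / 53248 + 15 / 69632 * even_poly Z2 t + 25 / 226304 * even_poly Z4 t + 5 / 19456 * even_poly Z6 t + 1 / 69632 * even_poly Z8 t + 1 / 1323008 * even_poly Z10 t"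
  by (simp_all add: zonal_simps field_simps power_numeral_reduce)

text \<open>Odd moments vanish on both sides by antipodality, so the even degrees up to 10 give
  strength 11.\<close>

theorem leech_code_11_design: "spherical_design 11 leech_code"
  unfolding spherical_design_iff_power_means
proof (intro conjI allI impI)
  show "spherical_code leech_code"
    by (simp add: spherical_code_def finite_leech_code leech_code_sphere)
  fix k :: nat and u :: "real ^ 23 option" assume k: "k \<le> 11"
  let ?L = leech_code
  have N: "real (card ?L) = 196560" by (simp add: card_leech_code)
  show "(\<Sum>x\<in>?L. (u \<bullet> x) ^ k) / real (card ?L) = sphere_mean (\<lambda>z. (u \<bullet> z) ^ k)"
  proof (cases "odd k")
    case True
    have "(\<Sum>x\<in>?L. (u \<bullet> x) ^ k) = (\<Sum>x\<in>?L. (u \<bullet> (- x)) ^ k)"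
      by (rule sum.reindex_bij_witness[of _ uminus uminus]) (auto simp: uminus_leech_code)
    also have "\<dots> = - (\<Sum>x\<in>?L. (u \<bullet> x) ^ k)"
      using True by (simp add: sum_negf)
    finally have "(\<Sum>x\<in>?L. (u \<bullet> x) ^ k) = 0" by simp
    moreover have "sphere_mean (\<lambda>z. (u \<bullet> z) ^ k) = 0"
      using True by (intro sphere_mean_odd polynomial_intros) simp
    ultimately show ?thesis by simp
  next
    case even: False
    obtain w :: "real ^ 23 option" where w: "norm w = 1" "u = norm u *\<^sub>R w"
    proof (cases "u = 0")
      case True
      obtain e :: "real ^ 23 option" where "norm e = 1"
        using vector_choose_size[of 1] by auto
      then show ?thesis using that[of e] True by simp
    next
      case False
      then show ?thesis using that[of "sgn u"] by (simp add: norm_sgn sgn_div_norm)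
    qed
    have Z: "(\<Sum>y\<in>?L. even_poly Z2 (w \<bullet> y)) = 0" "(\<Sum>y\<in>?L. even_poly Z4 (w \<bullet> y)) = 0"
      "(\<Sum>y\<in>?L. even_poly Z6 (w \<bullet> y)) = 0" "(\<Sum>y\<in>?L. even_poly Z8 (w \<bullet> y)) = 0"
      "(\<Sum>y\<in>?L. even_poly Z10 (w \<bullet> y)) = 0"
      by (rule zonal_sums[OF _ w(1)]; blast)+
    have mean: "sphere_mean (\<lambda>z. (w \<bullet> z) ^ k) = joint_moment 24 1 0 k"
      using sphere_mean_joint_moment[OF w(1,1), of 0 k] w(1) by (simp add: card_points norm_eq_1)
    have "k \<in> {0, 2, 4, 6, 8, 10}" using even k by auto
    then have "(\<Sum>y\<in>?L. (w \<bullet> y) ^ k) / real (card ?L) = sphere_mean (\<lambda>z. (w \<bullet> z) ^ k)"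
      unfolding mean
      by (elim insertE emptyE; simp add: even_power_zonal sum.distrib sum_distrib_left[symmetric]
          sum_divide_distrib[symmetric] Z joint_moment_24 card_leech_code)
    moreover have "(u \<bullet> y) ^ k = norm u ^ k * (w \<bullet> y) ^ k" for y
      by (subst w(2)) (simp add: power_mult_distrib)
    ultimately show ?thesis
      using sphere_mean_power[OF w(1), of u k]
      by (simp add: sum_distrib_left[symmetric] mult.commute flip: times_divide_eq_right)
  qed
qed

section \<open>Gegenbauer polynomials\<close>

lemma poly_real_eqI: "(\<And>t :: real. poly p t = poly q t) \<Longrightarrow> p = q"
  by (simp add: poly_eq_poly_eq_iff[symmetric] fun_eq_iff)

text \<open>The Gegenbauer polynomial of degree \<open>i\<close> in dimension \<open>2 m + 3\<close> is the hypergeometric polynomial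
  \<open>F(-i, i + 2 m + 1; m + 1; (1 - t) / 2)\<close>; its differential equation gives orthogonality.\<close>

fun hyper_coeff :: "nat \<Rightarrow> nat \<Rightarrow> nat \<Rightarrow> real" where
  "hyper_coeff m i 0 = 1"
| "hyper_coeff m i (Suc j) = hyper_coeff m i j *
     ((real j - real i) * (real j + real i + 2 * real m + 1)) / ((real j + 1) * (real j + real m + 1))"

definition hyper_poly :: "nat \<Rightarrow> nat \<Rightarrow> real poly" where
  "hyper_poly m i = (\<Sum>j\<le>i. monom (hyper_coeff m i j) j)"

definition geg_poly :: "nat \<Rightarrow> nat \<Rightarrow> real poly" where
  "geg_poly m i = pcompose (hyper_poly m i) [:1/2, -1/2:]"

lemma hyper_coeff_eq_0: "i < j \<Longrightarrow> hyper_coeff m i j = 0"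
proof (induction j)
  case (Suc j)
  then show ?case by (cases "i = j") auto
qed simp

lemma hyper_coeff_neq_0: "j \<le> i \<Longrightarrow> hyper_coeff m i j \<noteq> 0"
proof (induction j)
  case (Suc j)
  then have "real j + real i + 2 * real m + 1 > 0" "real j + real m + 1 > 0" "real j < real i" by auto
  then show ?case using Suc by simp
qed simp

lemma coeff_hyper_poly: "coeff (hyper_poly m i) j = hyper_coeff m i j"
proof -
  have "coeff (hyper_poly m i) j = (\<Sum>k\<le>i. if k = j then hyper_coeff m i k else 0)"
    by (simp add: hyper_poly_def coeff_sum coeff_monom)
  then show ?thesis by (simp add: hyper_coeff_eq_0)
qed

lemma degree_hyper_poly: "degree (hyper_poly m i) = i"
proof (rule antisym)
  show "degree (hyper_poly m i) \<le> i"
    by (rule degree_le) (simp add: coeff_hyper_poly hyper_coeff_eq_0)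
  show "i \<le> degree (hyper_poly m i)"
    by (rule le_degree) (simp add: coeff_hyper_poly hyper_coeff_neq_0)
qed

lemma hyper_poly_ode:
  "[:0, 1, -1:] * pderiv (pderiv (hyper_poly m i)) + smult (real m + 1) ([:1, -2:] * pderiv (hyper_poly m i)) +
    smult (real i * (real i + 2 * real m + 1)) (hyper_poly m i) = 0"
proof (rule poly_eqI)
  fix j
  have step: "hyper_coeff m i (Suc k) * ((real k + 1) * (real k + real m + 1)) =
      hyper_coeff m i k * ((real k - real i) * (real k + real i + 2 * real m + 1))" for k
  proof -
    have "(real k + 1) * (real k + real m + 1) \<noteq> 0" by (simp add: add_nonneg_eq_0_iff)
    then show ?thesis by simp
  qed
  show "coeff ([:0, 1, -1:] * pderiv (pderiv (hyper_poly m i)) + smult (real m + 1) ([:1, -2:] * pderiv (hyper_poly m i)) +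
    smult (real i * (real i + 2 * real m + 1)) (hyper_poly m i)) j = coeff 0 j"
  proof (cases j)
    case 0
    then show ?thesis using step[of 0]
      by (simp add: coeff_pderiv coeff_hyper_poly algebra_simps del: hyper_coeff.simps(2))
  next
    case (Suc k)
    then show ?thesis using step[of j]
      by (cases k) (simp_all add: coeff_pderiv coeff_hyper_poly algebra_simps del: hyper_coeff.simps(2))
  qed
qed

lemma degree_geg_poly: "degree (geg_poly m i) = i"
  by (simp add: geg_poly_def degree_pcompose degree_hyper_poly)

lemma poly_geg_poly_1: "poly (geg_poly m i) 1 = 1"
  by (simp add: geg_poly_def poly_pcompose poly_0_coeff_0 coeff_hyper_poly)

abbreviation weight_poly :: "real poly" where "weight_poly \<equiv> [:1, 0, -1:]"

lemma geg_poly_ode: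
  "weight_poly * pderiv (pderiv (geg_poly m i)) =
    smult (2 * real m + 2) ([:0, 1:] * pderiv (geg_poly m i)) -
    smult (real i * (real i + 2 * real m + 1)) (geg_poly m i)"
proof -
  let ?Q = "hyper_poly m i" and ?l = "[:1/2, -1/2:] :: real poly"
  have d1: "pderiv (geg_poly m i) = smult (-1/2) (pcompose (pderiv ?Q) ?l)"
    by (simp add: geg_poly_def pderiv_pcompose pderiv_pCons)
  have d2: "pderiv (pderiv (geg_poly m i)) = smult (1/4) (pcompose (pderiv (pderiv ?Q)) ?l)"
    unfolding d1 by (simp add: pderiv_smult pderiv_minus pderiv_pcompose pderiv_pCons)
  show ?thesis
  proof (rule poly_real_eqI)
    fix t :: real
    define s where "s = (1 - t) / 2"
    have l: "poly ?l t = s" and t: "t = 1 - 2 * s" by (simp_all add: s_def field_simps)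
    have "poly ([:0, 1, -1:] * pderiv (pderiv ?Q) + smult (real m + 1) ([:1, -2:] * pderiv ?Q) +
        smult (real i * (real i + 2 * real m + 1)) ?Q) s = 0"
      unfolding hyper_poly_ode by simp
    then show "poly (weight_poly * pderiv (pderiv (geg_poly m i))) t =
        poly (smult (2 * real m + 2) ([:0, 1:] * pderiv (geg_poly m i)) -
          smult (real i * (real i + 2 * real m + 1)) (geg_poly m i)) t"
      unfolding d2 unfolding d1 unfolding geg_poly_def poly_mult poly_smult poly_diff poly_add poly_pcompose l
      unfolding t by (simp add: field_simps)
  qed
qed

definition weighted_integral :: "nat \<Rightarrow> real poly \<Rightarrow> real" where
  "weighted_integral m p = integral {-1..1} (\<lambda>t. poly p t * (1 - t\<^sup>2) ^ m)"

lemma weighted_integrable: "(\<lambda>t. poly p t * (1 - t\<^sup>2) ^ m) integrable_on {-1..1 :: real}"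
  by (intro integrable_continuous_real continuous_intros)

lemma weighted_integral_add: "weighted_integral m (p + q) = weighted_integral m p + weighted_integral m q"
  by (simp add: weighted_integral_def distrib_right integral_add weighted_integrable)

lemma weighted_integral_smult: "weighted_integral m (smult c p) = c * weighted_integral m p"
  by (simp add: weighted_integral_def mult.assoc)

lemma weighted_integral_0 [simp]: "weighted_integral m 0 = 0"
  by (simp add: weighted_integral_def)

lemma weighted_integral_diff: "weighted_integral m (p - q) = weighted_integral m p - weighted_integral m q"
  using weighted_integral_add[of m "p - q" q] by simp

lemma weighted_integral_square_eq_0:
  assumes "weighted_integral m (p * p) = 0"
  shows "p = 0"
proof -
  have zero: "poly (p * p) t * (1 - t\<^sup>2) ^ m = 0" if "t \<in> {-1..1}" for t :: real
  proof -
    have "\<forall>t\<in>{-1..1}. poly (p * p) t * (1 - t\<^sup>2) ^ m = 0"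
    proof (subst integral_eq_0_iff[symmetric])
      show "continuous_on {-1..1} (\<lambda>t. poly (p * p) t * (1 - t\<^sup>2) ^ m)"
        by (intro continuous_intros)
      fix t :: real assume "t \<in> {-1..1}"
      then have "t\<^sup>2 \<le> 1" by (simp add: abs_square_le_1 abs_le_iff)
      then show "0 \<le> poly (p * p) t * (1 - t\<^sup>2) ^ m" by simp
    qed (use assms in \<open>simp_all add: weighted_integral_def\<close>)
    then show ?thesis using that by blast
  qed
  have "{0<..<1} \<subseteq> {t. poly p t = 0}"
  proof
    fix t :: real assume t: "t \<in> {0<..<1}"
    then have "t\<^sup>2 < 1" by (simp add: power_less_one_iff abs_square_less_1)
    then show "t \<in> {t. poly p t = 0}" using zero[of t] t by simp
  qed
  then have "infinite {t. poly p t = 0}"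
    by (rule infinite_super) (simp add: infinite_Ioo)
  then show ?thesis using poly_roots_finite by blast
qed

text \<open>The Sturm-Liouville argument. \<open>D\<close> is the Wronskian times the weight to the
  power \<open>Suc m\<close>, so it vanishes at both end points, and its derivative is the integrand
  times the difference of the eigenvalues, which is nonzero for distinct degrees.\<close>

lemma geg_poly_orthogonal:
  assumes "i \<noteq> j"
  shows "weighted_integral m (geg_poly m i * geg_poly m j) = 0"
proof -
  let ?P = "geg_poly m i" and ?R = "geg_poly m j"
  define \<mu> where "\<mu> k = real k * (real k + 2 * real m + 1)" for k
  define D where "D = weight_poly ^ Suc m * (pderiv ?P * ?R - ?P * pderiv ?R)"
  have ode: "(1 - t\<^sup>2) * poly (pderiv (pderiv (geg_poly m k))) t =
      (2 * real m + 2) * (t * poly (pderiv (geg_poly m k)) t) - \<mu> k * poly (geg_poly m k) t" for k t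
    using arg_cong[OF geg_poly_ode[of m k], of "\<lambda>p. poly p t"]
    by (simp add: \<mu>_def power2_eq_square algebra_simps)
  have D': "poly (pderiv D) t = (\<mu> j - \<mu> i) * (poly (?P * ?R) t * (1 - t\<^sup>2) ^ m)" for t
  proof -
    have "poly (pderiv D) t = (1 - t\<^sup>2) ^ m *
        (((1 - t\<^sup>2) * poly (pderiv (pderiv ?P)) t) * poly ?R t -
         poly ?P t * ((1 - t\<^sup>2) * poly (pderiv (pderiv ?R)) t) -
         (2 * real m + 2) * t * (poly (pderiv ?P) t * poly ?R t - poly ?P t * poly (pderiv ?R) t))"
      unfolding D_def pderiv_mult[of "weight_poly ^ Suc m"] pderiv_power_Suc
      by (simp add: pderiv_mult pderiv_diff pderiv_pCons poly_power power2_eq_square algebra_simps)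
    then show ?thesis unfolding ode by (simp add: algebra_simps)
  qed
  have "(poly (pderiv D) has_integral poly D 1 - poly D (-1)) {-1..1}"
  proof (rule fundamental_theorem_of_calculus)
    fix t :: real
    have "(poly D has_vector_derivative poly (pderiv D) t) (at t)"
      using poly_DERIV[of D t] by (simp only: has_real_derivative_iff_has_vector_derivative)
    then show "(poly D has_vector_derivative poly (pderiv D) t) (at t within {-1..1})"
      by (rule has_vector_derivative_at_within)
  qed simp
  then have "integral {-1..1} (poly (pderiv D)) = 0"
    by (simp add: integral_unique) (simp add: D_def)
  then have "(\<mu> j - \<mu> i) * weighted_integral m (?P * ?R) = 0"
    unfolding weighted_integral_def D'[abs_def] by simp
  moreover have "\<mu> i \<noteq> \<mu> j"
  proof -
    have "\<mu> j - \<mu> i = (real j - real i) * (real i + real j + 2 * real m + 1)"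
      by (simp add: \<mu>_def algebra_simps)
    moreover have "real i + real j + 2 * real m + 1 \<noteq> 0" by (simp add: add_nonneg_eq_0_iff)
    ultimately show ?thesis using assms by auto
  qed
  ultimately show ?thesis by simp
qed

lemma is_gegenbauer_iff:
  assumes "0 < m"
  shows "is_gegenbauer (2 * m + 3) P \<longleftrightarrow>
    (\<forall>i. degree (P i) = i \<and> poly (P i) 1 = 1) \<and>
    (\<forall>i j. i \<noteq> j \<longrightarrow> weighted_integral m (P i * P j) = 0)"
proof -
  have "integral {-1..1} (\<lambda>t. poly (P i) t * poly (P j) t * (1 - t\<^sup>2) powr ((real (2 * m + 3) - 3) / 2)) =
      weighted_integral m (P i * P j)" for i j
    unfolding weighted_integral_def
  proof (rule integral_cong)
    fix t :: real assume "t \<in> {-1..1}"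
    then have "t\<^sup>2 \<le> 1" by (simp add: abs_square_le_1 abs_le_iff)
    \<comment> \<open>At the end points \<open>0 powr 0\<close> is 0 but \<open>0 ^ 0\<close> is 1;
      \<open>0 < m\<close> makes both powers 0 there.\<close>
    then have "(1 - t\<^sup>2) powr real m = (1 - t\<^sup>2) ^ m"
      using assms by (cases "t\<^sup>2 = 1") (auto simp: powr_realpow)
    then show "poly (P i) t * poly (P j) t * (1 - t\<^sup>2) powr ((real (2 * m + 3) - 3) / 2) =
        poly (P i * P j) t * (1 - t\<^sup>2) ^ m" by simp
  qed
  then show ?thesis unfolding is_gegenbauer_def by simp
qed

lemma orthogonal_to_lower_degree:
  assumes deg: "\<And>k. degree (Q k) = k" and nz: "\<And>k. Q k \<noteq> 0"
    and orth: "\<And>k. k < i \<Longrightarrow> weighted_integral m (Q k * R) = 0"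
  shows "degree p < d \<Longrightarrow> d \<le> i \<Longrightarrow> weighted_integral m (p * R) = 0"
proof (induction d arbitrary: p)
  case (Suc d)
  define r where "r = p - smult (coeff p d / lead_coeff (Q d)) (Q d)"
  have "weighted_integral m (r * R) = 0"
  proof (cases "r = 0")
    case False
    have "coeff r k = 0" if "d \<le> k" for k
    proof (cases "k = d")
      case True
      moreover have "coeff (Q d) d \<noteq> 0"
        using nz[of d] deg[of d] leading_coeff_neq_0[of "Q d"] by simp
      ultimately show ?thesis by (simp add: r_def deg)
    next
      case False
      then have "degree p < k" "degree (Q d) < k" using that Suc.prems deg[of d] by simp_all
      then show ?thesis by (simp add: r_def coeff_eq_0)
    qed
    then have "degree r < d"
      using False by (metis leading_coeff_0_iff not_less)
    then show ?thesis using Suc by simp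
  qed simp
  moreover have "p * R = r * R + smult (coeff p d / lead_coeff (Q d)) (Q d * R)"
    by (simp add: r_def algebra_simps)
  ultimately show ?case
    using orth[of d] Suc.prems by (simp add: weighted_integral_add weighted_integral_smult)
qed simp

text \<open>For uniqueness, a multiple of \<open>Q i\<close> is subtracted to cancel the leading
  term. The remainder has lower degree, so it is orthogonal to both polynomials of degree
  \<open>i\<close>, hence to itself.\<close>

lemma gegenbauer_eq:
  assumes "0 < m"
  shows "gegenbauer (2 * m + 3) = geg_poly m"
  unfolding gegenbauer_def
proof (rule the_equality)
  show geg: "is_gegenbauer (2 * m + 3) (geg_poly m)"
    using assms by (simp add: is_gegenbauer_iff degree_geg_poly poly_geg_poly_1 geg_poly_orthogonal)
  fix Q assume Q: "is_gegenbauer (2 * m + 3) Q"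
  have Q_deg: "degree (Q k) = k" and Q_1: "poly (Q k) 1 = 1"
    and Q_orth: "k \<noteq> l \<Longrightarrow> weighted_integral m (Q k * Q l) = 0" for k l
    using Q assms by (auto simp: is_gegenbauer_iff)
  have Q_nz: "Q k \<noteq> 0" for k using Q_1[of k] by auto
  have P_nz: "geg_poly m k \<noteq> 0" for k using poly_geg_poly_1[of m k] by auto
  show "Q = geg_poly m"
  proof
    fix i
    let ?P = "geg_poly m i"
    define c where "c = lead_coeff ?P / lead_coeff (Q i)"
    define r where "r = ?P - smult c (Q i)"
    have "r = 0"
    proof (rule ccontr)
      assume "r \<noteq> 0"
      have "coeff r k = 0" if "i \<le> k" for k
      proof (cases "k = i")
        case True
        moreover have "coeff (Q i) i \<noteq> 0"
          using Q_nz[of i] Q_deg[of i] leading_coeff_neq_0[of "Q i"] by simp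
        ultimately show ?thesis by (simp add: r_def c_def Q_deg degree_geg_poly)
      next
        case False
        then show ?thesis using that by (simp add: r_def coeff_eq_0 Q_deg degree_geg_poly)
      qed
      then have deg: "degree r < i" using \<open>r \<noteq> 0\<close> by (metis leading_coeff_0_iff not_less)
      have "weighted_integral m (r * Q i) = 0"
        by (rule orthogonal_to_lower_degree[OF Q_deg Q_nz _ deg order_refl]) (simp add: Q_orth)
      moreover have "weighted_integral m (r * ?P) = 0"
        by (rule orthogonal_to_lower_degree[OF degree_geg_poly P_nz _ deg order_refl])
          (simp add: geg_poly_orthogonal)
      moreover have "r * r = r * ?P - smult c (r * Q i)"
        by (subst (2) r_def) (simp add: right_diff_distrib)
      ultimately have "weighted_integral m (r * r) = 0"
        by (simp add: weighted_integral_diff weighted_integral_smult)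
      then show False using \<open>r \<noteq> 0\<close> weighted_integral_square_eq_0 by blast
    qed
    then have "?P = smult c (Q i)" by (simp add: r_def)
    moreover from this have "c = 1"
      using poly_geg_poly_1[of m i] Q_1[of i] by simp
    ultimately show "Q i = ?P" by simp
  qed
qed

text \<open>Simple zeros at the four end points of \<open>T2\<close> and a double zero at 7/15, so
  that the sign changes only at the ends of the two gaps.\<close>

definition lp_poly :: "real poly" where
  "lp_poly = [:9/15, 1:] * [:5/15, 1:] * [:1/15, 1:] * [:-3/15, 1:] * [:-7/15, 1:]\<^sup>2"

text \<open>Coefficients in dimension 23, the case \<open>m = 10\<close> of \<open>geg_poly\<close>.
  Tightness constrains signs only at index 0 and above the strength, so the negative entry at index
  5 is admissible. The value of \<open>lp_poly\<close> at 1 divided by the first entry is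
  47104.\<close>

definition lp_coeffs :: "nat \<Rightarrow> real" where
  "lp_coeffs i = (if i < 7 then [64/5821875, 64/253125, 37312/33766875, 13376/489375, 1408/104625,
     -352/3915, 4576/8091] ! i else 0)"

lemma lp_poly_expansion: "gegenbauer_expansion 23 lp_poly lp_coeffs"
proof -
  have supp: "{i. lp_coeffs i \<noteq> 0} = {..<7}"
  proof -
    have "lp_coeffs i \<noteq> 0" if "i < 7" for i
    proof -
      have "i \<in> {0, 1, 2, 3, 4, 5, 6}" using that by auto
      then show ?thesis by (auto simp: lp_coeffs_def)
    qed
    then show ?thesis by (auto simp: lp_coeffs_def)
  qed
  have eval: "poly (geg_poly 10 i) t = (\<Sum>j\<le>i. hyper_coeff 10 i j * ((1 - t) / 2) ^ j)" for i t
    by (simp add: geg_poly_def poly_pcompose hyper_poly_def poly_sum poly_monom diff_divide_distrib)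
  have sums: "(\<Sum>j\<le>0. hyper_coeff 10 0 j * s ^ j) = 1"
    "(\<Sum>j\<le>Suc 0. hyper_coeff 10 (Suc 0) j * s ^ j) = 1 - 2 * s"
    "(\<Sum>j\<le>2. hyper_coeff 10 2 j * s ^ j) = 1 - 46 / 11 * s ^ 1 + 46 / 11 * s ^ 2"
    "(\<Sum>j\<le>3. hyper_coeff 10 3 j * s ^ j) = 1 - 72 / 11 * s ^ 1 + 150 / 11 * s ^ 2 - 100 / 11 * s ^ 3"
    "(\<Sum>j\<le>4. hyper_coeff 10 4 j * s ^ j) = 1 - 100 / 11 * s ^ 1 + 325 / 11 * s ^ 2 - 450 / 11 * s ^ 3 + 225 / 11 * s ^ 4"
    "(\<Sum>j\<le>5. hyper_coeff 10 5 j * s ^ j) = 1 - 130 / 11 * s ^ 1 + 585 / 11 * s ^ 2 - 1260 / 11 * s ^ 3 + 1305 / 11 * s ^ 4 - 522 / 11 * s ^ 5"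
    "(\<Sum>j\<le>6. hyper_coeff 10 6 j * s ^ j) = 1 - 162 / 11 * s ^ 1 + 945 / 11 * s ^ 2 - 36540 / 143 * s ^ 3 + 58725 / 143 * s ^ 4 - 48546 / 143 * s ^ 5 + 16182 / 143 * s ^ 6" for s
    by (simp_all add: atMost_nat_numeral atMost_Suc numeral_nat field_simps)
  have "poly lp_poly t = (\<Sum>i<7. lp_coeffs i * poly (geg_poly 10 i) t)" for t
  proof -
    define s where "s = (1 - t) / 2"
    have t: "t = 1 - 2 * s" by (simp add: s_def field_simps)
    have "(\<Sum>i<7. lp_coeffs i * poly (geg_poly 10 i) t) =
        (\<Sum>i<7. lp_coeffs i * (\<Sum>j\<le>i. hyper_coeff 10 i j * s ^ j))"
      by (simp add: eval s_def)
    also have "\<dots> = 64/5821875 + 64/253125 * (1 - 2 * s) + 37312/33766875 * (1 - 46 / 11 * s ^ 1 + 46 / 11 * s ^ 2) + 13376/489375 * (1 - 72 / 11 * s ^ 1 + 150 / 11 * s ^ 2 - 100 / 11 * s ^ 3) + 1408/104625 * (1 - 100 / 11 * s ^ 1 + 325 / 11 * s ^ 2 - 450 / 11 * s ^ 3 + 225 / 11 * s ^ 4) + (- 352/3915) * (1 - 130 / 11 * s ^ 1 + 585 / 11 * s ^ 2 - 1260 / 11 * s ^ 3 + 1305 / 11 * s ^ 4 - 522 / 11 * s ^ 5) + 4576/8091 * (1 - 162 / 11 * s ^ 1 + 945 / 11 * s ^ 2 - 36540 / 143 * s ^ 3 + 58725 / 143 * s ^ 4 - 48546 / 143 * s ^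 5 + 16182 / 143 * s ^ 6)"
      by (simp add: lessThan_nat_numeral lessThan_Suc lp_coeffs_def sums)
    also have "\<dots> = poly lp_poly t"
      unfolding t by (simp add: lp_poly_def field_simps power_numeral_reduce)
    finally show ?thesis ..
  qed
  then have "lp_poly = (\<Sum>i<7. smult (lp_coeffs i) (geg_poly 10 i))"
    by (simp add: poly_eq_poly_eq_iff[symmetric] fun_eq_iff poly_sum)
  then show ?thesis
    using gegenbauer_eq[of 10] by (simp add: gegenbauer_expansion_def supp)
qed

section \<open>The derived code and the linear programming bound\<close>

lemma card_23: "CARD(23) = 23"
  by simp

lemma leech_moment:
  assumes "norm u = 1" "norm x = 1" "u \<bullet> x = 0" "k + j \<le> 11"
  shows "(\<Sum>y\<in>leech_code. (u \<bullet> y) ^ k * (x \<bullet> y) ^ j) = 196560 * joint_moment 24 0 k j"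
proof -
  have "\<forall>p\<in>polynomials_upto 11. (\<Sum>y\<in>leech_code. p y) / real (card leech_code) = sphere_mean p"
    using leech_code_11_design unfolding spherical_design_def by (rule conjunct2)
  from bspec[OF this linear_powers_in_polynomials_upto[OF assms(4), of u x]]
  show ?thesis
    using sphere_mean_joint_moment[OF assms(1,2), of k j] assms(3)
    by (simp add: card_leech_code card_points)
qed

definition leech_neighbours :: "real ^ 23 option \<Rightarrow> (real ^ 23 option) set" where
  "leech_neighbours x = {y \<in> leech_code. x \<bullet> y = 1/4}"

text \<open>The quartic vanishes at the inner products of \<open>leech_code\<close> other than \<open>1/4\<close> and \<open>\<plusminus>1\<close>, so the
  11-design property of \<open>leech_code\<close> gives the moments of the neighbours of \<open>x\<close> up to degree 7.\<close>

lemma leech_neighbours_moment: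
  assumes x: "x \<in> leech_code" and u: "norm u = 1" "u \<bullet> x = 0" and k: "k \<le> 7"
  shows "- 3 / 128 * (\<Sum>y\<in>leech_neighbours x. (u \<bullet> y) ^ k) + 3 / 2 * 0 ^ k =
    196560 * (joint_moment 24 0 k 4 + joint_moment 24 0 k 3 / 4 - joint_moment 24 0 k 2 / 4 -
      joint_moment 24 0 k 1 / 16)"
proof -
  \<comment> \<open>This is \<open>s * (s + 1/4) * (s ^ 2 - 1/4)\<close> multiplied out.\<close>
  define g :: "real \<Rightarrow> real" where "g s = s ^ 4 + s ^ 3 / 4 - s\<^sup>2 / 4 - s / 16" for s
  let ?L = leech_code and ?N = "leech_neighbours x"
  have nx: "norm x = 1" and xx: "x \<bullet> x = 1" using norm_leech_code[OF x] by (simp_all add: norm_eq_1)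
  then have neq: "x \<noteq> - x" by (metis inner_minus_right one_neq_neg_one)
  have fin: "finite ?N" by (simp add: leech_neighbours_def finite_leech_code)
  have "(\<Sum>y\<in>?L. (u \<bullet> y) ^ k * g (x \<bullet> y)) =
      (\<Sum>y\<in>?L. (u \<bullet> y) ^ k * (x \<bullet> y) ^ 4) + (\<Sum>y\<in>?L. (u \<bullet> y) ^ k * (x \<bullet> y) ^ 3) / 4 -
      (\<Sum>y\<in>?L. (u \<bullet> y) ^ k * (x \<bullet> y) ^ 2) / 4 - (\<Sum>y\<in>?L. (u \<bullet> y) ^ k * (x \<bullet> y) ^ 1) / 16"
    unfolding sum_divide_distrib sum.distrib[symmetric] sum_subtractf[symmetric]
    by (simp add: g_def algebra_simps)
  also have "\<dots> = 196560 * (joint_moment 24 0 k 4 + joint_moment 24 0 k 3 / 4 -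
      joint_moment 24 0 k 2 / 4 - joint_moment 24 0 k 1 / 16)"
    using k by (subst (1 2 3 4) leech_moment[OF u(1) nx u(2)]) simp_all
  finally have "(\<Sum>y\<in>?L. (u \<bullet> y) ^ k * g (x \<bullet> y)) = \<dots>" .
  moreover have "(\<Sum>y\<in>?L. (u \<bullet> y) ^ k * g (x \<bullet> y)) = (\<Sum>y\<in>?N \<union> {x, - x}. (u \<bullet> y) ^ k * g (x \<bullet> y))"
  proof (rule sum.mono_neutral_right[OF finite_leech_code])
    show "?N \<union> {x, - x} \<subseteq> ?L" using x uminus_leech_code by (auto simp: leech_neighbours_def)
    show "\<forall>y\<in>?L - (?N \<union> {x, - x}). (u \<bullet> y) ^ k * g (x \<bullet> y) = 0"
    proof
      fix y assume y: "y \<in> ?L - (?N \<union> {x, - x})"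
      then have "x \<bullet> y \<in> {-1/2, -1/4, 0, 1/4, 1/2}"
        using inner_leech_code[of x y] x by (auto simp: equation_minus_iff[of x y])
      moreover have "x \<bullet> y \<noteq> 1/4" using y by (auto simp: leech_neighbours_def)
      ultimately have "g (x \<bullet> y) = 0"
        by (elim insertE emptyE) (simp_all only: g_def, simp_all add: power_divide)
      then show "(u \<bullet> y) ^ k * g (x \<bullet> y) = 0" by simp
    qed
  qed
  also have "\<dots> = (\<Sum>y\<in>?N. (u \<bullet> y) ^ k * g (x \<bullet> y)) + (\<Sum>y\<in>{x, - x}. (u \<bullet> y) ^ k * g (x \<bullet> y))"
    using fin by (intro sum.union_disjoint) (auto simp: leech_neighbours_def xx)
  also have "(\<Sum>y\<in>?N. (u \<bullet> y) ^ k * g (x \<bullet> y)) = (\<Sum>y\<in>?N. (u \<bullet> y) ^ k * (- 3 / 128))"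
  proof (intro sum.cong refl)
    fix y assume "y \<in> ?N"
    then have "x \<bullet> y = 1/4" by (simp only: leech_neighbours_def mem_Collect_eq)
    moreover have "g (1/4) = - 3 / 128" by (simp add: g_def power_divide)
    ultimately show "(u \<bullet> y) ^ k * g (x \<bullet> y) = (u \<bullet> y) ^ k * (- 3 / 128)" by (simp only:)
  qed
  also have "\<dots> = - 3 / 128 * (\<Sum>y\<in>?N. (u \<bullet> y) ^ k)"
    unfolding sum_distrib_right[symmetric] by simp
  \<comment> \<open>As \<open>u\<close> is orthogonal to \<open>x\<close>, the two points contribute
    only for \<open>k = 0\<close>, where \<open>0 ^ 0 = 1\<close> and the values of \<open>g\<close>
    are 15/16 and 9/16.\<close>
  also have "(\<Sum>y\<in>{x, - x}. (u \<bullet> y) ^ k * g (x \<bullet> y)) = 3 / 2 * 0 ^ k"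
    using neq by (simp add: u xx g_def)
  ultimately show ?thesis by simp
qed

lemma card_leech_neighbours:
  assumes x: "x \<in> leech_code"
  shows "card (leech_neighbours x) = 47104"
proof -
  \<comment> \<open>The moment formula in degree 0 counts the neighbours; \<open>u\<close> only has
    to be some unit vector orthogonal to \<open>x\<close>.\<close>
  obtain v where v: "v \<noteq> 0" "orthogonal x v"
    using orthogonal_to_vector_exists[of x] by (auto simp: card_points)
  define u where "u = sgn v"
  have "norm u = 1" "u \<bullet> x = 0"
    using v by (auto simp: u_def norm_sgn sgn_div_norm orthogonal_def inner_commute)
  from leech_neighbours_moment[OF x this, of 0]
  have "- 3 / 128 * real (card (leech_neighbours x)) + 3 / 2 = - 2205 / 2"
    by (simp add: joint_moment_0_rec numeral_3_eq_3)
  then have "real (card (leech_neighbours x)) = 47104" by simp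
  then show ?thesis by linarith
qed

text \<open>\<open>joint_moment 23 1 0 k\<close> is the moment of one coordinate on the sphere in
  dimension 23, and \<open>sqrt (15/16)\<close> is the length of a neighbour projected to the
  hyperplane. The rational moments in dimension 24 thus take the shape of a design in dimension
  23.\<close>

lemma leech_neighbours_sum:
  assumes x: "x \<in> leech_code" and w: "w \<bullet> x = 0" and k: "k \<le> 7"
  shows "(\<Sum>y\<in>leech_neighbours x. (w \<bullet> y) ^ k) =
    47104 * joint_moment 23 1 0 k * sqrt (15/16) ^ k * norm w ^ k"
proof (cases "k = 0")
  case True
  then show ?thesis by (simp add: card_leech_neighbours[OF x])
next
  case k0: False
  show ?thesis
  proof (cases "w = 0")
    case True
    then show ?thesis using k0 by (simp add: power_0_left)
  next
    case False
    define u where "u = sgn w"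
    have u: "norm u = 1" "u \<bullet> x = 0" and wu: "w = norm w *\<^sub>R u"
      using w False by (simp_all add: u_def norm_sgn sgn_div_norm)
    have sq: "sqrt (15/16) ^ 2 = 15/16" "sqrt (15/16) ^ 4 = (15/16)^2" "sqrt (15/16) ^ 6 = (15/16)^3"
    proof -
      show s: "sqrt (15/16) ^ 2 = 15/16" by simp
      show "sqrt (15/16) ^ 4 = (15/16)^2" using power_mult[of "sqrt (15/16)" 2 2] s by simp
      show "sqrt (15/16) ^ 6 = (15/16)^3" using power_mult[of "sqrt (15/16)" 2 3] s by simp
    qed
    have "k \<in> {1, 2, 3, 4, 5, 6, 7}" using k k0 by auto
    then have "(\<Sum>y\<in>leech_neighbours x. (u \<bullet> y) ^ k) = 47104 * joint_moment 23 1 0 k * sqrt (15/16) ^ k"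
      using leech_neighbours_moment[OF x u k]
      by (elim insertE emptyE) (simp_all add: joint_moment_rec joint_moment_0_rec sq power_divide)
    moreover have "(w \<bullet> y) ^ k = norm w ^ k * (u \<bullet> y) ^ k" for y
      by (subst wu) (simp add: power_mult_distrib)
    ultimately show ?thesis by (simp add: sum_distrib_left[symmetric])
  qed
qed

abbreviation quarter_point :: "real ^ 23 option \<Rightarrow> real ^ 23 option \<Rightarrow> real ^ 23 option" where
  "quarter_point x y \<equiv> (1 / sqrt (1 - 1 / 16)) *\<^sub>R (y - (1 / 4) *\<^sub>R x)"

lemma C_quarter_eq: "C_quarter x = quarter_point x ` leech_neighbours x"
  unfolding C_quarter_def leech_neighbours_def by blast

lemma inj_quarter_point: "inj_on (quarter_point x) A"
  by (rule inj_onI) simp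

lemma inner_quarter_point:
  assumes "x \<in> leech_code" "y \<in> leech_neighbours x" "y' \<in> leech_neighbours x"
  shows "quarter_point x y \<bullet> quarter_point x y' = (y \<bullet> y' - 1/16) * (16/15)"
proof -
  have xx: "x \<bullet> x = 1" and xy: "x \<bullet> y' = 1/4" "y \<bullet> x = 1/4"
    using assms norm_leech_code by (auto simp: leech_neighbours_def norm_eq_1 inner_commute)
  have "(y - (1 / 4) *\<^sub>R x) \<bullet> (y' - (1 / 4) *\<^sub>R x) =
      y \<bullet> y' - 1 / 4 * (y \<bullet> x) - 1 / 4 * (x \<bullet> y') + 1 / 16 * (x \<bullet> x)"
    by (simp add: inner_diff_left inner_diff_right algebra_simps)
  then have "(y - (1 / 4) *\<^sub>R x) \<bullet> (y' - (1 / 4) *\<^sub>R x) = y \<bullet> y' - 1/16"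
    unfolding xx xy by simp
  moreover have "(1 / sqrt (1 - 1 / 16)) * (1 / sqrt (1 - 1 / 16)) = 16/15"
    by (simp add: field_simps)
  ultimately show ?thesis
    by (simp only: inner_scaleR_left inner_scaleR_right mult.assoc[symmetric])
qed

lemma quarter_point_orthogonal:
  assumes "x \<in> leech_code" "y \<in> leech_neighbours x"
  shows "x \<bullet> quarter_point x y = 0"
  using assms norm_leech_code by (auto simp: leech_neighbours_def norm_eq_1 inner_diff_right)

lemma C_quarter_sum:
  assumes x: "x \<in> leech_code" and w: "w \<bullet> x = 0" and k: "k \<le> 7"
  shows "(\<Sum>q\<in>C_quarter x. (w \<bullet> q) ^ k) = 47104 * joint_moment 23 1 0 k * norm w ^ k"
proof -
  have "(w \<bullet> quarter_point x y) ^ k = (1 / sqrt (15/16) ^ k) * (w \<bullet> y) ^ k" for y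
    using w by (simp add: inner_diff_right power_divide)
  then have "(\<Sum>q\<in>C_quarter x. (w \<bullet> q) ^ k) =
      (1 / sqrt (15/16) ^ k) * (\<Sum>y\<in>leech_neighbours x. (w \<bullet> y) ^ k)"
    unfolding C_quarter_eq sum.reindex[OF inj_quarter_point] o_def by (simp only: sum_distrib_left)
  also have "\<dots> = 47104 * joint_moment 23 1 0 k * norm w ^ k"
    unfolding leech_neighbours_sum[OF assms] by simp
  finally show ?thesis .
qed

section \<open>Transport of the derived code to dimension 23\<close>

lemma isometric_inner:
  assumes \<phi>: "isometric_on_complement x \<phi>" and v: "x \<bullet> v = 0" "x \<bullet> w = 0"
  shows "\<phi> v \<bullet> \<phi> w = v \<bullet> w"
proof -
  have lin: "linear \<phi>" and nrm: "\<And>v. x \<bullet> v = 0 \<Longrightarrow> norm (\<phi> v) = norm v"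
    using \<phi> by (auto simp: isometric_on_complement_def)
  have "norm (\<phi> v + \<phi> w) = norm (v + w)"
    using nrm[of "v + w"] v by (simp add: linear_add[OF lin] inner_add_right)
  then show ?thesis using nrm v by (simp add: dot_norm)
qed

text \<open>Norm preservation makes the map injective on the hyperplane, whose dimension 24 - 1 is
  that of the target.\<close>

lemma isometric_surj:
  assumes x: "x \<noteq> 0" and \<phi>: "isometric_on_complement x \<phi>"
  obtains w where "x \<bullet> w = 0" "\<phi> w = v"
proof -
  have lin: "linear \<phi>" and nrm: "\<And>v. x \<bullet> v = 0 \<Longrightarrow> norm (\<phi> v) = norm v"
    using \<phi> by (auto simp: isometric_on_complement_def)
  let ?S = "{v. x \<bullet> v = 0}"
  have sub: "subspace ?S" by (rule subspace_hyperplane)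
  have "inj_on \<phi> (span ?S)"
  proof (rule inj_onI)
    fix a b assume "a \<in> span ?S" "b \<in> span ?S" and eq: "\<phi> a = \<phi> b"
    then have "x \<bullet> (a - b) = 0" using sub by (auto simp: span_eq_iff[THEN iffD2] inner_diff_right)
    then have "norm (a - b) = norm (\<phi> (a - b))" by (simp add: nrm)
    then show "a = b" by (simp add: linear_diff[OF lin] eq)
  qed
  then have "dim (\<phi> ` ?S) = dim ?S" by (rule dim_image_eq[OF lin])
  also have "\<dots> = 23" using x by (simp add: dim_hyperplane card_points)
  finally have "span (\<phi> ` ?S) = UNIV" by (subst dim_eq_full[symmetric]) simp
  moreover have "span (\<phi> ` ?S) = \<phi> ` ?S"
    using linear_subspace_image[OF lin sub] by (rule span_eq_iff[THEN iffD2])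
  ultimately have "v \<in> \<phi> ` ?S" by simp
  then show ?thesis using that by blast
qed

theorem C_quarter_design:
  assumes x: "x \<in> leech_code" and \<phi>: "isometric_on_complement x \<phi>"
  shows "card (\<phi> ` C_quarter x) = 47104" "spherical_design 7 (\<phi> ` C_quarter x)"
    "T_avoiding T2 (\<phi> ` C_quarter x)"
proof -
  let ?Q = "C_quarter x"
  have lin: "linear \<phi>" and nrm: "\<And>v. x \<bullet> v = 0 \<Longrightarrow> norm (\<phi> v) = norm v"
    using \<phi> by (auto simp: isometric_on_complement_def)
  have xQ: "x \<bullet> q = 0" if "q \<in> ?Q" for q
    using that quarter_point_orthogonal[OF x] unfolding C_quarter_eq by blast
  have nQ: "norm q = 1" if q: "q \<in> ?Q" for q
  proof -
    obtain y where y: "y \<in> leech_neighbours x" "q = quarter_point x y"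
      using q unfolding C_quarter_eq by blast
    have "y \<bullet> y = 1" using y(1) norm_leech_code by (auto simp: leech_neighbours_def norm_eq_1)
    then show ?thesis unfolding norm_eq_1 y(2) inner_quarter_point[OF x y(1) y(1)] by simp
  qed
  have x0: "x \<noteq> 0" using norm_leech_code[OF x] by auto
  have inj: "inj_on \<phi> ?Q"
  proof (rule inj_onI)
    fix a b assume "a \<in> ?Q" "b \<in> ?Q" and eq: "\<phi> a = \<phi> b"
    then have "x \<bullet> (a - b) = 0" by (simp add: xQ inner_diff_right)
    then have "norm (a - b) = norm (\<phi> (a - b))" by (simp add: nrm)
    then show "a = b" by (simp add: linear_diff[OF lin] eq)
  qed
  have card_Q: "card ?Q = 47104"
    unfolding C_quarter_eq card_image[OF inj_quarter_point] by (rule card_leech_neighbours[OF x])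
  then show card: "card (\<phi> ` ?Q) = 47104" by (simp add: card_image[OF inj])
  have fin: "finite ?Q" by (rule card_ge_0_finite) (simp add: card_Q)
  show "spherical_design 7 (\<phi> ` ?Q)"
    unfolding spherical_design_iff_power_means
  proof (intro conjI allI impI)
    show "spherical_code (\<phi> ` ?Q)"
      unfolding spherical_code_def
    proof (intro conjI subsetI)
      fix p assume "p \<in> \<phi> ` ?Q"
      then obtain q where "q \<in> ?Q" "p = \<phi> q" by blast
      then show "p \<in> sphere 0 1" using nrm[OF xQ[of q]] nQ[of q] by simp
    qed (simp add: fin)
    fix k :: nat and v :: "real ^ 23" assume k: "k \<le> 7"
    \<comment> \<open>Pulling the test vector back into the hyperplane turns moments of the image
      into moments of \<open>C_quarter x\<close>.\<close>
    obtain w where w: "x \<bullet> w = 0" "\<phi> w = v"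
      using isometric_surj[OF x0 \<phi>, of v] .
    obtain e :: "real ^ 23" where e: "norm e = 1" using vector_choose_size[of 1] by auto
    have "(\<Sum>p\<in>\<phi> ` ?Q. (v \<bullet> p) ^ k) = (\<Sum>q\<in>?Q. (w \<bullet> q) ^ k)"
      unfolding sum.reindex[OF inj] o_def
      by (intro sum.cong refl) (simp add: w(2)[symmetric] isometric_inner[OF \<phi> w(1)] xQ)
    also have "\<dots> = 47104 * joint_moment 23 1 0 k * norm w ^ k"
      using w(1) by (intro C_quarter_sum[OF x _ k]) (simp add: inner_commute)
    also have "norm w = norm v" using nrm[OF w(1)] w(2) by simp
    also have "joint_moment 23 1 0 k = sphere_mean (\<lambda>z. (e \<bullet> z) ^ k)"
      using sphere_mean_joint_moment[OF e e, of 0 k, unfolded card_23] e by (simp add: norm_eq_1)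
    finally show "(\<Sum>p\<in>\<phi> ` ?Q. (v \<bullet> p) ^ k) / real (card (\<phi> ` ?Q)) = sphere_mean (\<lambda>z. (v \<bullet> z) ^ k)"
      using sphere_mean_power[OF e, of v k] by (simp add: card)
  qed
  show "T_avoiding T2 (\<phi> ` ?Q)"
  proof -
    have "\<phi> a \<bullet> \<phi> b \<notin> T2" if a: "a \<in> ?Q" and b: "b \<in> ?Q" and ab: "\<phi> a \<noteq> \<phi> b" for a b
    proof -
      obtain y where y: "y \<in> leech_neighbours x" "a = quarter_point x y"
        using a unfolding C_quarter_eq by blast
      obtain z where z: "z \<in> leech_neighbours x" "b = quarter_point x z"
        using b unfolding C_quarter_eq by blast
      have "y \<noteq> z" using ab y(2) z(2) by blast
      \<comment> \<open>Both have inner product 1/4 with \<open>x\<close>, whereas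
        \<open>- z\<close> would have -1/4.\<close>
      moreover have "y \<noteq> - z" using y(1) z(1) by (auto simp: leech_neighbours_def)
      ultimately have "y \<bullet> z \<in> {-1/2, -1/4, 0, 1/4, 1/2}"
        using y z by (intro inner_leech_code) (auto simp: leech_neighbours_def)
      moreover have "\<phi> a \<bullet> \<phi> b = (y \<bullet> z - 1/16) * (16/15)"
        unfolding isometric_inner[OF \<phi> xQ[OF a] xQ[OF b]] unfolding y(2) z(2)
        by (rule inner_quarter_point[OF x y(1) z(1)])
      \<comment> \<open>The values are -9/15, -5/15, -1/15, 3/15 and 7/15. The first four are the
        end points of the open intervals of \<open>T2\<close>.\<close>
      ultimately show ?thesis by (auto simp: T2_def)
    qed
    then show ?thesis by (auto simp: T_avoiding_def code_inner_products_def)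
  qed
qed

section \<open>The lower bound for avoiding designs\<close>

lemma lp_poly_nonneg: "t \<in> {-1..1} - T2 \<Longrightarrow> 0 \<le> poly lp_poly t"
proof -
  assume "t \<in> {-1..1} - T2"
  then have "0 \<le> (t + 9/15) * (t + 5/15)" "0 \<le> (t + 1/15) * (t - 3/15)"
    by (auto simp: T2_def zero_le_mult_iff)
  from mult_nonneg_nonneg[OF mult_nonneg_nonneg[OF this] zero_le_power2]
  have "0 \<le> ((t + 9/15) * (t + 5/15)) * ((t + 1/15) * (t - 3/15)) * (t - 7/15)\<^sup>2" .
  also have "\<dots> = poly lp_poly t"
    by (simp add: lp_poly_def field_simps power_numeral_reduce power2_eq_square)
  finally show "0 \<le> poly lp_poly t" .
qed

lemma poly_lp_poly: "poly lp_poly t = - 49 / 84375 - 1526 / 253125 * t ^ 1 + 2399 / 50625 * t ^ 2 + 52 / 675 * t ^ 3 - 7 / 15 * t ^ 4 - 2 / 15 * t ^ 5 + 1 * t ^ 6"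
  by (simp add: lp_poly_def field_simps power_numeral_reduce)

text \<open>With a single point \<open>x\<close> of \<open>C\<close> fixed, the design property
  already gives the sum of the sextic over all \<open>x \<bullet> y\<close> as \<open>card C\<close>
  times its mean. The terms with \<open>y \<noteq> x\<close> are nonnegative, so the term at 1
  bounds this from below.\<close>

theorem avoiding_design_lower_bound:
  fixes C :: "(real ^ 23) set"
  assumes design: "spherical_design 6 C" and avoid: "T_avoiding T2 C"
  shows "47104 \<le> card C"
proof -
  have C: "finite C" "C \<subseteq> sphere 0 1"
    using design by (auto simp: spherical_design_iff_power_means spherical_code_def)
  have mean: "(\<Sum>x\<in>C. (u \<bullet> x) ^ k) / real (card C) = sphere_mean (\<lambda>z. (u \<bullet> z) ^ k)" if "k \<le> 6" for k u
  proof -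
    have "\<forall>k\<le>6. \<forall>u. (\<Sum>x\<in>C. (u \<bullet> x) ^ k) / real (card C) = sphere_mean (\<lambda>z. (u \<bullet> z) ^ k)"
      using design unfolding spherical_design_iff_power_means by (rule conjunct2)
    then show ?thesis using that by simp
  qed
  \<comment> \<open>Degree 0 excludes the empty code, for which the quotient would be 0.\<close>
  have "real (card C) / real (card C) = 1"
    using mean[of 0 0] sphere.prob_space by simp
  then have "C \<noteq> {}" by auto
  then obtain x where x: "x \<in> C" by blast
  then have nx: "norm x = 1" and xx: "x \<bullet> x = 1" using C(2) by (auto simp: norm_eq_1)
  have card: "real (card C) > 0" using C(1) x by (auto simp: card_gt_0_iff)
  have moment: "(\<Sum>y\<in>C. (x \<bullet> y) ^ k) = real (card C) * joint_moment 23 1 0 k" if "k \<le> 6" for k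
    using mean[OF that, of x] sphere_mean_joint_moment[OF nx nx, of 0 k, unfolded card_23] card by (simp add: xx field_simps)
  have pow: "(\<Sum>y\<in>C. x \<bullet> y) = (\<Sum>y\<in>C. (x \<bullet> y) ^ 1)" by simp
  have "poly lp_poly 1 = poly lp_poly (x \<bullet> x)" by (simp add: xx)
  also have "\<dots> \<le> (\<Sum>y\<in>C. poly lp_poly (x \<bullet> y))"
  proof (rule member_le_sum[OF x _ C(1)])
    fix y assume y: "y \<in> C - {x}"
    have "x \<bullet> y \<in> {-1..1}"
      using Cauchy_Schwarz_ineq2[of x y] nx y C(2) by (auto simp: abs_le_iff)
    moreover have "x \<bullet> y \<notin> T2"
      using avoid x y by (auto simp: T_avoiding_def code_inner_products_def)
    ultimately show "0 \<le> poly lp_poly (x \<bullet> y)" by (intro lp_poly_nonneg) simp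
  qed
  \<comment> \<open>The constant is \<open>lp_coeffs 0\<close>, here computed as the mean of the
    sextic from its power moments.\<close>
  also have "\<dots> = real (card C) * (64/5821875)"
    unfolding poly_lp_poly
    by (simp only: sum.distrib sum_subtractf sum_negf sum_distrib_left[symmetric] moment)
      (simp add: moment pow joint_moment_0_rec numeral_3_eq_3 algebra_simps del: power_one_right)
  finally have "64/5821875 * 47104 \<le> real (card C) * (64/5821875)"
    by (simp add: lp_poly_def power2_eq_square)
  then show ?thesis by simp
qed

lemma exists_C_quarter_design:
  obtains x \<phi> where "x \<in> leech_code" "isometric_on_complement x \<phi>"
proof -
  have "leech_code \<noteq> {}" using card_leech_code by auto
  then obtain x where x: "x \<in> leech_code" by blast
  let ?S = "{v. x \<bullet> v = 0}"
  have "x \<noteq> 0" using norm_leech_code[OF x] by auto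
  then have dim: "dim ?S \<le> dim (UNIV :: (real ^ 23) set)"
    by (simp add: dim_hyperplane card_points)
  show ?thesis
  proof (rule isometry_subset_subspace[OF subspace_hyperplane subspace_UNIV dim])
    fix \<phi> :: "real ^ 23 option \<Rightarrow> real ^ 23"
    assume "linear \<phi>" "\<And>v. v \<in> ?S \<Longrightarrow> norm (\<phi> v) = norm v"
    then have "isometric_on_complement x \<phi>" by (simp add: isometric_on_complement_def)
    with x show ?thesis by (rule that)
  qed
qed

lemma spherical_design_mono:
  assumes "spherical_design d C" "d' \<le> d"
  shows "spherical_design d' C"
  unfolding spherical_design_iff_power_means
proof (intro conjI allI impI)
  show "spherical_code C"
    using assms(1) unfolding spherical_design_iff_power_means by (rule conjunct1)
  fix k u assume "k \<le> d'"
  then have "k \<le> d" using assms(2) by simp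
  moreover have "\<forall>k\<le>d. \<forall>u. (\<Sum>x\<in>C. (u \<bullet> x) ^ k) / real (card C) = sphere_mean (\<lambda>z. (u \<bullet> z) ^ k)"
    using assms(1) unfolding spherical_design_iff_power_means by (rule conjunct2)
  ultimately show "(\<Sum>x\<in>C. (u \<bullet> x) ^ k) / real (card C) = sphere_mean (\<lambda>z. (u \<bullet> z) ^ k)"
    by simp
qed

theorem theorem6p2:
  shows "min_avoiding_design TYPE(23) 6 T2 = 47104 \<and>
         min_avoiding_design TYPE(23) 7 T2 = 47104 \<and>
         (\<forall>x \<phi>. x \<in> leech_code \<longrightarrow> isometric_on_complement x \<phi> \<longrightarrow>
            tight_avoiding_design 7 T2 (\<phi> ` C_quarter x))"
proof (intro conjI allI impI)
  obtain x \<phi> where x: "x \<in> leech_code" and \<phi>: "isometric_on_complement x \<phi>"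
    by (rule exists_C_quarter_design)
  note C = C_quarter_design[OF x \<phi>]
  \<comment> \<open>Both strengths at once: the witness is a 7-design, and the lower bound holds for
    6-designs.\<close>
  have *: "min_avoiding_design TYPE(23) \<tau> T2 = 47104" if \<tau>: "6 \<le> \<tau>" "\<tau> \<le> 7" for \<tau>
    unfolding min_avoiding_design_def
  proof (rule cInf_eq_minimum)
    show "47104 \<in> {card C | C :: (real ^ 23) set. spherical_design \<tau> C \<and> T_avoiding T2 C}"
      using C spherical_design_mono[OF C(2) \<tau>(2)] by (intro CollectI exI[of _ "\<phi> ` C_quarter x"]) simp
    fix N assume "N \<in> {card C | C :: (real ^ 23) set. spherical_design \<tau> C \<and> T_avoiding T2 C}"
    then obtain D :: "(real ^ 23) set" where "N = card D" "spherical_design \<tau> D" "T_avoiding T2 D"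
      by blast
    then show "47104 \<le> N"
      using avoiding_design_lower_bound[OF spherical_design_mono[OF _ \<tau>(1)]] by blast
  qed
  show "min_avoiding_design TYPE(23) 6 T2 = 47104" by (rule *) simp_all
  show "min_avoiding_design TYPE(23) 7 T2 = 47104" by (rule *) simp_all
next
  fix x \<phi> assume x: "x \<in> leech_code" and \<phi>: "isometric_on_complement x \<phi>"
  note C = C_quarter_design[OF x \<phi>]
  have "gegenbauer_expansion CARD(23) lp_poly lp_coeffs"
    using lp_poly_expansion by simp
  moreover have "\<forall>t \<in> {-1..1} - T2. poly lp_poly t \<ge> 0" using lp_poly_nonneg by blast
  moreover have "lp_coeffs 0 > 0" "\<forall>i \<ge> 7 + 1. lp_coeffs i \<le> 0"
    by (simp_all add: lp_coeffs_def)
  moreover have "real (card (\<phi> ` C_quarter x)) = poly lp_poly 1 / lp_coeffs 0"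
    by (simp add: C lp_poly_def lp_coeffs_def power2_eq_square)
  ultimately show "tight_avoiding_design 7 T2 (\<phi> ` C_quarter x)"
    unfolding tight_avoiding_design_def using C(2,3) by blast
qed

end
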